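(* If $\mathbb{E}|\mu_0|^\varepsilon<\infty$ for some $\varepsilon>0$ and $\mathbb{E}\sigma_0^2\in(0,\infty)$, then for every $x\in\mathbb{R}$, $$\mathbb{E}_\xi\left(\left.\frac{Z_n(-\infty,b_nx+a_n]}{Z_n(\mathbb{R})}\right|Z_n(\mathbb{R})>0\right)\to\Phi(x)\quad\text{a.s.},$$ $$\mathbb{E}\left(\left.\frac{Z_n(-\infty,b_nx+a_n]}{Z_n(\mathbb{R})}\right|Z_n(\mathbb{R})>0\right)\to\Phi(x),$$ where $a_n=\sum_{i=0}^{n-1}\mu_i$ and $b_n=\left(\sum_{i=0}^{n-1}\sigma_i^2\right)^{1/2}$.
   Context: Branching random walk in a random environment in time. Let $\xi=(\xi_n)_{n\ge 0}$ be a stationary and ergodic sequence of random variables with values in a measurable space $\Theta$; each realization of $\xi_n$ determines a probability distribution $\eta_n=\eta(\xi_n)$ on $\mathbb{N}\times\mathbb{R}\times\mathbb{R}\times\cdots$. Given $\xi$ (quenched law $\mathbb{P}_\xi$, expectation $\mathbb{E}_\xi$), let $X(u)=(N(u),L_1(u),L_2(u),\dots)$, indexed by finite sequences $u\in\{\emptyset\}\cup\bigcup_{n\ge1}\mathbb{N}^n$, be independent random vectors, $X(u)$ having law $\eta_n$ when the length $|u|$ equals $n$ (values $L_i(u)$ with $i>N(u)$ play no role). The initial particle $\emptyset$ is at $S_\emptyset=0$; each particle $u$ of generation $n$, located at $S_u$, is replaced by $N(u)$ particles $ui$ of generation $n+1$ located at $S_{ui}=S_u+L_i(u)$, $1\le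 i\le N(u)$. Let $\mathbb{T}_n$ be the set of particles of generation $n$ and $Z_n=\sum_{u\in\mathbb{T}_n}\delta_{S_u}$ their counting measure. The annealed law $\mathbb{P}$ (expectation $\mathbb{E}$) is $\mathbb{P}_\xi$ integrated against the law of $\xi$; "a.s." refers to $\mathbb{P}$. $\mathbb{E}_\xi(\cdot\,|\,B)$ and $\mathbb{E}(\cdot\,|\,B)$ denote conditional expectation given the event $B$ under $\mathbb{P}_\xi$ and $\mathbb{P}$ respectively. Write $N=N(\emptyset)$ and $m_n=\mathbb{E}_\xi N(u)$ for $|u|=n$. Standing assumption: $\mathbb{E}\log m_0\in(0,\infty)$ and $\mathbb{E}\frac{N}{m_0}\log^+N<\infty$. Notation: for $|u|=n$, $\mu_n=\frac1{m_n}\mathbb{E}_\xi\sum_{i=1}^{N(u)}L_i(u)$ and $\sigma_n^2=\frac1{m_n}\mathbb{E}_\xi\sum_{i=1}^{N(u)}(L_i(u)-\mu_n)^2$. $\Phi$ is the distribution function of the standard normal law. *)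

theory Defs
  imports "HOL-Probability.Probability"
begin

subsection \<open>Stationary ergodic environments\<close>

definition env_law :: "'w measure \<Rightarrow> 't measure \<Rightarrow> (nat \<Rightarrow> 'w \<Rightarrow> 't) \<Rightarrow> (nat \<Rightarrow> 't) measure" where
  "env_law M \<Theta> \<xi> = distr M (\<Pi>\<^sub>M n\<in>UNIV. \<Theta>) (\<lambda>w n. \<xi> n w)"

definition stationary_seq :: "'w measure \<Rightarrow> 't measure \<Rightarrow> (nat \<Rightarrow> 'w \<Rightarrow> 't) \<Rightarrow> bool" where
  "stationary_seq M \<Theta> \<xi> \<longleftrightarrow> env_law M \<Theta> (\<lambda>n. \<xi> (Suc n)) = env_law M \<Theta> \<xi>"

definition ergodic_seq :: "'w measure \<Rightarrow> 't measure \<Rightarrow> (nat \<Rightarrow> 'w \<Rightarrow> 't) \<Rightarrow> bool" where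
  "ergodic_seq M \<Theta> \<xi> \<longleftrightarrow>
     (\<forall>A\<in>sets (\<Pi>\<^sub>M n\<in>(UNIV::nat set). \<Theta>).
        {s \<in> space (\<Pi>\<^sub>M n\<in>(UNIV::nat set). \<Theta>). (\<lambda>n. s (Suc n)) \<in> A} = A \<longrightarrow>
        measure (env_law M \<Theta> \<xi>) A = 0 \<or> measure (env_law M \<Theta> \<xi>) A = 1)"

subsection \<open>The branching random walk\<close>

text \<open>
  A mark \<^term>\<open>(N, L) :: nat \<times> (nat \<Rightarrow> real)\<close> gives the number of children of a particle and
  their displacements. Children are numbered from \<open>0\<close>, so \<^term>\<open>L i\<close> stands for
  \<open>L\<^sub>i\<^sub>+\<^sub>1\<close> and only the values with \<^prop>\<open>i < N\<close> matter. Particles are finite sequences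
  of child numbers, oldest ancestor first.
\<close>

type_synonym mark = "nat \<times> (nat \<Rightarrow> real)"
type_synonym marks = "nat list \<Rightarrow> mark"

definition mark_space :: "mark measure" where
  "mark_space = count_space UNIV \<Otimes>\<^sub>M (\<Pi>\<^sub>M i\<in>UNIV. borel)"

text \<open>
  The quenched law is the law of the independent family of marks given the environment
  \<^term>\<open>s\<close>, the annealed law is the joint law of the environment and the marks.
\<close>

definition quenched :: "('t \<Rightarrow> mark measure) \<Rightarrow> (nat \<Rightarrow> 't) \<Rightarrow> marks measure" where
  "quenched \<eta> s = (\<Pi>\<^sub>M u\<in>UNIV. \<eta> (s (length u)))"

definition annealed :: "('t \<Rightarrow> mark measure) \<Rightarrow> (nat \<Rightarrow> 't) measure \<Rightarrow> ((nat \<Rightarrow> 't) \<times> marks) measure" where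
  "annealed \<eta> \<nu> =
     \<nu> \<bind> (\<lambda>s. quenched \<eta> s \<bind> (\<lambda>X. return (\<nu> \<Otimes>\<^sub>M (\<Pi>\<^sub>M u\<in>UNIV. mark_space)) (s, X)))"

primrec generation :: "marks \<Rightarrow> nat \<Rightarrow> nat list set" where
  "generation X 0 = {[]}"
| "generation X (Suc n) = {u @ [i] |u i. u \<in> generation X n \<and> i < fst (X u)}"

text \<open>Satisfies \<open>position X [] = 0\<close> and \<open>position X (u @ [i]) = position X u + snd (X u) i\<close>.\<close>

definition position :: "marks \<Rightarrow> nat list \<Rightarrow> real" where
  "position X u = (\<Sum>k<length u. snd (X (take k u)) (u ! k))"

text \<open>The sum of the Dirac measures at the positions of the particles of generation \<^term>\<open>n\<close>.\<close>

definition Z :: "marks \<Rightarrow> nat \<Rightarrow> real measure" where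
  "Z X n = distr (count_space (generation X n)) borel (position X)"

definition cond_expectation :: "'a measure \<Rightarrow> ('a \<Rightarrow> bool) \<Rightarrow> ('a \<Rightarrow> real) \<Rightarrow> real" where
  "cond_expectation M B f = (\<integral>x. f x \<partial>uniform_measure M {x \<in> space M. B x})"

subsection \<open>Quenched moments and norming constants\<close>

text \<open>
  Under \<^term>\<open>quenched \<eta> s\<close> the mark of a particle of generation \<^term>\<open>n\<close> has law \<^term>\<open>\<eta> (s n)\<close>.
  Non-negative quantities that may be infinite have values in \<^typ>\<open>ennreal\<close>. The real \<open>mean_disp\<close>
  is the actual mean whenever \<open>mean_offspring\<close> and \<open>var_disp\<close> are finite: in that case
  \<open>\<Sum>i<N. \<bar>L i\<bar> \<le> \<Sum>i<N. (1 + \<bar>\<mu>\<bar> + (L i - \<mu>)\<^sup>2)\<close> is integrable, with \<open>\<mu>\<close> the value of \<open>mean_disp\<close>.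
\<close>

definition mean_offspring :: "('t \<Rightarrow> mark measure) \<Rightarrow> (nat \<Rightarrow> 't) \<Rightarrow> nat \<Rightarrow> ennreal" where
  "mean_offspring \<eta> s n = (\<integral>\<^sup>+p. of_nat (fst p) \<partial>\<eta> (s n))"

definition mean_disp :: "('t \<Rightarrow> mark measure) \<Rightarrow> (nat \<Rightarrow> 't) \<Rightarrow> nat \<Rightarrow> real" where
  "mean_disp \<eta> s n = (\<integral>p. (\<Sum>i<fst p. snd p i) \<partial>\<eta> (s n)) / enn2real (mean_offspring \<eta> s n)"

definition var_disp :: "('t \<Rightarrow> mark measure) \<Rightarrow> (nat \<Rightarrow> 't) \<Rightarrow> nat \<Rightarrow> ennreal" where
  "var_disp \<eta> s n =
     (\<integral>\<^sup>+p. ennreal (\<Sum>i<fst p. (snd p i - mean_disp \<eta> s n)\<^sup>2) \<partial>\<eta> (s n)) / mean_offspring \<eta> s n"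

definition centering :: "('t \<Rightarrow> mark measure) \<Rightarrow> (nat \<Rightarrow> 't) \<Rightarrow> nat \<Rightarrow> real" where
  "centering \<eta> s n = (\<Sum>i<n. mean_disp \<eta> s i)"

definition scaling :: "('t \<Rightarrow> mark measure) \<Rightarrow> (nat \<Rightarrow> 't) \<Rightarrow> nat \<Rightarrow> real" where
  "scaling \<eta> s n = sqrt (\<Sum>i<n. enn2real (var_disp \<eta> s i))"

definition log_plus :: "real \<Rightarrow> real" where
  "log_plus x = max 0 (ln x)"

end

theory Submission
  imports Defs "HOL-Real_Asymp.Real_Asymp"
begin

text \<open>
  Fix the environment. Cut the tree at generation \<open>k\<close> and let \<open>W\<close> be the population normalised by its
  mean. Given the first \<open>k\<close> generations, the normalised counting measure of generation \<open>n\<close> is an average of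
  independent contributions of the particles of generation \<open>k\<close>. Their means are probabilities for a random walk
  with independent steps and obey Lindeberg's theorem, the Lindeberg condition being a consequence of the ergodic
  theorem. Their fluctuations are small in \<open>L\<^sup>2\<close> after truncation, provided that \<open>W\<close> is uniformly integrable for
  the environment seen from generation \<open>k\<close>. By recurrence one bound for the uniform integrability is available for
  infinitely many \<open>k\<close>, so \<open>k\<close> can be chosen before \<open>n \<rightarrow> \<infinity>\<close>, and only convergence in probability is needed.

  Uniform integrability follows from the size-biased recursion
  \<open>E W\<^sub>n\<^sub>+\<^sub>1 min 1 (l W\<^sub>n\<^sub>+\<^sub>1) \<le> E' W\<^sub>n min 1 (l W\<^sub>n / m) + E (N / m) min 1 (l N / m)\<close>, where \<open>E'\<close> refers to
  the shifted environment, and from \<open>E (N / m) log\<^sup>+ N < \<infinity>\<close>. Division by the population needs that \<open>W\<close> is not small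
  on survival: the extinction probability and the limit at infinity of the Laplace transform of \<open>W\<close> solve the same
  fixed point equation along the shift, and convexity of the generating functions with stationarity shows that they agree.
\<close>

section \<open>The ergodic theorem\<close>

text \<open>The obstacle is the order of choices. Given generation \<open>k\<close>, the truncated
  fluctuation has second moment of order \<open>K^2 / prod_mean e k\<close>, where \<open>K\<close>
  truncates the population of the subtrees rooted in generation \<open>k\<close>. A \<open>K\<close>
  obtained from the environment shifted by \<open>k\<close> depends on \<open>k\<close> and need not
  be small against \<open>prod_mean e k\<close>; a single \<open>K\<close> that serves arbitrarily
  large \<open>k\<close> breaks this circle. No martingale limit is ever formed. The Laplace
  transforms increase with the generation, and their limits are all that is used. Independence
  enters only through the decomposition of a tree into its root mark and a family of independent
  subtrees, so facts about generation \<open>k\<close> are proved by induction at the root, with the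
  environment shifted at each step. Positions join this recursion by subtracting the displacement of
  each child from a barrier \<open>y\<close>. Conditioning on survival costs nothing at the end: the
  ratios lie between 0 and 1 and the survival probability has a positive limit, so convergence in
  mean on survival is enough.\<close>

locale ergodic_system = prob_space M for M :: "'a measure" +
  fixes T :: "'a \<Rightarrow> 'a"
  assumes T_measurable [measurable]: "T \<in> M \<rightarrow>\<^sub>M M"
    and distr_T: "distr M M T = M"
    and ergodic: "\<And>A. A \<in> sets M \<Longrightarrow> T -` A \<inter> space M = A \<Longrightarrow> prob A = 0 \<or> prob A = 1"
begin

lemma funpow_measurable [measurable]: "T ^^ n \<in> M \<rightarrow>\<^sub>M M"
  by (induction n) (auto intro: measurable_compose simp: comp_def)

lemma distr_funpow: "distr M M (T ^^ n) = M"
proof (induction n)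
  case 0
  then show ?case by (simp add: id_def distr_id2)
next
  case (Suc n)
  have "distr M M (T ^^ Suc n) = distr (distr M M T) M (T ^^ n)"
    by (subst distr_distr) (auto simp: funpow_Suc_right simp del: funpow.simps)
  also have "\<dots> = M" by (simp only: distr_T Suc)
  finally show ?case .
qed

lemma nn_integral_funpow:
  assumes [measurable]: "f \<in> borel_measurable M"
  shows "(\<integral>\<^sup>+x. f ((T ^^ n) x) \<partial>M) = (\<integral>\<^sup>+x. f x \<partial>M)"
  by (subst (2) distr_funpow[of n, symmetric]) (simp add: nn_integral_distr)

lemma integrable_funpow:
  fixes f :: "'a \<Rightarrow> real"
  assumes "integrable M f"
  shows "integrable M (\<lambda>x. f ((T ^^ n) x))"
  by (rule integrable_distr[OF funpow_measurable]) (simp add: distr_funpow assms)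

lemma integral_funpow:
  fixes f :: "'a \<Rightarrow> real"
  assumes [measurable]: "f \<in> borel_measurable M"
  shows "(\<integral>x. f ((T ^^ n) x) \<partial>M) = (\<integral>x. f x \<partial>M)"
  by (subst (2) distr_funpow[of n, symmetric]) (simp add: integral_distr)

lemma AE_funpow:
  assumes "AE x in M. Q x"
  shows "AE x in M. \<forall>n. Q ((T ^^ n) x)"
proof (subst AE_all_countable, rule allI)
  fix n
  show "AE x in M. Q ((T ^^ n) x)"
    by (rule AE_distrD[OF funpow_measurable]) (simp only: distr_funpow assms)
qed

definition birkhoff_sum :: "('a \<Rightarrow> real) \<Rightarrow> nat \<Rightarrow> 'a \<Rightarrow> real" where
  "birkhoff_sum f n x = (\<Sum>i<n. f ((T ^^ i) x))"

lemma birkhoff_sum_Suc: "birkhoff_sum f (Suc n) x = f x + birkhoff_sum f n (T x)"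
  by (simp add: birkhoff_sum_def sum.lessThan_Suc_shift funpow_swap1 del: sum.lessThan_Suc funpow.simps(2))
    (simp add: funpow_swap1)

primrec max_sum :: "('a \<Rightarrow> real) \<Rightarrow> nat \<Rightarrow> 'a \<Rightarrow> real" where
  "max_sum f 0 x = f x"
| "max_sum f (Suc n) x = f x + max 0 (max_sum f n (T x))"

lemma max_sum_mono: "max_sum f n x \<le> max_sum f (Suc n) x"
proof (induction n arbitrary: x)
  case (Suc n)
  have "f x + max 0 (max_sum f n (T x)) \<le> f x + max 0 (max_sum f (Suc n) (T x))"
    using Suc[of "T x"] by (intro add_left_mono max.mono) auto
  then show ?case by simp
qed simp

lemma birkhoff_sum_le_max_sum: "birkhoff_sum f (Suc n) x \<le> max_sum f n x"
proof (induction n arbitrary: x)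
  case 0
  then show ?case by (simp add: birkhoff_sum_def)
next
  case (Suc n)
  then show ?case by (subst birkhoff_sum_Suc) (simp add: max.coboundedI2)
qed

text \<open>\<open>max_sum f n\<close> is the maximum of the first \<open>n + 1\<close> Birkhoff sums. On the invariant set where it
  tends to infinity, \<open>max_sum f (n + 1) - max_sum f n \<circ> T\<close> decreases to \<open>f\<close>, and its integral is
  nonnegative by invariance of the measure.\<close>

lemma birkhoff_sums_bounded_above:
  assumes f: "integrable M f" and neg: "(\<integral>x. f x \<partial>M) < 0"
  shows "AE x in M. \<exists>B. \<forall>n. birkhoff_sum f n x \<le> B"
proof -
  note [measurable] = borel_measurable_integrable[OF f]
  have meas [measurable]: "max_sum f n \<in> borel_measurable M" for n
    by (induction n) (auto intro!: borel_measurable_add borel_measurable_max measurable_compose[OF T_measurable])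
  have int: "integrable M (max_sum f n)" for n
  proof (induction n)
    case (Suc n)
    have "integrable M (\<lambda>x. max_sum f n (T x))"
      using integrable_funpow[OF Suc, of 1] by simp
    then show ?case using f by simp
  qed (use f in simp)
  define A where "A = {x \<in> space M. \<forall>k::nat. \<exists>n. max_sum f n x > k}"
  have A [measurable]: "A \<in> sets M" unfolding A_def by measurable
  have inc: "incseq (\<lambda>n. max_sum f n x)" for x
    by (intro incseq_SucI max_sum_mono)
  have big: "\<exists>n>0. max_sum f n x > c" if "x \<in> A" for x c
  proof -
    from that obtain n where "max_sum f n x > of_nat (nat \<lceil>c\<rceil>)" by (auto simp: A_def)
    then have "max_sum f n x > c" by linarith
    then show ?thesis using max_sum_mono[of f n x] by (intro exI[of _ "Suc n"]) auto
  qed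
  have "T -` A \<inter> space M = A"
  proof (intro set_eqI iffI)
    fix x assume x: "x \<in> T -` A \<inter> space M"
    show "x \<in> A"
    unfolding A_def
    proof (clarsimp, intro conjI allI)
      fix k :: nat
      obtain n where "max_sum f n (T x) > \<bar>f x\<bar> + k" using big[of "T x" "\<bar>f x\<bar> + k"] x by auto
      then show "\<exists>n. max_sum f n x > k" by (intro exI[of _ "Suc n"]) auto
    qed (use x in auto)
  next
    fix x assume x: "x \<in> A"
    then have xs: "x \<in> space M" by (simp add: A_def)
    have "\<exists>n. max_sum f n (T x) > k" for k :: nat
    proof -
      obtain n where n: "n > 0" "max_sum f n x > \<bar>f x\<bar> + k" using big[OF x] by blast
      then obtain n' where "n = Suc n'" by (cases n) auto
      with n have "max_sum f n' (T x) > k" by auto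
      then show ?thesis by blast
    qed
    then show "x \<in> T -` A \<inter> space M"
      using xs measurable_space[OF T_measurable xs] by (auto simp: A_def)
  qed
  from ergodic[OF A this] show ?thesis
  proof
    assume "prob A = 0"
    then have "AE x in M. x \<notin> A"
      by (subst AE_iff_measurable[OF A]) (auto simp: emeasure_eq_measure A_def)
    then show ?thesis using AE_space
    proof eventually_elim
      case (elim x)
      then obtain k :: nat where k: "\<And>n. max_sum f n x \<le> k"
        by (auto simp: A_def not_less)
      have "birkhoff_sum f n x \<le> k" for n
        using k[of "n - 1"] birkhoff_sum_le_max_sum[of f "n - 1" x]
        by (cases n) (auto simp: birkhoff_sum_def)
      then show ?case by blast
    qed
  next
    assume "prob A = 1"
    then have AE_A: "AE x in M. x \<in> A" by (simp add: prob_eq_1)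
    \<comment> \<open>\<open>?d n x\<close> equals \<open>f x + max 0 (- max_sum f n (T x))\<close>.
      The excess over \<open>f x\<close> is at most \<open>\<bar>f (T x)\<bar>\<close>, because the
      maximum includes the one-term sum \<open>f (T x)\<close>, and it vanishes as soon as some
      partial sum at \<open>T x\<close> is nonnegative.\<close>
    let ?d = "\<lambda>n x. max_sum f (Suc n) x - max_sum f n (T x)"
    have "(\<lambda>n. \<integral>x. ?d n x \<partial>M) \<longlonglongrightarrow> (\<integral>x. f x \<partial>M)"
    proof (rule integral_dominated_convergence)
      show "integrable M (\<lambda>x. \<bar>f x\<bar> + \<bar>f (T x)\<bar>)"
        using f integrable_funpow[OF f, of 1] by auto
      show "AE x in M. norm (?d n x) \<le> \<bar>f x\<bar> + \<bar>f (T x)\<bar>" for n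
      proof (rule AE_I2)
        fix x
        have "max_sum f n (T x) \<ge> f (T x)"
          using inc[of "T x"] by (auto dest!: incseqD[of _ 0 n])
        then show "norm (?d n x) \<le> \<bar>f x\<bar> + \<bar>f (T x)\<bar>" by (auto simp: max_def)
      qed
      show "AE x in M. (\<lambda>n. ?d n x) \<longlonglongrightarrow> f x"
        using AE_A
      proof eventually_elim
        case (elim x)
        obtain n where n: "n > 0" "max_sum f n x > \<bar>f x\<bar>" using big[OF elim] by blast
        then obtain n' where n': "n = Suc n'" by (cases n) auto
        have "max_sum f n' (T x) \<ge> 0" using n n' by auto
        then have "\<forall>k\<ge>n'. ?d k x = f x"
          using incseqD[OF inc[of "T x"]] by (force simp: max_def)
        then show ?case
          by (intro tendsto_eventually) (auto simp: eventually_sequentially)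
      qed
    qed (use f in measurable)
    moreover have "(\<integral>x. ?d n x \<partial>M) \<ge> 0" for n
    proof -
      have "(\<integral>x. ?d n x \<partial>M) = (\<integral>x. max_sum f (Suc n) x \<partial>M) - (\<integral>x. max_sum f n (T x) \<partial>M)"
        using int[of "Suc n"] integrable_funpow[OF int[of n], of 1]
        by (intro Bochner_Integration.integral_diff) (simp_all del: max_sum.simps)
      moreover have "(\<integral>x. max_sum f n (T x) \<partial>M) = (\<integral>x. max_sum f n x \<partial>M)"
        using integral_funpow[OF meas[of n], of 1] by simp
      moreover have "(\<integral>x. max_sum f n x \<partial>M) \<le> (\<integral>x. max_sum f (Suc n) x \<partial>M)"
        by (intro integral_mono int max_sum_mono)
      ultimately show ?thesis by (simp del: max_sum.simps)
    qed
    ultimately have "(\<integral>x. f x \<partial>M) \<ge> 0" by (intro LIMSEQ_le_const) auto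
    with neg show ?thesis by simp
  qed
qed

text \<open>Subtracting the mean plus \<open>1 / Suc k\<close> makes the mean negative, so the
  Birkhoff sums of the difference are bounded above, and dividing by \<open>n\<close> removes the
  bound. The same argument for \<open>- f\<close> gives the lower estimate.\<close>

theorem birkhoff:
  assumes f: "integrable M f"
  shows "AE x in M. (\<lambda>n. birkhoff_sum f n x / n) \<longlonglongrightarrow> (\<integral>x. f x \<partial>M)"
proof -
  have upper: "AE x in M. \<forall>k. \<exists>B. \<forall>n. birkhoff_sum g n x \<le> B + n * ((\<integral>x. g x \<partial>M) + 1 / Suc k)"
    if g: "integrable M g" for g
  proof (subst AE_all_countable, rule allI)
    fix k
    let ?c = "(\<integral>x. g x \<partial>M) + 1 / Suc k"
    have "AE x in M. \<exists>B. \<forall>n. birkhoff_sum (\<lambda>x. g x - ?c) n x \<le> B"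
      using g by (intro birkhoff_sums_bounded_above) (auto simp: prob_space)
    then show "AE x in M. \<exists>B. \<forall>n. birkhoff_sum g n x \<le> B + n * ?c"
    proof eventually_elim
      case (elim x)
      then obtain B where "\<And>n. birkhoff_sum (\<lambda>x. g x - ?c) n x \<le> B" by blast
      then show ?case
        by (intro exI[of _ B]) (simp add: birkhoff_sum_def sum_subtractf sum.distrib algebra_simps)
    qed
  qed
  have lim: "eventually (\<lambda>n. a n / n < c + \<epsilon>) sequentially"
    if *: "\<forall>k. \<exists>B. \<forall>n. a n \<le> B + n * (c + 1 / Suc k)" and "\<epsilon> > 0" for a :: "nat \<Rightarrow> real" and c \<epsilon>
  proof -
    obtain k where k: "1 / Suc k < \<epsilon>" using \<open>\<epsilon> > 0\<close> nat_approx_posE by blast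
    obtain B where B: "\<And>n. a n \<le> B + n * (c + 1 / Suc k)" using * by blast
    have "(\<lambda>n. B / real n + (c + 1 / Suc k)) \<longlonglongrightarrow> 0 + (c + 1 / Suc k)"
      by (intro tendsto_intros lim_const_over_n)
    then have "eventually (\<lambda>n. B / real n + (c + 1 / Suc k) < c + \<epsilon>) sequentially"
      using k by (intro order_tendstoD) auto
    then show ?thesis using eventually_gt_at_top[of 0]
    proof eventually_elim
      case (elim n)
      have "a n / n \<le> (B + n * (c + 1 / Suc k)) / n" using B by (intro divide_right_mono) auto
      also have "\<dots> = B / n + (c + 1 / Suc k)" using elim by (simp add: field_simps)
      finally show ?case using elim by simp
    qed
  qed
  show ?thesis
    using upper[OF f] upper[OF integrable_minus[OF f]]
  proof eventually_elim
    case (elim x)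
    have neg: "birkhoff_sum (\<lambda>x. - f x) n x = - birkhoff_sum f n x" for n
      by (simp add: birkhoff_sum_def sum_negf)
    show ?case
    proof (rule order_tendstoI)
      fix a assume "a < (\<integral>x. f x \<partial>M)"
      then show "eventually (\<lambda>n. a < birkhoff_sum f n x / n) sequentially"
        using lim[OF elim(2), of "(\<integral>x. f x \<partial>M) - a"] by (simp add: neg)
    next
      fix a assume "(\<integral>x. f x \<partial>M) < a"
      then show "eventually (\<lambda>n. birkhoff_sum f n x / n < a) sequentially"
        using lim[OF elim(1), of "a - (\<integral>x. f x \<partial>M)"] by simp
    qed
  qed
qed

text \<open>With finitely many visits to \<open>A\<close> the Birkhoff averages of its indicator
  would tend to 0 instead of \<open>prob A\<close>.\<close>

lemma recurrence:
  assumes A [measurable]: "A \<in> sets M" and "prob A > 0"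
  shows "AE x in M. \<forall>n. \<exists>k\<ge>n. (T ^^ k) x \<in> A"
proof -
  have int: "integrable M (indicator A :: 'a \<Rightarrow> real)"
    by (simp add: emeasure_eq_measure)
  show ?thesis using birkhoff[OF int]
  proof eventually_elim
    case (elim x)
    have "\<exists>k\<ge>n. (T ^^ k) x \<in> A" for n
    proof (rule ccontr)
      assume "\<not> (\<exists>k\<ge>n. (T ^^ k) x \<in> A)"
      then have *: "(T ^^ k) x \<notin> A" if "k \<ge> n" for k
        using that by blast
      have "birkhoff_sum (indicator A) k x \<le> n" for k
      proof -
        have "birkhoff_sum (indicator A) k x \<le> (\<Sum>i<k. if i < n then 1 else 0)"
          unfolding birkhoff_sum_def by (intro sum_mono) (auto simp: not_less indicator_def dest: *)
        also have "\<dots> = card {i. i < k \<and> i < n}" by (simp add: sum.If_cases Int_def)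
        also have "\<dots> \<le> card {..<n}" by (intro of_nat_mono card_mono) auto
        finally show ?thesis by simp
      qed
      then have "birkhoff_sum (indicator A) k x / k \<le> n / k" for k
        by (intro divide_right_mono) auto
      then have "(\<integral>x. indicator A x \<partial>M) \<le> (0::real)"
        by (intro LIMSEQ_le[OF elim lim_const_over_n]) auto
      then show False using \<open>prob A > 0\<close> by simp
    qed
    then show ?case by blast
  qed
qed

text \<open>The nonnegative difference \<open>h x - h (T x)\<close> has integral zero by invariance
  of the measure.\<close>

lemma AE_eq_of_decreasing:
  fixes h :: "'a \<Rightarrow> real"
  assumes h: "integrable M h" and le: "AE x in M. h (T x) \<le> h x"
  shows "AE x in M. h (T x) = h x"
proof -
  have 1: "integrable M (\<lambda>x. h (T x))" using integrable_funpow[OF h, of 1] by simp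
  have "(\<integral>x. h x - h (T x) \<partial>M) = 0"
    using h 1 integral_funpow[of h 1] by (simp add: borel_measurable_integrable)
  then have "AE x in M. h x - h (T x) = 0"
    using h 1 le by (subst integral_nonneg_eq_0_iff_AE[symmetric]) auto
  then show ?thesis by eventually_elim simp
qed

end

section \<open>Trees of marks\<close>

definition tree_space :: "marks measure" where
  "tree_space = (\<Pi>\<^sub>M u\<in>UNIV. mark_space)"

definition tree_law :: "(nat \<Rightarrow> mark measure) \<Rightarrow> marks measure" where
  "tree_law e = (\<Pi>\<^sub>M u\<in>UNIV. e (length u))"

text \<open>Infinitely many independent subtrees are provided whatever the number of children. This
  keeps the forest independent of the root mark; sums over children read only the first
  \<open>fst p\<close> of them.\<close>

definition forest_law :: "(nat \<Rightarrow> mark measure) \<Rightarrow> (nat \<Rightarrow> marks) measure" where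
  "forest_law e = (\<Pi>\<^sub>M i\<in>UNIV. tree_law e)"

definition shift :: "(nat \<Rightarrow> 'a) \<Rightarrow> nat \<Rightarrow> 'a" where
  "shift e n = e (Suc n)"

definition subtree :: "marks \<Rightarrow> nat \<Rightarrow> marks" where
  "subtree X i u = X (i # u)"

definition graft :: "mark \<Rightarrow> (nat \<Rightarrow> marks) \<Rightarrow> marks" where
  "graft p Y u = (case u of [] \<Rightarrow> p | i # v \<Rightarrow> Y i v)"

definition mark_laws :: "(nat \<Rightarrow> mark measure) \<Rightarrow> bool" where
  "mark_laws e \<longleftrightarrow> (\<forall>n. e n \<in> space (prob_algebra mark_space))"

lemma graft_simps [simp]: "graft p Y [] = p" "graft p Y (i # v) = Y i v" "subtree (graft p Y) i = Y i"
  by (simp_all add: graft_def subtree_def fun_eq_iff)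

lemma space_mark_space [simp]: "space mark_space = UNIV"
  by (simp add: mark_space_def space_pair_measure space_PiM)

lemma space_tree_space [simp]: "space tree_space = UNIV"
  by (simp add: tree_space_def space_PiM)

lemma mark_lawsD:
  assumes "mark_laws e"
  shows "prob_space (e n)" "sets (e n) = sets mark_space" "space (e n) = UNIV"
proof -
  show "prob_space (e n)" and *: "sets (e n) = sets mark_space"
    using assms by (auto simp: mark_laws_def space_prob_algebra)
  show "space (e n) = UNIV" using sets_eq_imp_space_eq[OF *] by simp
qed

lemma mark_laws_shift: "mark_laws e \<Longrightarrow> mark_laws (shift e)"
  by (simp add: mark_laws_def shift_def)

lemma sets_tree_law: "mark_laws e \<Longrightarrow> sets (tree_law e) = sets tree_space"
  unfolding tree_law_def tree_space_def by (intro sets_PiM_cong) (auto simp: mark_lawsD)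

lemma space_tree_law: "mark_laws e \<Longrightarrow> space (tree_law e) = UNIV"
  using sets_eq_imp_space_eq[OF sets_tree_law] by simp

lemma prob_space_tree_law: "mark_laws e \<Longrightarrow> prob_space (tree_law e)"
  unfolding tree_law_def by (intro prob_space_PiM) (auto simp: mark_lawsD)

lemma sets_forest_law: "mark_laws e \<Longrightarrow> sets (forest_law e) = sets (\<Pi>\<^sub>M i\<in>UNIV. tree_space)"
  unfolding forest_law_def by (intro sets_PiM_cong) (auto simp: sets_tree_law)

lemma prob_space_forest_law: "mark_laws e \<Longrightarrow> prob_space (forest_law e)"
  unfolding forest_law_def by (intro prob_space_PiM) (auto simp: prob_space_tree_law)

lemma subtree_measurable [measurable]: "(\<lambda>X. subtree X i) \<in> tree_space \<rightarrow>\<^sub>M tree_space"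
  unfolding subtree_def[abs_def] tree_space_def
  by (intro measurable_PiM_single' measurable_component_singleton) (auto simp: space_PiM)

lemma forest_update_measurable [measurable]:
  "(\<lambda>(X, Y). Y(i := X)) \<in> tree_space \<Otimes>\<^sub>M (\<Pi>\<^sub>M i\<in>UNIV. tree_space) \<rightarrow>\<^sub>M (\<Pi>\<^sub>M i\<in>UNIV. tree_space)"
  unfolding case_prod_beta' by (rule measurable_fun_upd[where J=UNIV]) auto

lemma root_measurable [measurable]: "(\<lambda>X. X u) \<in> tree_space \<rightarrow>\<^sub>M mark_space"
  unfolding tree_space_def by measurable

lemma graft_measurable [measurable]:
  "(\<lambda>(p, Y). graft p Y) \<in> mark_space \<Otimes>\<^sub>M (\<Pi>\<^sub>M i\<in>UNIV. tree_space) \<rightarrow>\<^sub>M tree_space"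
proof -
  have "(\<lambda>x. graft (fst x) (snd x) u) \<in> mark_space \<Otimes>\<^sub>M (\<Pi>\<^sub>M i\<in>UNIV. tree_space) \<rightarrow>\<^sub>M mark_space" for u
  proof (cases u)
    case (Cons i v)
    have "(\<lambda>x. snd x i) \<in> mark_space \<Otimes>\<^sub>M (\<Pi>\<^sub>M i\<in>(UNIV::nat set). tree_space) \<rightarrow>\<^sub>M tree_space"
      by measurable
    from measurable_compose[OF this root_measurable] show ?thesis
      by (simp add: Cons)
  qed simp
  then have "(\<lambda>x. graft (fst x) (snd x)) \<in> mark_space \<Otimes>\<^sub>M (\<Pi>\<^sub>M i\<in>UNIV. tree_space) \<rightarrow>\<^sub>M (\<Pi>\<^sub>M u\<in>UNIV. mark_space)"
    by (intro measurable_PiM_single') auto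
  then show ?thesis
    by (simp add: tree_space_def[symmetric] case_prod_beta')
qed

lemma mark_measurable [measurable]: "fst \<in> mark_space \<rightarrow>\<^sub>M count_space UNIV" "(\<lambda>p. snd p i) \<in> borel_measurable mark_space"
  unfolding mark_space_def by measurable

text \<open>This is the branching property in law. It is checked on cylinders: a finite set
  \<open>J\<close> of nodes splits into the root, if present, and blocks \<open>K i\<close> of nodes
  below child \<open>i\<close>, and the product of the probabilities factorises accordingly.\<close>

lemma distr_graft:
  assumes e: "mark_laws e"
  shows "distr (e 0 \<Otimes>\<^sub>M forest_law (shift e)) tree_space (\<lambda>(p, Y). graft p Y) = tree_law e"
proof -
  note e' = mark_laws_shift[OF e]
  note [measurable_cong] = mark_lawsD(2)[OF e] sets_forest_law[OF e']
  note eD = mark_lawsD[OF e] and e'D = mark_lawsD[OF e']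
  interpret F: prob_space "forest_law (shift e)" by (rule prob_space_forest_law[OF e'])
  interpret T: prob_space "tree_law e" by (rule prob_space_tree_law[OF e])
  interpret E0: prob_space "e 0" by (rule eD)
  let ?D = "distr (e 0 \<Otimes>\<^sub>M forest_law (shift e)) tree_space (\<lambda>(p, Y). graft p Y)"
  have "tree_law e = ?D"
  proof (rule measure_eqI_PiM_infinite[where I=UNIV and M="\<lambda>u. e (length u)"])
    show "sets (tree_law e) = sets (Pi\<^sub>M UNIV (\<lambda>u. e (length u)))"
      by (simp add: tree_law_def)
    then show "sets ?D = sets (Pi\<^sub>M UNIV (\<lambda>u. e (length u)))"
      by (simp add: sets_tree_law[OF e])
    show "finite_measure (tree_law e)" by unfold_locales
    fix A and J :: "nat list set"
    assume J: "finite J" and A: "\<And>i. i \<in> J \<Longrightarrow> A i \<in> sets (e (length i))"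
    define J' where "J' = J - {[]}"
    define I where "I = hd ` J'"
    define K where "K i = {v. i # v \<in> J}" for i
    let ?B = "prod_emb UNIV (\<lambda>u. e (length u)) J (Pi\<^sub>E J A)"
    let ?A0 = "if [] \<in> J then A [] else UNIV"
    let ?Y = "\<lambda>i. prod_emb UNIV (\<lambda>u. shift e (length u)) (K i) (\<Pi>\<^sub>E v\<in>K i. A (i # v))"
    let ?F = "prod_emb UNIV (\<lambda>i. tree_law (shift e)) I (\<Pi>\<^sub>E i\<in>I. ?Y i)"
    have fin: "finite I" "finite J'" using J by (auto simp: I_def J'_def)
    have finK: "finite (K i)" for i
      using finite_vimageI[OF J, of "\<lambda>v. i # v"] by (simp add: K_def vimage_def)
    have J'_eq: "J' = (\<lambda>(i, v). i # v) ` (SIGMA i:I. K i)"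
    proof (intro set_eqI iffI)
      fix j assume j: "j \<in> J'"
      then obtain i v where "j = i # v" by (cases j) (auto simp: J'_def)
      moreover from this j have "i \<in> I" "v \<in> K i" by (force simp: I_def K_def J'_def)+
      ultimately show "j \<in> (\<lambda>(i, v). i # v) ` (SIGMA i:I. K i)" by auto
    qed (auto simp: J'_def K_def)
    have AK: "A (i # v) \<in> sets (shift e (length v))" if "v \<in> K i" for i v
      using A[of "i # v"] that by (simp add: K_def shift_def)
    have Y_sets: "?Y i \<in> sets (tree_law (shift e))" for i
      unfolding tree_law_def using finK AK by (intro sets_PiM_I) auto
    have A0: "?A0 \<in> sets (e 0)" using A[of "[]"] sets.top[of "e 0"] eD(3)[of 0] by auto
    have "emeasure (tree_law e) ?B = (\<Prod>j\<in>J. emeasure (e (length j)) (A j))"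
      unfolding tree_law_def using J A eD(1) by (intro emeasure_PiM_emb) auto
    also have "\<dots> = emeasure (e 0) ?A0 * (\<Prod>j\<in>J'. emeasure (e (length j)) (A j))"
      using prod.insert_remove[OF J, of "\<lambda>j. emeasure (e (length j)) (A j)" "[]"] E0.emeasure_space_1 eD(3)[of 0]
      by (auto simp: J'_def insert_absorb)
    also have "(\<Prod>j\<in>J'. emeasure (e (length j)) (A j)) = (\<Prod>(i, v)\<in>(SIGMA i:I. K i). emeasure (shift e (length v)) (A (i # v)))"
      unfolding J'_eq by (subst prod.reindex) (auto simp: inj_on_def shift_def case_prod_beta)
    also have "\<dots> = (\<Prod>i\<in>I. \<Prod>v\<in>K i. emeasure (shift e (length v)) (A (i # v)))"
      using fin finK by (subst prod.Sigma) auto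
    also have "\<dots> = (\<Prod>i\<in>I. emeasure (tree_law (shift e)) (?Y i))"
      unfolding tree_law_def using finK AK e'D(1)
      by (intro prod.cong refl emeasure_PiM_emb[symmetric]) auto
    also have "\<dots> = emeasure (forest_law (shift e)) ?F"
      unfolding forest_law_def using fin Y_sets prob_space_tree_law[OF e']
      by (intro emeasure_PiM_emb[symmetric]) auto
    also have "emeasure (e 0) ?A0 * \<dots> = emeasure (e 0 \<Otimes>\<^sub>M forest_law (shift e)) (?A0 \<times> ?F)"
      using A0 Y_sets fin by (intro F.emeasure_pair_measure_Times[symmetric]) (auto simp: forest_law_def intro!: sets_PiM_I)
    also have "?A0 \<times> ?F = (\<lambda>(p, Y). graft p Y) -` ?B \<inter> space (e 0 \<Otimes>\<^sub>M forest_law (shift e))"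
    proof -
      have "(p \<in> ?A0 \<and> (\<forall>i\<in>I. \<forall>v\<in>K i. Y i v \<in> A (i # v))) \<longleftrightarrow> (\<forall>j\<in>J. graft p Y j \<in> A j)" (is "?l \<longleftrightarrow> ?r") for p Y
      proof
        assume l: ?l
        show ?r
        proof
          fix j assume j: "j \<in> J"
          show "graft p Y j \<in> A j"
          proof (cases j)
            case (Cons i v)
            then have "i \<in> I" "v \<in> K i" using j by (force simp: I_def K_def J'_def)+
            then show ?thesis using l Cons by auto
          qed (use l j in auto)
        qed
      next
        assume r: ?r
        have "p \<in> ?A0" using r graft_simps(1)[of p Y] by (metis UNIV_I)
        moreover have "Y i v \<in> A (i # v)" if "v \<in> K i" for i v
          using r that by (auto simp: K_def)
        ultimately show ?l by blast
      qed
      moreover have "space (tree_law (shift e)) = UNIV" by (rule space_tree_law[OF e'])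
      ultimately show ?thesis
        using eD(3) e'D(3)
        by (auto simp only: set_eq_iff prod_emb_def space_pair_measure space_PiM forest_law_def restrict_PiE_iff
            PiE_UNIV_domain vimage_eq mem_Times_iff split_beta fst_conv snd_conv Int_iff UNIV_I Pi_UNIV simp_thms
            mem_Collect_eq Pi_I)
    qed
    also have "emeasure (e 0 \<Otimes>\<^sub>M forest_law (shift e)) \<dots> = emeasure ?D ?B"
    proof (intro emeasure_distr[symmetric])
      show "?B \<in> sets tree_space"
        unfolding sets_tree_law[OF e, symmetric] unfolding tree_law_def using J A by (intro sets_PiM_I) auto
    qed measurable
    finally show "emeasure (tree_law e) ?B = emeasure ?D ?B" .
  qed
  then show ?thesis by simp
qed

lemma nn_integral_tree_law:
  assumes e: "mark_laws e" and [measurable]: "f \<in> borel_measurable tree_space"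
  shows "(\<integral>\<^sup>+X. f X \<partial>tree_law e) = (\<integral>\<^sup>+p. (\<integral>\<^sup>+Y. f (graft p Y) \<partial>forest_law (shift e)) \<partial>e 0)"
proof -
  note e' = mark_laws_shift[OF e]
  note [measurable_cong] = mark_lawsD(2)[OF e] sets_forest_law[OF e']
  interpret F: prob_space "forest_law (shift e)" by (rule prob_space_forest_law[OF e'])
  show ?thesis
    by (subst distr_graft[OF e, symmetric])
      (simp add: nn_integral_distr F.nn_integral_fst[symmetric] case_prod_beta)
qed

lemma integral_tree_law:
  fixes f :: "marks \<Rightarrow> real"
  assumes e: "mark_laws e" and f: "integrable (tree_law e) f"
  shows "(\<integral>X. f X \<partial>tree_law e) = (\<integral>p. (\<integral>Y. f (graft p Y) \<partial>forest_law (shift e)) \<partial>e 0)"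
proof -
  note e' = mark_laws_shift[OF e]
  note [measurable_cong] = mark_lawsD(2)[OF e] sets_forest_law[OF e'] sets_tree_law[OF e]
  have [measurable]: "f \<in> borel_measurable tree_space" using f by measurable
  interpret F: prob_space "forest_law (shift e)" by (rule prob_space_forest_law[OF e'])
  interpret E: prob_space "e 0" by (rule mark_lawsD[OF e])
  interpret pair_prob_space "e 0" "forest_law (shift e)" ..
  have "integrable (e 0 \<Otimes>\<^sub>M forest_law (shift e)) (\<lambda>x. f (case x of (p, Y) \<Rightarrow> graft p Y))"
    by (rule integrable_distr[where M'=tree_space]) (simp_all add: distr_graft[OF e] f)
  then have "(\<integral>p. (\<integral>Y. f (graft p Y) \<partial>forest_law (shift e)) \<partial>e 0) = (\<integral>x. f (case x of (p, Y) \<Rightarrow> graft p Y) \<partial>(e 0 \<Otimes>\<^sub>M forest_law (shift e)))"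
    by (subst integral_fst'[symmetric]) auto
  also have "\<dots> = (\<integral>X. f X \<partial>distr (e 0 \<Otimes>\<^sub>M forest_law (shift e)) tree_space (\<lambda>(p, Y). graft p Y))"
    by (subst integral_distr) auto
  finally show ?thesis by (simp add: distr_graft[OF e])
qed

lemma distr_forest_component:
  assumes e: "mark_laws e"
  shows "distr (forest_law e) (tree_law e) (\<lambda>Y. Y i) = tree_law e"
    unfolding forest_law_def by (subst distr_PiM_component) (auto simp: prob_space_tree_law[OF e])

lemma nn_integral_forest_component:
  assumes e: "mark_laws e" and [measurable]: "f \<in> borel_measurable tree_space"
  shows "(\<integral>\<^sup>+Y. f (Y i) \<partial>forest_law e) = (\<integral>\<^sup>+X. f X \<partial>tree_law e)"
proof -
  note [measurable_cong] = sets_forest_law[OF e] sets_tree_law[OF e]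
  show ?thesis
    by (subst distr_forest_component[OF e, of i, symmetric], subst nn_integral_distr) measurable
qed

text \<open>Resampling one coordinate takes the place of independence arguments.\<close>

lemma nn_integral_forest_resample:
  assumes e: "mark_laws e" and [measurable]: "f \<in> borel_measurable (\<Pi>\<^sub>M i\<in>UNIV. tree_space)"
  shows "(\<integral>\<^sup>+Y. f Y \<partial>forest_law e) = (\<integral>\<^sup>+X. (\<integral>\<^sup>+Y. f (Y(i := X)) \<partial>forest_law e) \<partial>tree_law e)"
proof -
  note [measurable_cong] = sets_forest_law[OF e] sets_tree_law[OF e]
  interpret F: prob_space "forest_law e" by (rule prob_space_forest_law[OF e])
  have *: "forest_law e = distr (tree_law e \<Otimes>\<^sub>M forest_law e) (forest_law e) (\<lambda>(X, Y). Y(i := X))"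
    using distr_pair_PiM_eq_PiM[of UNIV "\<lambda>_. tree_law e" i] prob_space_tree_law[OF e]
    by (simp add: forest_law_def)
  show ?thesis
    by (subst *, subst nn_integral_distr) (measurable, simp add: F.nn_integral_fst[symmetric] case_prod_beta)
qed

lemma integral_forest_resample:
  fixes f :: "(nat \<Rightarrow> marks) \<Rightarrow> real"
  assumes e: "mark_laws e" and f: "integrable (forest_law e) f"
  shows "(\<integral>Y. f Y \<partial>forest_law e) = (\<integral>X. (\<integral>Y. f (Y(i := X)) \<partial>forest_law e) \<partial>tree_law e)"
proof -
  note [measurable_cong] = sets_forest_law[OF e] sets_tree_law[OF e]
  have [measurable]: "f \<in> borel_measurable (\<Pi>\<^sub>M i\<in>UNIV. tree_space)" using f by measurable
  interpret F: prob_space "forest_law e" by (rule prob_space_forest_law[OF e])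
  interpret T: prob_space "tree_law e" by (rule prob_space_tree_law[OF e])
  interpret pair_prob_space "tree_law e" "forest_law e" ..
  have *: "distr (tree_law e \<Otimes>\<^sub>M forest_law e) (forest_law e) (\<lambda>(X, Y). Y(i := X)) = forest_law e"
    using distr_pair_PiM_eq_PiM[of UNIV "\<lambda>_. tree_law e" i] prob_space_tree_law[OF e]
    by (simp add: forest_law_def)
  have "integrable (tree_law e \<Otimes>\<^sub>M forest_law e) (\<lambda>x. f (case x of (X, Y) \<Rightarrow> Y(i := X)))"
    by (rule integrable_distr[where M'="forest_law e"]) (measurable, simp only: * f)
  then have "(\<integral>X. (\<integral>Y. f (Y(i := X)) \<partial>forest_law e) \<partial>tree_law e) = (\<integral>x. f (case x of (X, Y) \<Rightarrow> Y(i := X)) \<partial>(tree_law e \<Otimes>\<^sub>M forest_law e))"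
    by (subst integral_fst'[symmetric]) auto
  also have "\<dots> = (\<integral>Y. f Y \<partial>distr (tree_law e \<Otimes>\<^sub>M forest_law e) (forest_law e) (\<lambda>(X, Y). Y(i := X)))"
    by (subst integral_distr) auto
  finally show ?thesis by (simp add: *)
qed

section \<open>Branching sums and the many-to-one formula\<close>

definition offspring_mean :: "mark measure \<Rightarrow> real" where
  "offspring_mean \<kappa> = enn2real (\<integral>\<^sup>+p. of_nat (fst p) \<partial>\<kappa>)"

text \<open>Excluding the means 0 and infinity makes the real number \<open>offspring_mean\<close>
  the true mean and a legitimate divisor.\<close>

definition environment :: "(nat \<Rightarrow> mark measure) \<Rightarrow> bool" where
  "environment e \<longleftrightarrow> mark_laws e \<and> (\<forall>n. 0 < (\<integral>\<^sup>+p. of_nat (fst p) \<partial>e n) \<and> (\<integral>\<^sup>+p. of_nat (fst p) \<partial>e n) < \<infinity>)"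

definition prod_mean :: "(nat \<Rightarrow> mark measure) \<Rightarrow> nat \<Rightarrow> real" where
  "prod_mean e n = (\<Prod>k<n. offspring_mean (e k))"

text \<open>\<open>branching_sum k e F X y\<close> sums \<open>F\<close>, evaluated at the subtree of \<open>u\<close> and at \<open>y\<close> minus the position of
  \<open>u\<close>, over the particles \<open>u\<close> of generation \<open>k\<close>, and divides by the mean population.\<close>

primrec branching_sum ::
    "nat \<Rightarrow> (nat \<Rightarrow> mark measure) \<Rightarrow> (marks \<Rightarrow> real \<Rightarrow> real) \<Rightarrow> marks \<Rightarrow> real \<Rightarrow> real" where
  "branching_sum 0 e F X y = F X y"
| "branching_sum (Suc k) e F X y =
     (\<Sum>i<fst (X []). branching_sum k (shift e) F (subtree X i) (y - snd (X []) i)) / offspring_mean (e 0)"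

definition norm_pop :: "nat \<Rightarrow> (nat \<Rightarrow> mark measure) \<Rightarrow> marks \<Rightarrow> real" where
  "norm_pop k e X = branching_sum k e (\<lambda>_ _. 1) X 0"

text \<open>The intensity measure of the displacements of the children, divided by the mean number
  of children. The density lives on pairs of a mark and a child number, so it describes the
  displacement of a child picked under the size-biased mark law.\<close>

definition disp_law :: "mark measure \<Rightarrow> real measure" where
  "disp_law \<kappa> = distr (density (\<kappa> \<Otimes>\<^sub>M count_space UNIV)
     (\<lambda>(p, i). if i < fst p then ennreal (1 / offspring_mean \<kappa>) else 0)) borel (\<lambda>(p, i). snd p i)"

primrec walk_law :: "nat \<Rightarrow> (nat \<Rightarrow> mark measure) \<Rightarrow> real measure" where
  "walk_law 0 e = return borel 0"
| "walk_law (Suc n) e = convolution (disp_law (e 0)) (walk_law n (shift e))"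

lemma environmentD:
  assumes "environment e"
  shows "mark_laws e" "offspring_mean (e n) > 0" "(\<integral>\<^sup>+p. of_nat (fst p) \<partial>e n) = ennreal (offspring_mean (e n))"
proof -
  show "mark_laws e" using assms by (simp add: environment_def)
  show 1: "(\<integral>\<^sup>+p. of_nat (fst p) \<partial>e n) = ennreal (offspring_mean (e n))"
    using assms by (simp add: environment_def offspring_mean_def)
  show "offspring_mean (e n) > 0"
    using assms unfolding environment_def offspring_mean_def by (auto simp: enn2real_positive_iff)
qed

lemma environment_shift: "environment e \<Longrightarrow> environment (shift e)"
  by (auto simp: environment_def mark_laws_shift) (auto simp: shift_def)

lemma environment_funpow_shift: "environment e \<Longrightarrow> environment ((shift ^^ k) e)"
  by (induction k) (auto intro: environment_shift)

lemma prod_mean_Suc_shift: "prod_mean e (Suc n) = offspring_mean (e 0) * prod_mean (shift e) n"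
  by (simp add: prod_mean_def prod.lessThan_Suc_shift shift_def del: prod.lessThan_Suc)

lemma prod_mean_pos: "environment e \<Longrightarrow> prod_mean e n > 0"
  unfolding prod_mean_def by (intro prod_pos) (auto simp: environmentD)

lemma branching_sum_0 [simp]: "branching_sum 0 e F = F"
  by (simp add: fun_eq_iff)

lemma sum_random_length_measurable:
  fixes f :: "nat \<Rightarrow> 'a \<Rightarrow> 'b::{second_countable_topology, topological_comm_monoid_add}"
  assumes [measurable]: "\<And>i. f i \<in> borel_measurable M" "N \<in> M \<rightarrow>\<^sub>M count_space UNIV"
  shows "(\<lambda>x. \<Sum>i<N x. f i x) \<in> borel_measurable M"
  by (rule measurable_compose_countable[where f="\<lambda>n x. \<Sum>i<n. f i x" and g=N]) measurable

lemma branching_sum_measurable: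
  assumes "(\<lambda>(X, y). F X y) \<in> borel_measurable (tree_space \<Otimes>\<^sub>M borel)"
  shows "(\<lambda>(X, y). branching_sum k e F X y) \<in> borel_measurable (tree_space \<Otimes>\<^sub>M borel)"
proof (induction k arbitrary: e)
  case (Suc k)
  have 1: "(\<lambda>x. branching_sum k (shift e) F (subtree (fst x) i) (snd x - snd (fst x []) i)) \<in> borel_measurable (tree_space \<Otimes>\<^sub>M borel)" for i
  proof -
    have "(\<lambda>x. (subtree (fst x) i, snd x - snd (fst x []) i)) \<in> tree_space \<Otimes>\<^sub>M borel \<rightarrow>\<^sub>M tree_space \<Otimes>\<^sub>M (borel :: real measure)"
      using measurable_compose[OF root_measurable mark_measurable(2)] by measurable
    from measurable_compose[OF this Suc[of "shift e"]] show ?thesis by simp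
  qed
  have 2: "(\<lambda>x. fst (fst x [])) \<in> tree_space \<Otimes>\<^sub>M (borel :: real measure) \<rightarrow>\<^sub>M count_space UNIV"
    by measurable
  show ?case
    using sum_random_length_measurable[OF 1 2] by (simp add: case_prod_beta' borel_measurable_divide)
qed (use assms in simp)

lemma branching_sum_measurable1:
  assumes "(\<lambda>(X, y). F X y) \<in> borel_measurable (tree_space \<Otimes>\<^sub>M borel)"
  shows "(\<lambda>X. branching_sum k e F X y) \<in> borel_measurable tree_space"
  using measurable_compose[OF measurable_Pair2'[of y borel tree_space] branching_sum_measurable[OF assms, of k e]]
  by simp

lemma branching_sum_one: "branching_sum k e (\<lambda>_ _. 1) X y = norm_pop k e X"
proof -
  have "branching_sum k e (\<lambda>_ _. 1) X y = branching_sum k e (\<lambda>_ _. 1) X z" for y z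
  proof (induction k arbitrary: e X y z)
    case (Suc k)
    show ?case
      unfolding branching_sum.simps by (intro arg_cong2[where f="(/)"] refl sum.cong Suc)
  qed simp
  then show ?thesis by (simp add: norm_pop_def)
qed

lemma norm_pop_simps [simp]:
  "norm_pop 0 e X = 1"
  "norm_pop (Suc k) e X = (\<Sum>i<fst (X []). norm_pop k (shift e) (subtree X i)) / offspring_mean (e 0)"
  by (simp_all add: norm_pop_def) (simp only: branching_sum_one, simp add: norm_pop_def)

lemma norm_pop_measurable [measurable]: "norm_pop k e \<in> borel_measurable tree_space"
  unfolding norm_pop_def[abs_def] by (rule branching_sum_measurable1) simp

lemma offspring_mean_nonneg: "offspring_mean \<kappa> \<ge> 0"
  by (simp add: offspring_mean_def)

lemma branching_sum_mono:
  assumes "\<And>X y. F X y \<le> G X y"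
  shows "branching_sum k e F X y \<le> branching_sum k e G X y"
  by (induction k arbitrary: e X y) (auto simp: assms intro!: divide_right_mono sum_mono offspring_mean_nonneg)

lemma branching_sum_add:
  "branching_sum k e (\<lambda>X y. F X y + G X y) X y = branching_sum k e F X y + branching_sum k e G X y"
  by (induction k arbitrary: e X y) (auto simp: sum.distrib add_divide_distrib)

lemma branching_sum_diff:
  "branching_sum k e (\<lambda>X y. F X y - G X y) X y = branching_sum k e F X y - branching_sum k e G X y"
  by (induction k arbitrary: e X y) (auto simp: sum_subtractf diff_divide_distrib)

lemma branching_sum_scale:
  "branching_sum k e (\<lambda>X y. c * F X y) X y = c * branching_sum k e F X y"
  by (induction k arbitrary: e X y) (auto simp: sum_distrib_left)

lemma branching_sum_nonneg:
  assumes "\<And>X y. F X y \<ge> 0"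
  shows "branching_sum k e F X y \<ge> 0"
  by (induction k arbitrary: e X y)
    (auto simp: assms intro!: divide_nonneg_nonneg sum_nonneg offspring_mean_nonneg)

lemma norm_pop_nonneg: "norm_pop k e X \<ge> 0"
  unfolding norm_pop_def by (rule branching_sum_nonneg) simp

lemma abs_branching_sum_le:
  "\<bar>branching_sum k e F X y\<bar> \<le> branching_sum k e (\<lambda>X y. \<bar>F X y\<bar>) X y"
proof -
  have "- branching_sum k e F X y = branching_sum k e (\<lambda>X y. - F X y) X y"
    using branching_sum_scale[of k e "-1" F X y] by simp
  also have "\<dots> \<le> branching_sum k e (\<lambda>X y. \<bar>F X y\<bar>) X y" by (rule branching_sum_mono) simp
  finally show ?thesis
    using branching_sum_mono[of F "\<lambda>X y. \<bar>F X y\<bar>" k e X y] by (intro abs_leI) auto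
qed

text \<open>The tree is cut at generation \<open>k\<close>: the last \<open>n\<close> generations
  form the functional that is summed over the particles of generation \<open>k\<close>, each with
  its own reduced barrier.\<close>

lemma branching_sum_funpow:
  "branching_sum (k + n) e F X y = branching_sum k e (branching_sum n ((shift ^^ k) e) F) X y"
  by (induction k arbitrary: e X y) (simp_all add: funpow_swap1)

section \<open>First moments: from branching sums to the intensity walk\<close>

lemma nn_integral_disp_law:
  assumes e: "environment e" and f [measurable]: "f \<in> borel_measurable borel"
  shows "(\<integral>\<^sup>+x. f x \<partial>disp_law (e n)) = (\<integral>\<^sup>+p. (\<Sum>i<fst p. f (snd p i)) * ennreal (1 / offspring_mean (e n)) \<partial>e n)"
proof -
  note [measurable_cong] = mark_lawsD(2)[OF environmentD(1)[OF e], of n]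
  interpret sigma_finite_measure "count_space (UNIV :: nat set)"
    by (rule sigma_finite_measure_count_space)
  have [measurable]: "(\<lambda>x. snd (fst x) (snd x)) \<in> borel_measurable (mark_space \<Otimes>\<^sub>M count_space (UNIV :: nat set))"
    by (rule measurable_compose_countable[where f="\<lambda>i x. snd (fst x) i" and g=snd]) measurable
  have *: "(\<lambda>x. snd (fst x) (snd x)) \<in> borel_measurable (density (e n \<Otimes>\<^sub>M count_space UNIV)
      (\<lambda>x. if snd x < fst (fst x) then ennreal (1 / offspring_mean (e n)) else 0))"
    and "f \<in> borel_measurable borel"
    by measurable
  let ?d = "\<lambda>x. if snd x < fst (fst x) then ennreal (1 / offspring_mean (e n)) else 0"
  have d: "?d \<in> borel_measurable (e n \<Otimes>\<^sub>M count_space UNIV)"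
  proof (rule measurable_compose_countable[where f="\<lambda>i x. if i < fst (fst x) then ennreal (1 / offspring_mean (e n)) else 0" and g=snd])
    fix i
    have "(\<lambda>x. fst (fst x)) \<in> e n \<Otimes>\<^sub>M count_space (UNIV :: nat set) \<rightarrow>\<^sub>M count_space UNIV"
      by (rule measurable_compose[OF measurable_fst], subst measurable_cong_sets[OF mark_lawsD(2)[OF environmentD(1)[OF e]] refl])
        (rule mark_measurable(1))
    from measurable_compose[OF this, of "\<lambda>k. if i < k then ennreal (1 / offspring_mean (e n)) else 0" borel]
    show "(\<lambda>x. if i < fst (fst x) then ennreal (1 / offspring_mean (e n)) else 0) \<in> borel_measurable (e n \<Otimes>\<^sub>M count_space UNIV)"
      by simp
  qed simp
  have "(\<lambda>x. snd (fst x) (snd x)) \<in> borel_measurable (e n \<Otimes>\<^sub>M count_space UNIV)"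
    by measurable
  from measurable_compose[OF this f]
  have fs: "(\<lambda>x. f (snd (fst x) (snd x))) \<in> borel_measurable (e n \<Otimes>\<^sub>M count_space UNIV)" .
  have "(\<integral>\<^sup>+x. f x \<partial>disp_law (e n)) = (\<integral>\<^sup>+x. f (snd (fst x) (snd x)) \<partial>density (e n \<Otimes>\<^sub>M count_space UNIV) ?d)"
    unfolding disp_law_def case_prod_beta' by (intro nn_integral_distr *) simp
  also have "\<dots> = (\<integral>\<^sup>+x. ?d x * f (snd (fst x) (snd x)) \<partial>(e n \<Otimes>\<^sub>M count_space UNIV))"
    by (intro nn_integral_density d fs)
  also have "\<dots> = (\<integral>\<^sup>+p. \<integral>\<^sup>+i. (if i < fst p then ennreal (1 / offspring_mean (e n)) else 0) * f (snd p i) \<partial>count_space UNIV \<partial>e n)"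
    by (subst nn_integral_fst[symmetric]) (use d fs in simp_all)
  also have "\<dots> = (\<integral>\<^sup>+p. (\<Sum>i<fst p. f (snd p i)) * ennreal (1 / offspring_mean (e n)) \<partial>e n)"
  proof (intro nn_integral_cong)
    fix p :: mark
    have "(\<integral>\<^sup>+i. (if i < fst p then ennreal (1 / offspring_mean (e n)) else 0) * f (snd p i) \<partial>count_space UNIV)
      = (\<Sum>i<fst p. (if i < fst p then ennreal (1 / offspring_mean (e n)) else 0) * f (snd p i))"
      by (rule nn_integral_count_space') auto
    then show "(\<integral>\<^sup>+i. (if i < fst p then ennreal (1 / offspring_mean (e n)) else 0) * f (snd p i) \<partial>count_space UNIV)
      = (\<Sum>i<fst p. f (snd p i)) * ennreal (1 / offspring_mean (e n))"
      by (simp add: sum_distrib_left mult.commute)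
  qed
  finally show ?thesis .
qed

lemma sets_disp_law [simp, measurable_cong]: "sets (disp_law \<kappa>) = sets borel"
  by (simp add: disp_law_def)

lemma sets_walk_law [simp, measurable_cong]: "sets (walk_law n e) = sets borel"
  by (cases n) simp_all

lemma space_disp_law [simp]: "space (disp_law \<kappa>) = UNIV"
  by (simp add: disp_law_def)

lemma space_walk_law [simp]: "space (walk_law n e) = UNIV"
  by (cases n) (simp_all)

lemma nn_integral_offspring:
  assumes e: "environment e" and c: "c \<ge> 0"
  shows "(\<integral>\<^sup>+p. ennreal (real (fst p) * c) \<partial>e n) = ennreal (offspring_mean (e n) * c)"
proof -
  note [measurable_cong] = mark_lawsD(2)[OF environmentD(1)[OF e], of n]
  have m: "(\<lambda>p. of_nat (fst p) :: ennreal) \<in> borel_measurable (e n)"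
    by (subst measurable_cong_sets[OF mark_lawsD(2)[OF environmentD(1)[OF e]] refl])
      (rule measurable_compose[OF mark_measurable(1)], simp)
  have "(\<integral>\<^sup>+p. ennreal (real (fst p) * c) \<partial>e n) = (\<integral>\<^sup>+p. of_nat (fst p) * ennreal c \<partial>e n)"
    using c by (intro nn_integral_cong) (simp add: ennreal_mult ennreal_of_nat_eq_real_of_nat)
  also have "\<dots> = ennreal (offspring_mean (e n)) * ennreal c"
    by (subst nn_integral_multc[OF m]) (simp add: environmentD(3)[OF e])
  finally show ?thesis using c by (simp add: ennreal_mult offspring_mean_nonneg)
qed

lemma prob_space_disp_law:
  assumes e: "environment e"
  shows "prob_space (disp_law (e n))"
proof
  have "emeasure (disp_law (e n)) (space (disp_law (e n))) = (\<integral>\<^sup>+x. 1 \<partial>disp_law (e n))"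
    by (simp del: space_disp_law)
  also have "\<dots> = (\<integral>\<^sup>+p. ennreal (real (fst p) * (1 / offspring_mean (e n))) \<partial>e n)"
    by (subst nn_integral_disp_law[OF e]) (auto intro!: nn_integral_cong simp: ennreal_mult'[symmetric] ennreal_of_nat_eq_real_of_nat)
  also have "\<dots> = 1"
    using environmentD(2)[OF e, of n] by (subst nn_integral_offspring[OF e]) auto
  finally show "emeasure (disp_law (e n)) (space (disp_law (e n))) = 1" .
qed

lemma prob_space_convolution:
  assumes "prob_space M" "prob_space N" and [measurable_cong]: "sets M = sets borel" "sets N = sets borel"
  shows "prob_space (convolution M (N :: real measure))"
  unfolding convolution_def using assms(1,2)
  by (intro prob_space.prob_space_distr prob_space_pair) measurable

lemma prob_space_walk_law: "environment e \<Longrightarrow> prob_space (walk_law n e)"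
  by (induction n arbitrary: e)
    (auto intro!: prob_space_return prob_space_convolution prob_space_disp_law environment_shift)

lemma nn_integral_translate_measurable:
  assumes e: "mark_laws e" and F: "(\<lambda>(X, y). F X y) \<in> borel_measurable (tree_space \<Otimes>\<^sub>M borel)"
  shows "(\<lambda>x. \<integral>\<^sup>+X. ennreal (F X (y - x)) \<partial>tree_law e) \<in> borel_measurable (borel :: real measure)"
proof -
  note [measurable_cong] = sets_tree_law[OF e]
  interpret T: prob_space "tree_law e" by (rule prob_space_tree_law[OF e])
  have "(\<lambda>x. (snd x, y - fst x)) \<in> borel \<Otimes>\<^sub>M tree_space \<rightarrow>\<^sub>M tree_space \<Otimes>\<^sub>M (borel :: real measure)"
    by measurable
  from measurable_compose[OF this F]
  have sw: "(\<lambda>x. F (snd x) (y - fst x)) \<in> borel_measurable (borel \<Otimes>\<^sub>M tree_space)" by simp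
  show ?thesis
    by (rule T.borel_measurable_nn_integral) (use sw in \<open>simp add: case_prod_beta'\<close>)
qed

text \<open>The one-generation case of the many-to-one formula, for an arbitrary functional
  \<open>g\<close> of the subtree and the barrier. Linearity removes the joint law of siblings, and
  what is left is one step of law \<open>disp_law (e 0)\<close>.\<close>

lemma nn_integral_tree_law_sum:
  assumes e: "environment e"
    and g: "(\<lambda>(X, y). g X y) \<in> borel_measurable (tree_space \<Otimes>\<^sub>M borel)" "\<And>X y. g X y \<ge> 0"
  shows "(\<integral>\<^sup>+X. ennreal ((\<Sum>i<fst (X []). g (subtree X i) (y - snd (X []) i)) / offspring_mean (e 0)) \<partial>tree_law e)
    = (\<integral>\<^sup>+x. (\<integral>\<^sup>+X. ennreal (g X (y - x)) \<partial>tree_law (shift e)) \<partial>disp_law (e 0))"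
proof -
  note e1 = environmentD(1)[OF e]
  note e' = mark_laws_shift[OF e1]
  note [measurable_cong] = sets_tree_law[OF e'] mark_lawsD(2)[OF e1] sets_forest_law[OF e']
  interpret T: prob_space "tree_law (shift e)" by (rule prob_space_tree_law[OF e'])
  have [measurable]: "(\<lambda>x. g (fst x) (snd x)) \<in> borel_measurable (tree_space \<Otimes>\<^sub>M borel)"
    using g by (simp add: case_prod_beta')
  have gm [measurable]: "(\<lambda>X. g X y) \<in> borel_measurable tree_space" for y
    using measurable_compose[OF measurable_Pair2'[of y borel tree_space] g(1)] by simp
  have gi: "(\<lambda>X. g (subtree X i) (y - snd (X []) i)) \<in> borel_measurable tree_space" for i
  proof -
    have "(\<lambda>X. (subtree X i, y - snd (X []) i)) \<in> tree_space \<rightarrow>\<^sub>M tree_space \<Otimes>\<^sub>M (borel :: real measure)"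
      using measurable_compose[OF root_measurable mark_measurable(2)] by measurable
    from measurable_compose[OF this g(1)] show ?thesis by simp
  qed
  have [measurable]: "(\<lambda>X. (\<Sum>i<fst (X []). g (subtree X i) (y - snd (X []) i))) \<in> borel_measurable tree_space"
    using gi by (rule sum_random_length_measurable) measurable
  have [measurable]: "(\<lambda>x. \<integral>\<^sup>+X. ennreal (g X (y - x)) \<partial>tree_law (shift e)) \<in> borel_measurable borel"
    by (rule nn_integral_translate_measurable[OF e' g(1)])
  have [measurable]: "(\<lambda>Y. Y i) \<in> (\<Pi>\<^sub>M i\<in>UNIV. tree_space) \<rightarrow>\<^sub>M tree_space" for i :: nat
    by measurable
  have "(\<integral>\<^sup>+X. ennreal ((\<Sum>i<fst (X []). g (subtree X i) (y - snd (X []) i)) / offspring_mean (e 0)) \<partial>tree_law e)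
    = (\<integral>\<^sup>+p. (\<integral>\<^sup>+Y. ennreal ((\<Sum>i<fst p. g (Y i) (y - snd p i)) / offspring_mean (e 0)) \<partial>forest_law (shift e)) \<partial>e 0)"
    by (subst nn_integral_tree_law[OF e1]) auto
  also have "\<dots> = (\<integral>\<^sup>+p. (\<integral>\<^sup>+Y. (\<Sum>i<fst p. ennreal (g (Y i) (y - snd p i))) * ennreal (1 / offspring_mean (e 0)) \<partial>forest_law (shift e)) \<partial>e 0)"
    by (intro nn_integral_cong)
      (simp add: g(2) sum_nonneg sum_ennreal ennreal_mult[symmetric] offspring_mean_nonneg)
  also have "\<dots> = (\<integral>\<^sup>+p. (\<Sum>i<fst p. \<integral>\<^sup>+X. ennreal (g X (y - snd p i)) \<partial>tree_law (shift e)) * ennreal (1 / offspring_mean (e 0)) \<partial>e 0)"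
  proof (intro nn_integral_cong)
    fix p :: mark
    have c: "(\<integral>\<^sup>+Y. ennreal (g (Y i) (y - snd p i)) \<partial>forest_law (shift e))
        = (\<integral>\<^sup>+X. ennreal (g X (y - snd p i)) \<partial>tree_law (shift e))" for i
      by (rule nn_integral_forest_component[OF e', of "\<lambda>X. ennreal (g X (y - snd p i))"]) measurable
    have "(\<integral>\<^sup>+Y. (\<Sum>i<fst p. ennreal (g (Y i) (y - snd p i))) * ennreal (1 / offspring_mean (e 0)) \<partial>forest_law (shift e))
      = (\<Sum>i<fst p. \<integral>\<^sup>+Y. ennreal (g (Y i) (y - snd p i)) \<partial>forest_law (shift e)) * ennreal (1 / offspring_mean (e 0))"
      by (subst nn_integral_multc) (auto intro!: borel_measurable_sum simp: nn_integral_sum)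
    also have "\<dots> = (\<Sum>i<fst p. \<integral>\<^sup>+X. ennreal (g X (y - snd p i)) \<partial>tree_law (shift e)) * ennreal (1 / offspring_mean (e 0))"
      by (simp only: c)
    finally show "(\<integral>\<^sup>+Y. (\<Sum>i<fst p. ennreal (g (Y i) (y - snd p i))) * ennreal (1 / offspring_mean (e 0)) \<partial>forest_law (shift e))
      = (\<Sum>i<fst p. \<integral>\<^sup>+X. ennreal (g X (y - snd p i)) \<partial>tree_law (shift e)) * ennreal (1 / offspring_mean (e 0))" .
  qed
  also have "\<dots> = (\<integral>\<^sup>+x. (\<integral>\<^sup>+X. ennreal (g X (y - x)) \<partial>tree_law (shift e)) \<partial>disp_law (e 0))"
    by (subst nn_integral_disp_law[OF e]) auto
  finally show ?thesis .
qed

text \<open>Induction at the root composes single steps into a convolution. A particle of generation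
  \<open>k\<close> carries a fresh tree of the environment shifted by \<open>k\<close>, which is why
  the inner integral is taken under that law.\<close>

theorem many_to_one:
  assumes e: "environment e"
    and F: "(\<lambda>(X, y). F X y) \<in> borel_measurable (tree_space \<Otimes>\<^sub>M borel)" "\<And>X y. F X y \<ge> 0"
  shows "(\<integral>\<^sup>+X. ennreal (branching_sum k e F X y) \<partial>tree_law e)
    = (\<integral>\<^sup>+x. (\<integral>\<^sup>+X. ennreal (F X (y - x)) \<partial>tree_law ((shift ^^ k) e)) \<partial>walk_law k e)"
  using e
proof (induction k arbitrary: e y)
  case (0 e)
  note e1 = environmentD(1)[OF 0]
  have "(\<lambda>x. \<integral>\<^sup>+X. ennreal (F X (y - x)) \<partial>tree_law e) \<in> borel_measurable borel"
    by (rule nn_integral_translate_measurable[OF e1 F(1)])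
  then show ?case by (simp add: nn_integral_return)
next
  case (Suc k e)
  note e' = environment_shift[OF Suc.prems]
  let ?e = "(shift ^^ k) (shift e)"
  note e'' = environmentD(1)[OF environment_funpow_shift[OF e', of k]]
  interpret D: prob_space "disp_law (e 0)" by (rule prob_space_disp_law[OF Suc.prems])
  interpret W: prob_space "walk_law k (shift e)" by (rule prob_space_walk_law[OF e'])
  have m: "(\<lambda>x. \<integral>\<^sup>+X. ennreal (F X (y - x)) \<partial>tree_law ?e) \<in> borel_measurable borel"
    by (rule nn_integral_translate_measurable[OF e'' F(1)])
  have "(\<integral>\<^sup>+X. ennreal (branching_sum (Suc k) e F X y) \<partial>tree_law e)
    = (\<integral>\<^sup>+x. (\<integral>\<^sup>+X. ennreal (branching_sum k (shift e) F X (y - x)) \<partial>tree_law (shift e)) \<partial>disp_law (e 0))"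
    unfolding branching_sum.simps
    by (rule nn_integral_tree_law_sum[OF Suc.prems branching_sum_measurable[OF F(1)] branching_sum_nonneg[OF F(2)]])
  also have "\<dots> = (\<integral>\<^sup>+x. (\<integral>\<^sup>+x'. (\<integral>\<^sup>+X. ennreal (F X (y - x - x')) \<partial>tree_law ?e) \<partial>walk_law k (shift e)) \<partial>disp_law (e 0))"
    by (intro nn_integral_cong Suc.IH[OF e'])
  also have "\<dots> = (\<integral>\<^sup>+x. (\<integral>\<^sup>+X. ennreal (F X (y - x)) \<partial>tree_law ?e) \<partial>walk_law (Suc k) e)"
    using m by (simp, subst nn_integral_convolution) (auto simp: algebra_simps D.finite_measure_axioms W.finite_measure_axioms)
  finally show ?case by (simp add: funpow_swap1)
qed

lemma nn_integral_norm_pop: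
  assumes e: "environment e"
  shows "(\<integral>\<^sup>+X. ennreal (norm_pop k e X) \<partial>tree_law e) = 1"
proof -
  interpret T: prob_space "tree_law ((shift ^^ k) e)"
    by (intro prob_space_tree_law environmentD environment_funpow_shift e)
  interpret W: prob_space "walk_law k e" by (rule prob_space_walk_law[OF e])
  show ?thesis
    unfolding norm_pop_def by (subst many_to_one[OF e]) (simp_all add: T.emeasure_space_1 W.emeasure_space_1[simplified])
qed

section \<open>Second moments and uniform integrability\<close>

lemma integrable_square_bound:
  fixes f :: "'a \<Rightarrow> real"
  assumes "prob_space M" "f \<in> borel_measurable M" "(\<integral>\<^sup>+x. ennreal ((f x)\<^sup>2) \<partial>M) \<le> ennreal B" "B \<ge> 0"
  shows "integrable M (\<lambda>x. (f x)\<^sup>2)" "integrable M f" "(\<integral>x. (f x)\<^sup>2 \<partial>M) \<le> B"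
proof -
  interpret prob_space M by fact
  have fin: "(\<integral>\<^sup>+x. ennreal ((f x)\<^sup>2) \<partial>M) < \<infinity>"
    using le_less_trans[OF assms(3) ennreal_less_top] by (simp only: infinity_ennreal_def)
  show 1: "integrable M (\<lambda>x. (f x)\<^sup>2)"
    by (rule integrableI_nonneg[OF borel_measurable_power[OF assms(2)] _ fin]) simp
  show "integrable M f" by (rule square_integrable_imp_integrable[OF assms(2) 1])
  have "ennreal (\<integral>x. (f x)\<^sup>2 \<partial>M) \<le> ennreal B"
    using assms(3) nn_integral_eq_integral[OF 1] by simp
  then show "(\<integral>x. (f x)\<^sup>2 \<partial>M) \<le> B"
    using assms(4) by (subst (asm) ennreal_le_iff)
qed

lemma integrable_mult_square:
  fixes f g :: "'a \<Rightarrow> real"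
  assumes "integrable M (\<lambda>x. (f x)\<^sup>2)" "integrable M (\<lambda>x. (g x)\<^sup>2)" "f \<in> borel_measurable M" "g \<in> borel_measurable M"
  shows "integrable M (\<lambda>x. f x * g x)"
proof (rule Bochner_Integration.integrable_bound)
  show "integrable M (\<lambda>x. (f x)\<^sup>2 + (g x)\<^sup>2)" using assms by simp
  have "\<bar>a * b\<bar> \<le> a\<^sup>2 + b\<^sup>2" for a b :: real
  proof -
    have "0 \<le> (\<bar>a\<bar> - \<bar>b\<bar>)\<^sup>2" by simp
    then have "2 * \<bar>a * b\<bar> \<le> a\<^sup>2 + b\<^sup>2" by (simp add: power2_diff abs_mult)
    moreover have "0 \<le> \<bar>a * b\<bar>" by simp
    ultimately show ?thesis by linarith
  qed
  then show "AE x in M. norm (f x * g x) \<le> norm ((f x)\<^sup>2 + (g x)\<^sup>2)"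
    by (intro AE_I2) simp
  show "(\<lambda>x. f x * g x) \<in> borel_measurable M"
    by (rule borel_measurable_times[OF assms(3,4)])
qed

lemma integrable_forest_component:
  fixes f :: "marks \<Rightarrow> real"
  assumes e: "mark_laws e" and f: "integrable (tree_law e) f"
  shows "integrable (forest_law e) (\<lambda>Y. f (Y i))" "(\<integral>Y. f (Y i) \<partial>forest_law e) = (\<integral>X. f X \<partial>tree_law e)"
proof -
  note [measurable_cong] = sets_forest_law[OF e] sets_tree_law[OF e]
  have m: "(\<lambda>Y. Y i) \<in> forest_law e \<rightarrow>\<^sub>M tree_law e" by measurable
  show "integrable (forest_law e) (\<lambda>Y. f (Y i))"
    by (rule integrable_distr[OF m]) (simp add: distr_forest_component[OF e] f)
  show "(\<integral>Y. f (Y i) \<partial>forest_law e) = (\<integral>X. f X \<partial>tree_law e)"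
    using integral_distr[OF m borel_measurable_integrable[OF f]] by (simp add: distr_forest_component[OF e])
qed

text \<open>Centred functionals of different subtrees are uncorrelated, so second moments add. The
  cross term vanishes on resampling tree \<open>n\<close>, on which the partial sum
  \<open>?S\<close> does not depend. Integrability and the zero mean are part of the claim because
  the induction step uses them.\<close>

lemma forest_second_moment:
  fixes g :: "nat \<Rightarrow> marks \<Rightarrow> real"
  assumes e: "mark_laws e" and g [measurable]: "\<And>i. g i \<in> borel_measurable tree_space"
    and sq: "\<And>i. (\<integral>\<^sup>+X. ennreal ((g i X)\<^sup>2) \<partial>tree_law e) \<le> ennreal B" and "B \<ge> 0"
    and zero: "\<And>i. (\<integral>X. g i X \<partial>tree_law e) = 0"
  shows "integrable (forest_law e) (\<lambda>Y. (\<Sum>i<n. g i (Y i))\<^sup>2) \<and> (\<integral>Y. (\<Sum>i<n. g i (Y i))\<^sup>2 \<partial>forest_law e) \<le> n * B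
    \<and> (\<integral>Y. (\<Sum>i<n. g i (Y i)) \<partial>forest_law e) = 0"
proof (induction n)
  case (Suc n)
  note [measurable_cong] = sets_forest_law[OF e] sets_tree_law[OF e]
  interpret F: prob_space "forest_law e" by (rule prob_space_forest_law[OF e])
  have gm: "g n \<in> borel_measurable (tree_law e)" by measurable
  note gn = integrable_square_bound[OF prob_space_tree_law[OF e] gm sq \<open>B \<ge> 0\<close>]
  let ?S = "\<lambda>Y. \<Sum>i<n. g i (Y i)"
  have S [measurable]: "?S \<in> borel_measurable (forest_law e)" by measurable
  have G [measurable]: "(\<lambda>Y. g n (Y n)) \<in> borel_measurable (forest_law e)" by measurable
  have Ssq: "integrable (forest_law e) (\<lambda>Y. (?S Y)\<^sup>2)" using Suc by simp
  have Gsq: "integrable (forest_law e) (\<lambda>Y. (g n (Y n))\<^sup>2)"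
    by (rule integrable_forest_component(1)[OF e gn(1)])
  have SG: "integrable (forest_law e) (\<lambda>Y. ?S Y * g n (Y n))"
    by (rule integrable_mult_square[OF Ssq Gsq S G])
  have upd: "?S (Y(n := X)) = ?S Y" for X Y by (intro sum.cong) auto
  have "(\<integral>Y. ?S Y * g n (Y n) \<partial>forest_law e) = (\<integral>X. (\<integral>Y. ?S Y * g n X \<partial>forest_law e) \<partial>tree_law e)"
    by (subst integral_forest_resample[OF e SG, of n]) (simp only: fun_upd_same upd)
  then have SG0: "(\<integral>Y. ?S Y * g n (Y n) \<partial>forest_law e) = 0" using Suc by simp
  have eq: "(\<Sum>i<Suc n. g i (Y i))\<^sup>2 = (?S Y)\<^sup>2 + 2 * (?S Y * g n (Y n)) + (g n (Y n))\<^sup>2" for Y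
    by (simp add: power2_sum algebra_simps)
  have "(\<integral>Y. (\<Sum>i<Suc n. g i (Y i))\<^sup>2 \<partial>forest_law e)
      = (\<integral>Y. (?S Y)\<^sup>2 \<partial>forest_law e) + 2 * 0 + (\<integral>X. (g n X)\<^sup>2 \<partial>tree_law e)"
    unfolding eq using Ssq Gsq SG integrable_forest_component(2)[OF e gn(1), of n] SG0 by simp
  also have "\<dots> \<le> real (Suc n) * B" using Suc gn(3) by (simp add: algebra_simps)
  finally have 1: "(\<integral>Y. (\<Sum>i<Suc n. g i (Y i))\<^sup>2 \<partial>forest_law e) \<le> real (Suc n) * B" .
  have 2: "integrable (forest_law e) (\<lambda>Y. (\<Sum>i<Suc n. g i (Y i))\<^sup>2)"
    unfolding eq using Ssq Gsq SG by simp
  have 3: "integrable (forest_law e) ?S" using S Ssq by (rule F.square_integrable_imp_integrable)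
  have 4: "(\<integral>Y. (\<Sum>i<Suc n. g i (Y i)) \<partial>forest_law e) = 0"
    using 3 Suc integrable_forest_component[OF e gn(2), of n] zero[of n] by simp
  show ?case using 1 2 4 by blast
qed (simp add: zero)

text \<open>Since \<open>F\<close> is centred for every barrier, the sum is centred given the root
  mark, so only the mean number of children enters. One generation contributes a factor
  \<open>m\<close> for the children and \<open>1 / m^2\<close> for the normalisation, hence
  \<open>1 / m\<close> in total.\<close>

theorem branching_sum_second_moment:
  assumes e: "environment e"
    and F: "(\<lambda>(X, y). F X y) \<in> borel_measurable (tree_space \<Otimes>\<^sub>M borel)" "\<And>X y. \<bar>F X y\<bar> \<le> C"
    and zero: "\<And>y. (\<integral>X. F X y \<partial>tree_law ((shift ^^ k) e)) = 0"
  shows "(\<integral>\<^sup>+X. ennreal ((branching_sum k e F X y)\<^sup>2) \<partial>tree_law e) \<le> ennreal (C\<^sup>2 / prod_mean e k)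
    \<and> (\<integral>X. branching_sum k e F X y \<partial>tree_law e) = 0"
  using e zero
proof (induction k arbitrary: e y)
  case (0 e)
  interpret T: prob_space "tree_law e" by (rule prob_space_tree_law[OF environmentD(1)[OF 0(1)]])
  have "(F X y)\<^sup>2 \<le> C\<^sup>2" for X using F(2)[of X y] by (metis abs_ge_zero power2_abs power_mono)
  then have "(\<integral>\<^sup>+X. ennreal ((F X y)\<^sup>2) \<partial>tree_law e) \<le> (\<integral>\<^sup>+X. ennreal (C\<^sup>2) \<partial>tree_law e)"
    by (intro nn_integral_mono) (simp add: ennreal_leI)
  then show ?case using 0(2)[of y] by (simp add: T.emeasure_space_1 prod_mean_def)
next
  case (Suc k e)
  note e = \<open>environment e\<close>
  note e1 = environmentD(1)[OF e] and e' = environment_shift[OF e]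
  note e1' = environmentD(1)[OF e']
  note [measurable_cong] = sets_forest_law[OF e1'] sets_tree_law[OF e1']
  let ?m = "offspring_mean (e 0)"
  have m: "?m > 0" by (rule environmentD(2)[OF e])
  define B where "B = C\<^sup>2 / prod_mean (shift e) k"
  have B: "B \<ge> 0" using prod_mean_pos[OF e', of k] by (simp add: B_def)
  have IH: "(\<integral>\<^sup>+X. ennreal ((branching_sum k (shift e) F X z)\<^sup>2) \<partial>tree_law (shift e)) \<le> ennreal B"
    "(\<integral>X. branching_sum k (shift e) F X z \<partial>tree_law (shift e)) = 0" for z
    using Suc.IH[OF e', of z] Suc.prems(2) by (auto simp: B_def funpow_swap1)
  note bm = branching_sum_measurable1[OF F(1)]
  have second: "integrable (forest_law (shift e)) (\<lambda>Y. (\<Sum>i<fst p. branching_sum k (shift e) F (Y i) (y - snd p i))\<^sup>2)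
    \<and> (\<integral>Y. (\<Sum>i<fst p. branching_sum k (shift e) F (Y i) (y - snd p i))\<^sup>2 \<partial>forest_law (shift e)) \<le> fst p * B
    \<and> (\<integral>Y. (\<Sum>i<fst p. branching_sum k (shift e) F (Y i) (y - snd p i)) \<partial>forest_law (shift e)) = 0" for p :: mark
    by (rule forest_second_moment[OF e1' bm IH(1) B IH(2)])
  have hm: "(\<lambda>X. ennreal ((branching_sum (Suc k) e F X y)\<^sup>2)) \<in> borel_measurable tree_space"
    using bm[of "Suc k"] by (intro measurable_compose[OF _ measurable_ennreal] borel_measurable_power)
  have "(\<integral>\<^sup>+X. ennreal ((branching_sum (Suc k) e F X y)\<^sup>2) \<partial>tree_law e)
    = (\<integral>\<^sup>+p. (\<integral>\<^sup>+Y. ennreal (((\<Sum>i<fst p. branching_sum k (shift e) F (Y i) (y - snd p i)) / ?m)\<^sup>2) \<partial>forest_law (shift e)) \<partial>e 0)"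
    by (subst nn_integral_tree_law[OF e1 hm]) simp
  also have "\<dots> \<le> (\<integral>\<^sup>+p. ennreal (real (fst p) * (B / ?m\<^sup>2)) \<partial>e 0)"
  proof (rule nn_integral_mono)
    fix p :: mark
    have "integrable (forest_law (shift e)) (\<lambda>Y. ((\<Sum>i<fst p. branching_sum k (shift e) F (Y i) (y - snd p i)) / ?m)\<^sup>2)"
      using second[of p] by (simp add: power_divide)
    then have "(\<integral>\<^sup>+Y. ennreal (((\<Sum>i<fst p. branching_sum k (shift e) F (Y i) (y - snd p i)) / ?m)\<^sup>2) \<partial>forest_law (shift e))
      = ennreal (\<integral>Y. ((\<Sum>i<fst p. branching_sum k (shift e) F (Y i) (y - snd p i)) / ?m)\<^sup>2 \<partial>forest_law (shift e))"
      by (intro nn_integral_eq_integral) auto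
    also have "\<dots> = ennreal ((\<integral>Y. (\<Sum>i<fst p. branching_sum k (shift e) F (Y i) (y - snd p i))\<^sup>2 \<partial>forest_law (shift e)) / ?m\<^sup>2)"
      by (simp add: power_divide)
    also have "\<dots> \<le> ennreal (fst p * B / ?m\<^sup>2)"
      using second[of p] m by (intro ennreal_leI divide_right_mono) auto
    finally show "(\<integral>\<^sup>+Y. ennreal (((\<Sum>i<fst p. branching_sum k (shift e) F (Y i) (y - snd p i)) / ?m)\<^sup>2) \<partial>forest_law (shift e))
      \<le> ennreal (real (fst p) * (B / ?m\<^sup>2))" by simp
  qed
  also have "\<dots> = ennreal (?m * (B / ?m\<^sup>2))"
    using B by (intro nn_integral_offspring[OF e]) simp
  also have "?m * (B / ?m\<^sup>2) = C\<^sup>2 / prod_mean e (Suc k)"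
    using m by (simp add: B_def prod_mean_Suc_shift power2_eq_square)
  finally have 1: "(\<integral>\<^sup>+X. ennreal ((branching_sum (Suc k) e F X y)\<^sup>2) \<partial>tree_law e) \<le> ennreal (C\<^sup>2 / prod_mean e (Suc k))" .
  have "(\<lambda>X. branching_sum (Suc k) e F X y) \<in> borel_measurable (tree_law e)"
    by (subst measurable_cong_sets[OF sets_tree_law[OF e1] refl]) (rule bm)
  then have "integrable (tree_law e) (\<lambda>X. branching_sum (Suc k) e F X y)"
    using prod_mean_pos[OF e, of "Suc k"]
    by (intro integrable_square_bound(2)[OF prob_space_tree_law[OF e1] _ 1]) auto
  then have "(\<integral>X. branching_sum (Suc k) e F X y \<partial>tree_law e)
    = (\<integral>p. (\<integral>Y. branching_sum (Suc k) e F (graft p Y) y \<partial>forest_law (shift e)) \<partial>e 0)"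
    by (rule integral_tree_law[OF e1])
  also have "\<dots> = 0" using second by simp
  finally show ?case using 1 by blast
qed

text \<open>The mean of \<open>min 1 (c * N)\<close> under the size-biased offspring law. The
  function \<open>min 1\<close> is chosen because it is subadditive on nonnegative numbers, as the
  recursion requires, and because its sum over geometrically decreasing \<open>c\<close> grows like
  a logarithm of \<open>N\<close>.\<close>

definition size_biased_tail :: "mark measure \<Rightarrow> real \<Rightarrow> ennreal" where
  "size_biased_tail \<kappa> c = (\<integral>\<^sup>+p. ennreal (real (fst p) / offspring_mean \<kappa> * min 1 (c * real (fst p))) \<partial>\<kappa>)"

lemma min_one_add_le: "min 1 (a + b) \<le> min 1 a + min 1 (b :: real)" if "a \<ge> 0" "b \<ge> 0"
  using that by (auto simp: min_def)

text \<open>The total population is split into that of subtree \<open>i\<close> and that of its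
  siblings, and \<open>min 1\<close> is subadditive. The sibling part \<open>?R\<close> is decoupled
  by resampling tree \<open>i\<close>, whose normalised population has mean one; the mean of
  \<open>?R\<close> is bounded by 1 and, since each sibling has mean one, by
  \<open>c * n\<close>.\<close>

lemma forest_uniform_bound:
  assumes e: "environment e" and c: "c \<ge> 0" and i: "i < n"
  shows "(\<integral>\<^sup>+Y. ennreal (norm_pop k e (Y i) * min 1 (c * (\<Sum>j<n. norm_pop k e (Y j)))) \<partial>forest_law e)
    \<le> (\<integral>\<^sup>+X. ennreal (norm_pop k e X * min 1 (c * norm_pop k e X)) \<partial>tree_law e) + ennreal (min 1 (c * n))"
proof -
  note e1 = environmentD(1)[OF e]
  note [measurable_cong] = sets_forest_law[OF e1] sets_tree_law[OF e1]
  interpret F: prob_space "forest_law e" by (rule prob_space_forest_law[OF e1])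
  let ?W = "norm_pop k e"
  have W0 [simp]: "?W X \<ge> 0" for X by (rule norm_pop_nonneg)
  let ?R = "\<lambda>Y. min 1 (c * (\<Sum>j\<in>{..<n} - {i}. ?W (Y j)))"
  have Rm [measurable]: "?R \<in> borel_measurable (forest_law e)" by measurable
  have upd: "?R (Y(i := X)) = ?R Y" for X Y
    by (intro arg_cong[where f="\<lambda>x. min 1 (c * x)"] sum.cong) auto
  have rm: "(\<lambda>Y. ennreal (?W (Y i) * ?R Y)) \<in> borel_measurable (\<Pi>\<^sub>M i\<in>UNIV. tree_space)"
    by measurable
  have mean_one: "(\<integral>\<^sup>+Y. ennreal (?W (Y j)) \<partial>forest_law e) = 1" for j
    using nn_integral_forest_component[OF e1, of "\<lambda>X. ennreal (?W X)" j] nn_integral_norm_pop[OF e, of k] by simp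
  have R0: "?R Y \<ge> 0" for Y using c by (auto intro!: mult_nonneg_nonneg sum_nonneg)
  have "(\<integral>\<^sup>+Y. ennreal (?W (Y i) * min 1 (c * (\<Sum>j<n. ?W (Y j)))) \<partial>forest_law e)
    \<le> (\<integral>\<^sup>+Y. ennreal (?W (Y i) * min 1 (c * ?W (Y i))) + ennreal (?W (Y i) * ?R Y) \<partial>forest_law e)"
  proof (intro nn_integral_mono)
    fix Y :: "nat \<Rightarrow> marks"
    have "(\<Sum>j<n. ?W (Y j)) = ?W (Y i) + (\<Sum>j\<in>{..<n} - {i}. ?W (Y j))"
      using i by (subst sum.remove[of _ i]) auto
    then have "min 1 (c * (\<Sum>j<n. ?W (Y j))) \<le> min 1 (c * ?W (Y i)) + ?R Y"
      using c by (auto simp: distrib_left intro!: min_one_add_le mult_nonneg_nonneg sum_nonneg)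
    then have "?W (Y i) * min 1 (c * (\<Sum>j<n. ?W (Y j))) \<le> ?W (Y i) * min 1 (c * ?W (Y i)) + ?W (Y i) * ?R Y"
      by (metis W0 distrib_left mult_left_mono)
    then show "ennreal (?W (Y i) * min 1 (c * (\<Sum>j<n. ?W (Y j)))) \<le> ennreal (?W (Y i) * min 1 (c * ?W (Y i))) + ennreal (?W (Y i) * ?R Y)"
      using c R0[of Y] by (subst ennreal_plus[symmetric]) (auto intro!: ennreal_leI simp del: ennreal_plus)
  qed
  also have "\<dots> = (\<integral>\<^sup>+Y. ennreal (?W (Y i) * min 1 (c * ?W (Y i))) \<partial>forest_law e) + (\<integral>\<^sup>+Y. ennreal (?W (Y i) * ?R Y) \<partial>forest_law e)"
    by (intro nn_integral_add) measurable
  also have "(\<integral>\<^sup>+Y. ennreal (?W (Y i) * min 1 (c * ?W (Y i))) \<partial>forest_law e) = (\<integral>\<^sup>+X. ennreal (?W X * min 1 (c * ?W X)) \<partial>tree_law e)"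
    by (rule nn_integral_forest_component[OF e1, of "\<lambda>X. ennreal (?W X * min 1 (c * ?W X))"]) measurable
  also have "(\<integral>\<^sup>+Y. ennreal (?W (Y i) * ?R Y) \<partial>forest_law e) = (\<integral>\<^sup>+X. \<integral>\<^sup>+Y. ennreal (?W X * ?R Y) \<partial>forest_law e \<partial>tree_law e)"
    by (subst nn_integral_forest_resample[OF e1 rm, of i]) (simp only: fun_upd_same upd)
  also have "\<dots> = (\<integral>\<^sup>+X. ennreal (?W X) * (\<integral>\<^sup>+Y. ennreal (?R Y) \<partial>forest_law e) \<partial>tree_law e)"
    using R0 by (intro nn_integral_cong) (simp add: ennreal_mult nn_integral_cmult)
  also have "\<dots> = (\<integral>\<^sup>+Y. ennreal (?R Y) \<partial>forest_law e)"
    by (subst nn_integral_multc) (auto simp: nn_integral_norm_pop[OF e])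
  also have "\<dots> \<le> ennreal (min 1 (c * n))"
  proof -
    have "(\<integral>\<^sup>+Y. ennreal (?R Y) \<partial>forest_law e) \<le> (\<integral>\<^sup>+Y. 1 \<partial>forest_law e)"
      by (intro nn_integral_mono) (auto simp: ennreal_le_1)
    also have "\<dots> = 1" by (simp add: F.emeasure_space_1)
    finally have 1: "(\<integral>\<^sup>+Y. ennreal (?R Y) \<partial>forest_law e) \<le> 1" .
    have "(\<integral>\<^sup>+Y. ennreal (?R Y) \<partial>forest_law e) \<le> (\<integral>\<^sup>+Y. ennreal c * (\<Sum>j\<in>{..<n} - {i}. ennreal (?W (Y j))) \<partial>forest_law e)"
    proof (intro nn_integral_mono)
      fix Y :: "nat \<Rightarrow> marks"
      have "ennreal (?R Y) \<le> ennreal (c * (\<Sum>j\<in>{..<n} - {i}. ?W (Y j)))" by (intro ennreal_leI) simp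
      then show "ennreal (?R Y) \<le> ennreal c * (\<Sum>j\<in>{..<n} - {i}. ennreal (?W (Y j)))"
        using c by (simp add: ennreal_mult sum_nonneg sum_ennreal)
    qed
    also have "\<dots> = ennreal c * (\<Sum>j\<in>{..<n} - {i}. \<integral>\<^sup>+Y. ennreal (?W (Y j)) \<partial>forest_law e)"
      by (simp add: nn_integral_cmult nn_integral_sum del: sum_ennreal)
    also have "\<dots> = ennreal c * (\<Sum>j\<in>{..<n} - {i}. 1)"
      by (simp only: mean_one)
    also have "\<dots> \<le> ennreal (c * n)"
      using c i by (simp add: ennreal_mult ennreal_of_nat_eq_real_of_nat card_Diff_singleton)
        (auto intro!: mult_left_mono ennreal_leI)
    finally have 2: "(\<integral>\<^sup>+Y. ennreal (?R Y) \<partial>forest_law e) \<le> ennreal (c * n)" .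
    show ?thesis
    proof (cases "1 \<le> c * real n")
      case True
      with 1 show ?thesis by (simp only: min.absorb1 ennreal_1)
    next
      case False
      then have "min 1 (c * real n) = c * real n" by simp
      with 2 show ?thesis by (simp only:)
    qed
  qed
  finally show ?thesis by (simp add: add_left_mono)
qed

text \<open>Each generation divides the population by its offspring mean, so after the root the
  parameter \<open>l\<close> continues as \<open>l / m\<close>. Iteration produces
  \<open>l / prod_mean e (Suc k)\<close> in the error term of generation \<open>k\<close>.\<close>

theorem norm_pop_truncated_moment:
  assumes e: "environment e" and l: "l \<ge> 0"
  shows "(\<integral>\<^sup>+X. ennreal (norm_pop n e X * min 1 (l * norm_pop n e X)) \<partial>tree_law e)
    \<le> ennreal (min 1 (l / prod_mean e n)) + (\<Sum>k<n. size_biased_tail (e k) (l / prod_mean e (Suc k)))"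
  using e l
proof (induction n arbitrary: e l)
  case (0 e l)
  interpret T: prob_space "tree_law e" by (rule prob_space_tree_law[OF environmentD(1)[OF 0(1)]])
  show ?case by (simp add: T.emeasure_space_1 prod_mean_def)
next
  case (Suc n e l)
  note e = \<open>environment e\<close>
  note e1 = environmentD(1)[OF e] and e' = environment_shift[OF e]
  note e1' = environmentD(1)[OF e']
  note [measurable_cong] = sets_forest_law[OF e1'] sets_tree_law[OF e1'] mark_lawsD(2)[OF e1]
  let ?m = "offspring_mean (e 0)" and ?W = "norm_pop n (shift e)"
  have m: "?m > 0" by (rule environmentD(2)[OF e])
  have lm: "l / ?m \<ge> 0" using Suc.prems(2) m by simp
  let ?U = "\<integral>\<^sup>+X. ennreal (?W X * min 1 (l / ?m * ?W X)) \<partial>tree_law (shift e)"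
  have nm: "norm_pop (Suc n) e \<in> borel_measurable tree_space" by (rule norm_pop_measurable)
  have hm: "(\<lambda>X. ennreal (norm_pop (Suc n) e X * min 1 (l * norm_pop (Suc n) e X))) \<in> borel_measurable tree_space"
    using nm by (intro measurable_compose[OF _ measurable_ennreal] borel_measurable_times borel_measurable_min borel_measurable_const)
  have om: "(\<lambda>p. f (fst p)) \<in> borel_measurable mark_space" for f :: "nat \<Rightarrow> ennreal"
    by (rule measurable_compose[OF mark_measurable(1)]) simp
  have om': "(\<lambda>p. f (fst p)) \<in> borel_measurable (e 0)" for f :: "nat \<Rightarrow> ennreal"
    using om[of f] by (subst measurable_cong_sets[OF mark_lawsD(2)[OF e1] refl])
  have "(\<integral>\<^sup>+X. ennreal (norm_pop (Suc n) e X * min 1 (l * norm_pop (Suc n) e X)) \<partial>tree_law e)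
    = (\<integral>\<^sup>+p. \<integral>\<^sup>+Y. ennreal (norm_pop (Suc n) e (graft p Y) * min 1 (l * norm_pop (Suc n) e (graft p Y))) \<partial>forest_law (shift e) \<partial>e 0)"
    by (rule nn_integral_tree_law[OF e1 hm])
  also have "\<dots> = (\<integral>\<^sup>+p. \<integral>\<^sup>+Y. (\<Sum>i<fst p. ennreal (1 / ?m) * ennreal (?W (Y i) * min 1 (l / ?m * (\<Sum>j<fst p. ?W (Y j))))) \<partial>forest_law (shift e) \<partial>e 0)"
  proof (intro nn_integral_cong)
    fix p :: mark and Y :: "nat \<Rightarrow> marks"
    let ?S = "\<Sum>j<fst p. ?W (Y j)" and ?M = "min 1 (l / ?m * (\<Sum>j<fst p. ?W (Y j)))"
    have "?S \<ge> 0" by (intro sum_nonneg norm_pop_nonneg)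
    then have M0: "?M \<ge> 0" using mult_nonneg_nonneg[OF lm] by simp
    have "(\<Sum>i<fst p. 1 / ?m * (?W (Y i) * ?M)) = 1 / ?m * (\<Sum>i<fst p. ?W (Y i) * ?M)"
      by (rule sum_distrib_left[symmetric])
    also have "(\<Sum>i<fst p. ?W (Y i) * ?M) = ?S * ?M"
      by (rule sum_distrib_right[symmetric])
    also have "1 / ?m * (?S * ?M) = ?S / ?m * min 1 (l * (?S / ?m))"
      by (simp only: times_divide_eq_left times_divide_eq_right mult_1_left)
    finally have "norm_pop (Suc n) e (graft p Y) * min 1 (l * norm_pop (Suc n) e (graft p Y))
      = (\<Sum>i<fst p. 1 / ?m * (?W (Y i) * ?M))"
      by (simp only: norm_pop_simps graft_simps)
    then have "ennreal (norm_pop (Suc n) e (graft p Y) * min 1 (l * norm_pop (Suc n) e (graft p Y)))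
      = ennreal (\<Sum>i<fst p. 1 / ?m * (?W (Y i) * ?M))"
      by (rule arg_cong[where f=ennreal])
    also have "\<dots> = (\<Sum>i<fst p. ennreal (1 / ?m * (?W (Y i) * ?M)))"
      using m M0 by (intro sum_ennreal[symmetric] mult_nonneg_nonneg norm_pop_nonneg) simp
    also have "\<dots> = (\<Sum>i<fst p. ennreal (1 / ?m) * ennreal (?W (Y i) * ?M))"
      using m by (intro sum.cong refl ennreal_mult') simp
    finally show "ennreal (norm_pop (Suc n) e (graft p Y) * min 1 (l * norm_pop (Suc n) e (graft p Y))) = \<dots>" .
  qed
  also have "\<dots> \<le> (\<integral>\<^sup>+p. ennreal (real (fst p) * (1 / ?m)) * ?U + ennreal (real (fst p) / ?m * min 1 (l / ?m * real (fst p))) \<partial>e 0)"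
  proof (intro nn_integral_mono)
    fix p :: mark
    have a1: "of_nat (fst p) * ennreal (1 / ?m) = ennreal (real (fst p) * (1 / ?m))"
      using m by (subst ennreal_mult) (simp_all add: ennreal_of_nat_eq_real_of_nat)
    have a2: "ennreal (real (fst p) * (1 / ?m)) * ennreal (min 1 (l / ?m * real (fst p))) = ennreal (real (fst p) / ?m * min 1 (l / ?m * real (fst p)))"
      using m Suc.prems(2) by (subst ennreal_mult[symmetric]) auto
    have WY: "(\<lambda>Y. ?W (Y j)) \<in> borel_measurable (forest_law (shift e))" for j
      using measurable_compose[OF measurable_component_singleton[of j UNIV "\<lambda>_. tree_space"] norm_pop_measurable[of n "shift e"]]
      by (subst measurable_cong_sets[OF sets_forest_law[OF e1'] refl]) simp
    have Wm: "(\<lambda>Y. ennreal (?W (Y i) * min 1 (l / ?m * (\<Sum>j<fst p. ?W (Y j))))) \<in> borel_measurable (forest_law (shift e))" for i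
      by (intro measurable_compose[OF _ measurable_ennreal] borel_measurable_times borel_measurable_min borel_measurable_const
          borel_measurable_sum WY)
    then have Wm': "(\<lambda>Y. ennreal (1 / ?m) * ennreal (?W (Y i) * min 1 (l / ?m * (\<Sum>j<fst p. ?W (Y j))))) \<in> borel_measurable (forest_law (shift e))" for i
      by (rule borel_measurable_times_ennreal[OF borel_measurable_const])
    have "(\<integral>\<^sup>+Y. (\<Sum>i<fst p. ennreal (1 / ?m) * ennreal (?W (Y i) * min 1 (l / ?m * (\<Sum>j<fst p. ?W (Y j))))) \<partial>forest_law (shift e))
      = (\<Sum>i<fst p. ennreal (1 / ?m) * (\<integral>\<^sup>+Y. ennreal (?W (Y i) * min 1 (l / ?m * (\<Sum>j<fst p. ?W (Y j)))) \<partial>forest_law (shift e)))"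
      by (simp only: nn_integral_sum[OF Wm'] nn_integral_cmult[OF Wm])
    also have "\<dots> \<le> (\<Sum>i<fst p. ennreal (1 / ?m) * (?U + ennreal (min 1 (l / ?m * real (fst p)))))"
      using m Suc.prems(2) by (intro sum_mono mult_left_mono forest_uniform_bound[OF e']) auto
    also have "\<dots> = (of_nat (fst p) * ennreal (1 / ?m)) * ?U + (of_nat (fst p) * ennreal (1 / ?m)) * ennreal (min 1 (l / ?m * real (fst p)))"
      by (simp only: sum_constant card_lessThan distrib_left mult.assoc)
    also have "\<dots> = ennreal (real (fst p) * (1 / ?m)) * ?U + ennreal (real (fst p) / ?m * min 1 (l / ?m * real (fst p)))"
      by (simp only: a1 a2)
    finally show "(\<integral>\<^sup>+Y. (\<Sum>i<fst p. ennreal (1 / ?m) * ennreal (?W (Y i) * min 1 (l / ?m * (\<Sum>j<fst p. ?W (Y j))))) \<partial>forest_law (shift e))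
      \<le> ennreal (real (fst p) * (1 / ?m)) * ?U + ennreal (real (fst p) / ?m * min 1 (l / ?m * real (fst p)))" .
  qed
  also have "\<dots> = (\<integral>\<^sup>+p. ennreal (real (fst p) * (1 / ?m)) \<partial>e 0) * ?U + size_biased_tail (e 0) (l / ?m)"
    unfolding size_biased_tail_def
  proof (subst nn_integral_add)
    show "(\<lambda>p. ennreal (real (fst p) * (1 / ?m)) * ?U) \<in> borel_measurable (e 0)"
      by (rule om')
    show "(\<lambda>p. ennreal (real (fst p) / ?m * min 1 (l / ?m * real (fst p)))) \<in> borel_measurable (e 0)"
      by (rule om')
    have "(\<integral>\<^sup>+p. ennreal (real (fst p) * (1 / ?m)) * ?U \<partial>e 0) = (\<integral>\<^sup>+p. ennreal (real (fst p) * (1 / ?m)) \<partial>e 0) * ?U"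
      by (rule nn_integral_multc[OF om'])
    then show "(\<integral>\<^sup>+p. ennreal (real (fst p) * (1 / ?m)) * ?U \<partial>e 0) + (\<integral>\<^sup>+p. ennreal (real (fst p) / ?m * min 1 (l / ?m * real (fst p))) \<partial>e 0)
      = (\<integral>\<^sup>+p. ennreal (real (fst p) * (1 / ?m)) \<partial>e 0) * ?U + (\<integral>\<^sup>+p. ennreal (real (fst p) / ?m * min 1 (l / ?m * real (fst p))) \<partial>e 0)"
      by (simp only:)
  qed
  finally have "(\<integral>\<^sup>+X. ennreal (norm_pop (Suc n) e X * min 1 (l * norm_pop (Suc n) e X)) \<partial>tree_law e)
    \<le> (\<integral>\<^sup>+p. ennreal (real (fst p) * (1 / ?m)) \<partial>e 0) * ?U + size_biased_tail (e 0) (l / ?m)" .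
  \<comment> \<open>The coefficient of the induction term is the mean of \<open>N / m\<close>, which
    is one. The errors of the generations therefore add up without being amplified.\<close>
  moreover have "(\<integral>\<^sup>+p. ennreal (real (fst p) * (1 / ?m)) \<partial>e 0) = 1"
    using m by (subst nn_integral_offspring[OF e]) auto
  ultimately have step: "(\<integral>\<^sup>+X. ennreal (norm_pop (Suc n) e X * min 1 (l * norm_pop (Suc n) e X)) \<partial>tree_law e)
    \<le> ?U + size_biased_tail (e 0) (l / ?m)" by (simp only: mult_1_left)
  have pm: "l / ?m / prod_mean (shift e) k = l / prod_mean e (Suc k)" for k
    by (simp only: prod_mean_Suc_shift divide_divide_eq_left)
  have U: "?U \<le> ennreal (min 1 (l / ?m / prod_mean (shift e) n))
      + (\<Sum>k<n. size_biased_tail (shift e k) (l / ?m / prod_mean (shift e) (Suc k)))"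
    by (rule Suc.IH[OF e' lm])
  have "(\<Sum>k<n. size_biased_tail (shift e k) (l / ?m / prod_mean (shift e) (Suc k)))
      = (\<Sum>k<n. size_biased_tail (e (Suc k)) (l / prod_mean e (Suc (Suc k))))"
    by (intro sum.cong refl arg_cong2[where f=size_biased_tail] pm) (simp add: shift_def)
  moreover have "(\<Sum>k<Suc n. size_biased_tail (e k) (l / prod_mean e (Suc k)))
    = size_biased_tail (e 0) (l / ?m) + (\<Sum>k<n. size_biased_tail (e (Suc k)) (l / prod_mean e (Suc (Suc k))))"
    by (subst sum.lessThan_Suc_shift) (simp add: prod_mean_def)
  moreover have "ennreal (min 1 (l / ?m / prod_mean (shift e) n)) = ennreal (min 1 (l / prod_mean e (Suc n)))"
    by (intro arg_cong[where f="\<lambda>x. ennreal (min 1 x)"] pm)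
  ultimately show ?case
    using order_trans[OF step add_right_mono[OF U]] by (simp only: add.assoc add.commute add.left_commute)
qed

section \<open>Laplace transforms and extinction\<close>

definition pgf :: "mark measure \<Rightarrow> real \<Rightarrow> real" where
  "pgf \<kappa> t = (\<integral>p. t ^ fst p \<partial>\<kappa>)"

definition laplace :: "nat \<Rightarrow> (nat \<Rightarrow> mark measure) \<Rightarrow> real \<Rightarrow> real" where
  "laplace n e l = (\<integral>X. exp (- (l * norm_pop n e X)) \<partial>tree_law e)"

text \<open>Written as the integral of a 0-1 function so that \<open>forest_prod\<close> applies in
  the same way as to \<open>laplace\<close>.\<close>

definition extinct :: "nat \<Rightarrow> (nat \<Rightarrow> mark measure) \<Rightarrow> real" where
  "extinct n e = (\<integral>X. (if norm_pop n e X = 0 then 1 else 0) \<partial>tree_law e)"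

lemma forest_prod:
  fixes g :: "marks \<Rightarrow> real"
  assumes e: "mark_laws e" and g [measurable]: "g \<in> borel_measurable tree_space" and b: "\<And>X. 0 \<le> g X" "\<And>X. g X \<le> 1"
  shows "(\<integral>Y. (\<Prod>i<n. g (Y i)) \<partial>forest_law e) = (\<integral>X. g X \<partial>tree_law e) ^ n"
proof (induction n)
  case 0
  interpret F: prob_space "forest_law e" by (rule prob_space_forest_law[OF e])
  show ?case by (simp add: F.prob_space)
next
  case (Suc n)
  note [measurable_cong] = sets_forest_law[OF e] sets_tree_law[OF e]
  interpret F: prob_space "forest_law e" by (rule prob_space_forest_law[OF e])
  have "integrable (forest_law e) (\<lambda>Y. (\<Prod>i<n. g (Y i)) * g (Y n))"
  proof (rule F.integrable_const_bound[where B=1])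
    show "AE Y in forest_law e. norm ((\<Prod>i<n. g (Y i)) * g (Y n)) \<le> 1"
      using b by (intro AE_I2) (simp add: abs_mult abs_prod mult_le_one prod_le_1 prod_nonneg)
  qed measurable
  from integral_forest_resample[OF e this, of n]
  have "(\<integral>Y. (\<Prod>i<n. g (Y i)) * g (Y n) \<partial>forest_law e)
    = (\<integral>X. (\<integral>Y. (\<Prod>i<n. g ((Y(n := X)) i)) * g ((Y(n := X)) n) \<partial>forest_law e) \<partial>tree_law e)" .
  moreover have "(\<Prod>i<n. g ((Y(n := X)) i)) = (\<Prod>i<n. g (Y i))" for X Y by (intro prod.cong) auto
  ultimately show ?case using Suc by simp
qed

lemma mark_integrable:
  fixes f :: "nat \<Rightarrow> real"
  assumes e: "mark_laws e" and "\<And>n. \<bar>f n\<bar> \<le> B"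
  shows "integrable (e k) (\<lambda>p. f (fst p))"
proof -
  interpret prob_space "e k" by (rule mark_lawsD[OF e])
  show ?thesis
  proof (rule integrable_const_bound[where B=B])
    show "(\<lambda>p. f (fst p)) \<in> borel_measurable (e k)"
      by (subst measurable_cong_sets[OF mark_lawsD(2)[OF e] refl]) (rule measurable_compose[OF mark_measurable(1)], simp)
  qed (use assms in auto)
qed

lemma offspring_integrable:
  assumes e: "environment e"
  shows "integrable (e k) (\<lambda>p. real (fst p))" "(\<integral>p. real (fst p) \<partial>e k) = offspring_mean (e k)"
proof -
  have m: "(\<lambda>p. real (fst p)) \<in> borel_measurable (e k)"
    by (subst measurable_cong_sets[OF mark_lawsD(2)[OF environmentD(1)[OF e]] refl])
      (rule measurable_compose[OF mark_measurable(1)], simp)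
  have n: "(\<integral>\<^sup>+p. ennreal (real (fst p)) \<partial>e k) = ennreal (offspring_mean (e k))"
    using nn_integral_offspring[OF e, of 1 k] by simp
  show "integrable (e k) (\<lambda>p. real (fst p))"
    using m n by (intro integrableI_nonneg) auto
  show "(\<integral>p. real (fst p) \<partial>e k) = offspring_mean (e k)"
    using m n by (intro integral_eq_nn_integral[THEN trans]) (auto simp: offspring_mean_nonneg)
qed

lemma pgf_mono:
  assumes e: "mark_laws e" and "0 \<le> s" "s \<le> t" "t \<le> 1"
  shows "pgf (e k) s \<le> pgf (e k) t"
  unfolding pgf_def using assms
  by (intro integral_mono mark_integrable[OF e, where B=1] power_mono) (auto simp: power_abs power_le_one)

lemma pgf_tendsto:
  assumes e: "mark_laws e" and t: "\<And>n. 0 \<le> t n" "\<And>n. t n \<le> 1" "t \<longlonglongrightarrow> s"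
  shows "(\<lambda>n. pgf (e k) (t n)) \<longlonglongrightarrow> pgf (e k) s"
proof -
  interpret prob_space "e k" by (rule mark_lawsD[OF e])
  have m: "(\<lambda>p. t ^ fst p) \<in> borel_measurable (e k)" for t :: real
    by (subst measurable_cong_sets[OF mark_lawsD(2)[OF e] refl]) (rule measurable_compose[OF mark_measurable(1)], simp)
  show ?thesis
    unfolding pgf_def
    by (rule integral_dominated_convergence[where w="\<lambda>_. 1", OF m m])
      (use t in \<open>auto intro!: AE_I2 tendsto_power simp: power_abs power_le_one\<close>)
qed

lemma laplace_integrable:
  assumes e: "environment e" and l: "l \<ge> 0"
  shows "integrable (tree_law e) (\<lambda>X. exp (- (l * norm_pop n e X)))"
proof -
  note e1 = environmentD(1)[OF e]
  interpret T: prob_space "tree_law e" by (rule prob_space_tree_law[OF e1])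
  show ?thesis
  proof (rule T.integrable_const_bound[where B=1])
    have "0 \<le> l * norm_pop n e X" for X using l norm_pop_nonneg by (rule mult_nonneg_nonneg)
    then show "AE X in tree_law e. norm (exp (- (l * norm_pop n e X))) \<le> 1" by (intro AE_I2) simp
    show "(\<lambda>X. exp (- (l * norm_pop n e X))) \<in> borel_measurable (tree_law e)"
      by (subst measurable_cong_sets[OF sets_tree_law[OF e1] refl]) measurable
  qed
qed

lemma extinct_integrable:
  assumes e: "environment e"
  shows "integrable (tree_law e) (\<lambda>X. if norm_pop n e X = 0 then 1 else 0 :: real)"
proof -
  note e1 = environmentD(1)[OF e]
  interpret T: prob_space "tree_law e" by (rule prob_space_tree_law[OF e1])
  show ?thesis
  proof (rule T.integrable_const_bound[where B=1])
    show "(\<lambda>X. if norm_pop n e X = 0 then 1 else 0 :: real) \<in> borel_measurable (tree_law e)"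
      by (subst measurable_cong_sets[OF sets_tree_law[OF e1] refl]) measurable
  qed auto
qed

text \<open>The exponential turns the sum over children into a product of independent factors, and
  the division by the offspring mean moves into the argument.\<close>

lemma laplace_Suc:
  assumes e: "environment e" and l: "l \<ge> 0"
  shows "laplace (Suc n) e l = pgf (e 0) (laplace n (shift e) (l / offspring_mean (e 0)))"
proof -
  note e1 = environmentD(1)[OF e] and e' = mark_laws_shift[OF environmentD(1)[OF e]]
  interpret T: prob_space "tree_law e" by (rule prob_space_tree_law[OF e1])
  let ?m = "offspring_mean (e 0)"
  have m: "?m > 0" by (rule environmentD(2)[OF e])
  have "laplace (Suc n) e l = (\<integral>p. (\<integral>Y. exp (- (l * norm_pop (Suc n) e (graft p Y))) \<partial>forest_law (shift e)) \<partial>e 0)"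
    unfolding laplace_def by (rule integral_tree_law[OF e1 laplace_integrable[OF e l]])
  also have "\<dots> = (\<integral>p. laplace n (shift e) (l / ?m) ^ fst p \<partial>e 0)"
  proof (intro Bochner_Integration.integral_cong refl)
    fix p :: mark
    have "exp (- (l * norm_pop (Suc n) e (graft p Y))) = (\<Prod>i<fst p. exp (- (l / ?m * norm_pop n (shift e) (Y i))))" for Y
      by (simp add: exp_sum[symmetric] sum_negf sum_distrib_left)
        (simp add: sum_distrib_left[symmetric] sum_divide_distrib[symmetric])
    then show "(\<integral>Y. exp (- (l * norm_pop (Suc n) e (graft p Y))) \<partial>forest_law (shift e)) = laplace n (shift e) (l / ?m) ^ fst p"
      unfolding laplace_def using l m norm_pop_nonneg
      by (simp only:) (rule forest_prod[OF e'], auto)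
  qed
  finally show ?thesis by (simp add: pgf_def)
qed

text \<open>A sum of nonnegative subtree populations vanishes exactly when each of them does, so the
  indicator is a product over the children.\<close>

lemma extinct_Suc:
  assumes e: "environment e"
  shows "extinct (Suc n) e = pgf (e 0) (extinct n (shift e))"
proof -
  note e1 = environmentD(1)[OF e] and e' = mark_laws_shift[OF environmentD(1)[OF e]]
  interpret T: prob_space "tree_law e" by (rule prob_space_tree_law[OF e1])
  let ?m = "offspring_mean (e 0)"
  have m: "?m > 0" by (rule environmentD(2)[OF e])
  let ?I = "\<lambda>n e X. if norm_pop n e X = 0 then 1 else 0 :: real"
  have Im [measurable]: "?I n e \<in> borel_measurable tree_space" for n e
    using norm_pop_measurable[of n e] by measurable
  have "extinct (Suc n) e = (\<integral>p. (\<integral>Y. ?I (Suc n) e (graft p Y) \<partial>forest_law (shift e)) \<partial>e 0)"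
    unfolding extinct_def by (rule integral_tree_law[OF e1 extinct_integrable[OF e]])
  also have "\<dots> = (\<integral>p. extinct n (shift e) ^ fst p \<partial>e 0)"
  proof (intro Bochner_Integration.integral_cong refl)
    fix p :: mark
    have "?I (Suc n) e (graft p Y) = (\<Prod>i<fst p. ?I n (shift e) (Y i))" for Y
    proof -
      have "(\<Sum>i<fst p. norm_pop n (shift e) (Y i)) = 0 \<longleftrightarrow> (\<forall>i<fst p. norm_pop n (shift e) (Y i) = 0)"
        by (subst sum_nonneg_eq_0_iff) (auto simp: norm_pop_nonneg)
      then show ?thesis using m by (auto simp: prod_eq_1_iff)
    qed
    then show "(\<integral>Y. ?I (Suc n) e (graft p Y) \<partial>forest_law (shift e)) = extinct n (shift e) ^ fst p"
      unfolding extinct_def by (simp only:) (rule forest_prod[OF e' Im], auto)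
  qed
  finally show ?thesis by (simp add: pgf_def)
qed

context
  fixes e assumes e: "environment e"
begin

lemma laplace_bounds:
  assumes "l \<ge> 0"
  shows "0 \<le> laplace n e l" "laplace n e l \<le> 1" "extinct n e \<le> laplace n e l" "0 \<le> extinct n e"
proof -
  interpret T: prob_space "tree_law e" by (rule prob_space_tree_law[OF environmentD(1)[OF e]])
  show "0 \<le> laplace n e l" "0 \<le> extinct n e" unfolding laplace_def extinct_def by (auto intro!: integral_nonneg)
  have *: "0 \<le> l * norm_pop n e X" for X using assms norm_pop_nonneg by (rule mult_nonneg_nonneg)
  have "laplace n e l \<le> (\<integral>X. 1 \<partial>tree_law e)"
    unfolding laplace_def using * by (intro integral_mono laplace_integrable[OF e] assms) auto
  then show "laplace n e l \<le> 1" by (simp add: T.prob_space)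
  show "extinct n e \<le> laplace n e l"
    unfolding extinct_def laplace_def by (intro integral_mono laplace_integrable[OF e] extinct_integrable[OF e] assms) auto
qed

lemma laplace_antimono:
  assumes "0 \<le> l" "l \<le> l'"
  shows "laplace n e l' \<le> laplace n e l"
  unfolding laplace_def using assms
  by (intro integral_mono laplace_integrable[OF e]) (auto intro: mult_right_mono norm_pop_nonneg)

lemma laplace_0: "laplace 0 e l = exp (- l)"
proof -
  interpret T: prob_space "tree_law e" by (rule prob_space_tree_law[OF environmentD(1)[OF e]])
  show ?thesis by (simp add: laplace_def T.prob_space)
qed

lemma extinct_0: "extinct 0 e = 0"
  by (simp add: extinct_def)

text \<open>The difference of the two transforms is the mean of \<open>exp (- (l * W))\<close> on
  the event that the normalised population \<open>W\<close> is positive, and this integrand is at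
  least \<open>exp (- 1)\<close> where \<open>W \<le> 1 / l\<close>.\<close>

lemma prob_small_norm_pop:
  assumes "l > 0"
  shows "measure (tree_law e) {X. 0 < norm_pop n e X \<and> norm_pop n e X \<le> 1 / l} \<le> exp 1 * (laplace n e l - extinct n e)"
proof -
  note e1 = environmentD(1)[OF e]
  interpret T: prob_space "tree_law e" by (rule prob_space_tree_law[OF e1])
  let ?A = "{X. 0 < norm_pop n e X \<and> norm_pop n e X \<le> 1 / l}"
  have "{X \<in> space tree_space. 0 < norm_pop n e X \<and> norm_pop n e X \<le> 1 / l} \<in> sets tree_space" by measurable
  then have A: "?A \<in> sets (tree_law e)" by (simp add: sets_tree_law[OF e1])
  have "measure (tree_law e) ?A = (\<integral>X. indicator ?A X \<partial>tree_law e)"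
    using A by simp
  also have "\<dots> \<le> (\<integral>X. exp 1 * (exp (- (l * norm_pop n e X)) - (if norm_pop n e X = 0 then 1 else 0)) \<partial>tree_law e)"
  proof (rule integral_mono)
    show "integrable (tree_law e) (indicator ?A :: _ \<Rightarrow> real)" using A by (simp add: T.emeasure_eq_measure)
    show "integrable (tree_law e) (\<lambda>X. exp 1 * (exp (- (l * norm_pop n e X)) - (if norm_pop n e X = 0 then 1 else 0)))"
      using laplace_integrable[OF e, of l n] extinct_integrable[OF e, of n] assms by simp
    fix X
    have "1 \<le> exp 1 * exp (- (l * norm_pop n e X))" if "norm_pop n e X \<le> 1 / l"
      using that assms by (simp add: exp_add[symmetric] field_simps)
    then show "indicator ?A X \<le> exp 1 * (exp (- (l * norm_pop n e X)) - (if norm_pop n e X = 0 then 1 else 0))"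
      by (auto simp: indicator_def)
  qed
  also have "\<dots> = exp 1 * (laplace n e l - extinct n e)"
    using laplace_integrable[OF e, of l n] extinct_integrable[OF e, of n] assms by (simp add: laplace_def extinct_def)
  finally show ?thesis .
qed

text \<open>The elementary inequality \<open>x (1 - min 1 x) \<le> 1 - exp (- x)\<close> turns uniform integrability
  into a bound of the Laplace transform away from one.\<close>

lemma laplace_less_one:
  assumes K: "K > 0" and ui: "(\<integral>\<^sup>+X. ennreal (norm_pop n e X * min 1 (1 / K * norm_pop n e X)) \<partial>tree_law e) \<le> ennreal (1 / 2)"
  shows "laplace n e (1 / K) \<le> 1 - 1 / (2 * K)"
proof -
  note e1 = environmentD(1)[OF e]
  interpret T: prob_space "tree_law e" by (rule prob_space_tree_law[OF e1])
  note [measurable_cong] = sets_tree_law[OF e1]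
  let ?W = "norm_pop n e"
  have W: "integrable (tree_law e) ?W" "(\<integral>X. ?W X \<partial>tree_law e) = 1"
    using nn_integral_norm_pop[OF e, of n]
    by (auto intro!: integrableI_nonneg integral_eq_nn_integral[THEN trans] simp: norm_pop_nonneg)
  have nn: "0 \<le> ?W X * min 1 (1 / K * ?W X)" for X
    using K norm_pop_nonneg[of n e X] by simp
  have M: "integrable (tree_law e) (\<lambda>X. ?W X * min 1 (1 / K * ?W X))"
    by (rule integrableI_nonneg) (use nn le_less_trans[OF ui ennreal_less_top] in auto)
  have "ennreal (\<integral>X. ?W X * min 1 (1 / K * ?W X) \<partial>tree_law e) \<le> ennreal (1 / 2)"
    using ui nn_integral_eq_integral[OF M] nn by simp
  then have M2: "(\<integral>X. ?W X * min 1 (1 / K * ?W X) \<partial>tree_law e) \<le> 1 / 2"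
    by (subst (asm) ennreal_le_iff) auto
  have key: "x - x * min 1 x \<le> 1 - exp (- x)" if "x \<ge> 0" for x :: real
  proof (cases "x \<le> 1")
    case True
    have "exp (- x) \<le> 1 / (1 + x)"
      using exp_ge_add_one_self[of x] that by (simp add: exp_minus inverse_eq_divide field_simps)
    also have "\<dots> \<le> 1 - x + x * x"
      using that by (simp add: field_simps)
    finally show ?thesis using True by simp
  qed (use that in auto)
  have "laplace n e (1 / K) \<le> (\<integral>X. 1 - (1 / K) * (?W X - ?W X * min 1 (1 / K * ?W X)) \<partial>tree_law e)"
    unfolding laplace_def
  proof (rule integral_mono)
    show "integrable (tree_law e) (\<lambda>X. exp (- (1 / K * ?W X)))" using K by (intro laplace_integrable[OF e]) simp
    show "integrable (tree_law e) (\<lambda>X. 1 - (1 / K) * (?W X - ?W X * min 1 (1 / K * ?W X)))"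
      using W M by simp
    fix X
    show "exp (- (1 / K * ?W X)) \<le> 1 - (1 / K) * (?W X - ?W X * min 1 (1 / K * ?W X))"
      using key[of "1 / K * ?W X"] K norm_pop_nonneg[of n e X] by (simp add: algebra_simps)
  qed
  also have "\<dots> = 1 - (1 / K) * (1 - (\<integral>X. ?W X * min 1 (1 / K * ?W X) \<partial>tree_law e))"
    using W M by (simp add: T.prob_space)
  also have "\<dots> \<le> 1 - (1 / K) * (1 - 1 / 2)"
    using M2 K by (intro diff_left_mono mult_left_mono) auto
  finally show ?thesis by simp
qed

end

text \<open>This replaces Jensen's inequality for a martingale. Convexity is used only between
  generations 0 and 1, through the tangent of \<open>exp (- z)\<close> at \<open>z = l\<close>,
  whose remainder integrates to zero because \<open>N / m\<close> has mean one. Later generations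
  follow by monotonicity of the generating function.\<close>

lemma laplace_mono_Suc:
  assumes "environment e" "l \<ge> 0"
  shows "laplace n e l \<le> laplace (Suc n) e l"
  using assms
proof (induction n arbitrary: e l)
  case (0 e l)
  note e = \<open>environment e\<close>
  let ?m = "offspring_mean (e 0)"
  have m: "?m > 0" by (rule environmentD(2)[OF e])
  interpret prob_space "e 0" by (rule mark_lawsD[OF environmentD(1)[OF e]])
  have "exp (- l) = (\<integral>p. exp (- l) * (1 + l - l / ?m * real (fst p)) \<partial>e 0)"
    using offspring_integrable[OF e, of 0] m by (simp add: prob_space)
  also have "\<dots> \<le> (\<integral>p. exp (- (l / ?m)) ^ fst p \<partial>e 0)"
  proof (rule integral_mono)
    show "integrable (e 0) (\<lambda>p. exp (- l) * (1 + l - l / ?m * real (fst p)))"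
      using offspring_integrable[OF e, of 0] by simp
    show "integrable (e 0) (\<lambda>p. exp (- (l / ?m)) ^ fst p)"
      using 0(2) m by (intro mark_integrable[OF environmentD(1)[OF e], where B=1]) (auto intro!: power_le_one)
    fix p :: mark
    have "1 + l - l / ?m * real (fst p) \<le> exp (l - l / ?m * real (fst p))"
      using exp_ge_add_one_self[of "l - l / ?m * real (fst p)"] by linarith
    then have "exp (- l) * (1 + l - l / ?m * real (fst p)) \<le> exp (- l) * exp (l - l / ?m * real (fst p))"
      by (rule mult_left_mono) simp
    also have "\<dots> = exp (- (l / ?m)) ^ fst p"
      by (simp add: exp_add[symmetric] exp_of_nat_mult[symmetric])
    finally show "exp (- l) * (1 + l - l / ?m * real (fst p)) \<le> exp (- (l / ?m)) ^ fst p" .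
  qed
  also have "\<dots> = laplace (Suc 0) e l"
    by (simp add: laplace_Suc[OF e 0(2)] laplace_0[OF environment_shift[OF e]] pgf_def)
  finally show ?case by (simp add: laplace_0[OF e])
next
  case (Suc n e l)
  note e = \<open>environment e\<close>
  have l': "l / offspring_mean (e 0) \<ge> 0" using Suc.prems environmentD(2)[OF e, of 0] by simp
  note e' = environment_shift[OF e]
  show ?case
    unfolding laplace_Suc[OF e Suc.prems(2)]
    by (intro pgf_mono environmentD(1) e laplace_bounds e' l' Suc.IH)
qed

lemma extinct_mono_Suc: "environment e \<Longrightarrow> extinct n e \<le> extinct (Suc n) e"
proof (induction n arbitrary: e)
  case (0 e)
  show ?case using laplace_bounds(4)[OF 0, of 0 "Suc 0"] by (simp add: extinct_0[OF 0])
next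
  case (Suc n e)
  note e' = environment_shift[OF Suc.prems]
  have "extinct (Suc n) (shift e) \<le> 1"
    using laplace_bounds(2,3)[OF e', of 0 "Suc n"] by linarith
  then show ?case
    unfolding extinct_Suc[OF Suc.prems]
    by (intro pgf_mono environmentD(1) Suc.prems laplace_bounds(4)[OF e', of 0] Suc.IH e') auto
qed

section \<open>Limits of the Laplace transforms and their fixed point equations\<close>

definition laplace_lim :: "(nat \<Rightarrow> mark measure) \<Rightarrow> real \<Rightarrow> real" where
  "laplace_lim e l = lim (\<lambda>n. laplace n e l)"

text \<open>The probability that the limit of \<open>norm_pop n e\<close> vanishes, without reference to the limit.\<close>

definition null_prob :: "(nat \<Rightarrow> mark measure) \<Rightarrow> real" where
  "null_prob e = lim (\<lambda>k. laplace_lim e (real k))"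

definition extinct_prob :: "(nat \<Rightarrow> mark measure) \<Rightarrow> real" where
  "extinct_prob e = lim (\<lambda>n. extinct n e)"

lemma laplace_lim:
  assumes e: "environment e" and l: "l \<ge> 0"
  shows "(\<lambda>n. laplace n e l) \<longlonglongrightarrow> laplace_lim e l" "laplace n e l \<le> laplace_lim e l"
    "0 \<le> laplace_lim e l" "laplace_lim e l \<le> 1"
proof -
  have inc: "incseq (\<lambda>n. laplace n e l)" using laplace_mono_Suc[OF e l] by (rule incseq_SucI)
  obtain L where L: "(\<lambda>n. laplace n e l) \<longlonglongrightarrow> L"
    using incseq_convergent[OF inc, of 1] laplace_bounds(2)[OF e l] by blast
  then have eq: "laplace_lim e l = L" unfolding laplace_lim_def by (rule limI)
  show 1: "(\<lambda>n. laplace n e l) \<longlonglongrightarrow> laplace_lim e l" using L eq by simp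
  show 2: "laplace n e l \<le> laplace_lim e l" for n using incseq_le[OF inc 1] .
  show "0 \<le> laplace_lim e l" using 2[of 0] laplace_bounds(1)[OF e l, of 0] by linarith
  show "laplace_lim e l \<le> 1" by (rule LIMSEQ_le_const2[OF 1]) (use laplace_bounds(2)[OF e l] in auto)
qed

lemma laplace_lim_antimono:
  assumes e: "environment e" and "0 \<le> l" "l \<le> l'"
  shows "laplace_lim e l' \<le> laplace_lim e l"
proof (rule LIMSEQ_le)
  show "(\<lambda>n. laplace n e l') \<longlonglongrightarrow> laplace_lim e l'" "(\<lambda>n. laplace n e l) \<longlonglongrightarrow> laplace_lim e l"
    using laplace_lim(1)[OF e] assms by auto
qed (use laplace_antimono[OF e assms(2,3)] in auto)

lemma laplace_lim_fixed_point:
  assumes e: "environment e" and l: "l \<ge> 0"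
  shows "laplace_lim e l = pgf (e 0) (laplace_lim (shift e) (l / offspring_mean (e 0)))"
proof (rule LIMSEQ_unique)
  note e' = environment_shift[OF e]
  have l': "l / offspring_mean (e 0) \<ge> 0" using l environmentD(2)[OF e, of 0] by simp
  show "(\<lambda>n. laplace (Suc n) e l) \<longlonglongrightarrow> laplace_lim e l"
    by (rule LIMSEQ_Suc[OF laplace_lim(1)[OF e l]])
  show "(\<lambda>n. laplace (Suc n) e l) \<longlonglongrightarrow> pgf (e 0) (laplace_lim (shift e) (l / offspring_mean (e 0)))"
    unfolding laplace_Suc[OF e l]
    by (intro pgf_tendsto environmentD(1) e laplace_bounds[OF e' l'] laplace_lim(1)[OF e' l'])
qed

lemma null_prob_limit:
  assumes e: "environment e"
  shows "(\<lambda>k. laplace_lim e (real k)) \<longlonglongrightarrow> null_prob e" "null_prob e \<le> laplace_lim e (real k)"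
    "0 \<le> null_prob e" "null_prob e \<le> 1"
proof -
  have dec: "decseq (\<lambda>k. laplace_lim e (real k))"
    by (intro decseq_SucI laplace_lim_antimono[OF e]) auto
  have "0 \<le> laplace_lim e (real k)" for k by (rule laplace_lim(3)[OF e]) simp
  then obtain L where L: "(\<lambda>k. laplace_lim e (real k)) \<longlonglongrightarrow> L"
    using decseq_convergent[OF dec, of 0] by blast
  then have eq: "null_prob e = L" unfolding null_prob_def by (rule limI)
  show 1: "(\<lambda>k. laplace_lim e (real k)) \<longlonglongrightarrow> null_prob e" using L eq by simp
  show 2: "null_prob e \<le> laplace_lim e (real k)" for k using decseq_ge[OF dec 1] .
  show "0 \<le> null_prob e" by (rule LIMSEQ_le_const[OF 1]) (use laplace_lim(3)[OF e] in auto)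
  show "null_prob e \<le> 1" using 2[of 0] laplace_lim(4)[OF e, of 0] by simp
qed

text \<open>\<open>null_prob\<close> is a limit along the integers, whereas the fixed point equation
  rescales the argument by the inverse offspring mean. Monotonicity in the argument encloses the
  rescaled sequence between values at integers.\<close>

lemma laplace_lim_at_top:
  assumes e: "environment e" and c: "c > 0"
  shows "(\<lambda>k. laplace_lim e (real k * c)) \<longlonglongrightarrow> null_prob e"
proof (rule tendsto_sandwich)
  have f: "filterlim (\<lambda>k. nat \<lfloor>real k * c\<rfloor>) at_top sequentially" using c by real_asymp
  have g: "filterlim (\<lambda>k. nat \<lceil>real k * c\<rceil>) at_top sequentially" using c by real_asymp
  show "\<forall>\<^sub>F k in sequentially. laplace_lim e (real (nat \<lceil>real k * c\<rceil>)) \<le> laplace_lim e (real k * c)"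
    using c by (intro always_eventually allI laplace_lim_antimono[OF e]) (auto simp: real_nat_ceiling_ge)
  show "\<forall>\<^sub>F k in sequentially. laplace_lim e (real k * c) \<le> laplace_lim e (real (nat \<lfloor>real k * c\<rfloor>))"
    using c by (intro always_eventually allI laplace_lim_antimono[OF e]) (auto simp: of_nat_floor)
  show "(\<lambda>k. laplace_lim e (real (nat \<lceil>real k * c\<rceil>))) \<longlonglongrightarrow> null_prob e"
    by (rule filterlim_compose[OF null_prob_limit(1)[OF e] g])
  show "(\<lambda>k. laplace_lim e (real (nat \<lfloor>real k * c\<rfloor>))) \<longlonglongrightarrow> null_prob e"
    by (rule filterlim_compose[OF null_prob_limit(1)[OF e] f])
qed

lemma null_prob_fixed_point:
  assumes e: "environment e"
  shows "null_prob e = pgf (e 0) (null_prob (shift e))"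
proof (rule LIMSEQ_unique)
  note e' = environment_shift[OF e]
  have m: "1 / offspring_mean (e 0) > 0" using environmentD(2)[OF e, of 0] by simp
  show "(\<lambda>k. laplace_lim e (real k)) \<longlonglongrightarrow> null_prob e" by (rule null_prob_limit(1)[OF e])
  have eq: "laplace_lim e (real k) = pgf (e 0) (laplace_lim (shift e) (real k * (1 / offspring_mean (e 0))))" for k
    using laplace_lim_fixed_point[OF e, of "real k"] by simp
  have nn: "0 \<le> real k * (1 / offspring_mean (e 0))" for k
    using m by (intro mult_nonneg_nonneg) auto
  show "(\<lambda>k. laplace_lim e (real k)) \<longlonglongrightarrow> pgf (e 0) (null_prob (shift e))"
    unfolding eq by (intro pgf_tendsto environmentD(1) e laplace_lim_at_top[OF e' m] laplace_lim(3,4)[OF e' nn])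
qed

text \<open>The comparison with \<open>null_prob\<close> passes
  \<open>extinct n e \<le> laplace n e l\<close> to the limit twice, first in the generation and
  then in \<open>l\<close>.\<close>

lemma extinct_prob_limit:
  assumes e: "environment e"
  shows "(\<lambda>n. extinct n e) \<longlonglongrightarrow> extinct_prob e" "extinct n e \<le> extinct_prob e" "0 \<le> extinct_prob e" "extinct_prob e \<le> null_prob e"
proof -
  have inc: "incseq (\<lambda>n. extinct n e)" using extinct_mono_Suc[OF e] by (rule incseq_SucI)
  have b: "extinct n e \<le> laplace n e (real k)" for n k by (rule laplace_bounds(3)[OF e]) simp
  have "extinct n e \<le> 1" for n using b[of n 0] laplace_bounds(2)[OF e, of 0 n] by simp
  then obtain L where L: "(\<lambda>n. extinct n e) \<longlonglongrightarrow> L"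
    using incseq_convergent[OF inc, of 1] by blast
  then have eq: "extinct_prob e = L" unfolding extinct_prob_def by (rule limI)
  show 1: "(\<lambda>n. extinct n e) \<longlonglongrightarrow> extinct_prob e" using L eq by simp
  show 2: "extinct n e \<le> extinct_prob e" for n using incseq_le[OF inc 1] .
  show "0 \<le> extinct_prob e" using 2[of 0] extinct_0[OF e] by simp
  have "extinct_prob e \<le> laplace_lim e (real k)" for k
    by (rule LIMSEQ_le[OF 1 laplace_lim(1)[OF e]]) (use b in auto)
  then show "extinct_prob e \<le> null_prob e"
    by (intro LIMSEQ_le_const[OF null_prob_limit(1)[OF e]]) auto
qed

lemma extinct_prob_fixed_point:
  assumes e: "environment e"
  shows "extinct_prob e = pgf (e 0) (extinct_prob (shift e))"
proof (rule LIMSEQ_unique)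
  note e' = environment_shift[OF e]
  show "(\<lambda>n. extinct (Suc n) e) \<longlonglongrightarrow> extinct_prob e"
    by (rule LIMSEQ_Suc[OF extinct_prob_limit(1)[OF e]])
  have "extinct n (shift e) \<le> 1" for n
    using laplace_bounds(2,3)[OF e', of 0 n] by linarith
  then show "(\<lambda>n. extinct (Suc n) e) \<longlonglongrightarrow> pgf (e 0) (extinct_prob (shift e))"
    unfolding extinct_Suc[OF e]
    by (intro pgf_tendsto environmentD(1) e laplace_bounds(4)[OF e', of 0] extinct_prob_limit(1)[OF e']) auto
qed

text \<open>Uniform integrability at level \<open>1 / 2\<close> bounds the Laplace transform at
  \<open>1 / K\<close> away from one uniformly in the generation, so the bound survives the
  limit.\<close>

lemma null_prob_less_one:
  assumes e: "environment e" and K: "K > 0"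
    and ui: "\<And>n. (\<integral>\<^sup>+X. ennreal (norm_pop n e X * min 1 (1 / K * norm_pop n e X)) \<partial>tree_law e) \<le> ennreal (1 / 2)"
  shows "null_prob e < 1"
proof -
  obtain k :: nat where k: "1 / K \<le> real k" using real_arch_simple by blast
  have "laplace_lim e (1 / K) \<le> 1 - 1 / (2 * K)"
    using K by (intro LIMSEQ_le_const2[OF laplace_lim(1)[OF e]]) (auto intro!: laplace_less_one[OF e K ui])
  moreover have "null_prob e \<le> laplace_lim e (1 / K)"
    using null_prob_limit(2)[OF e, of k] laplace_lim_antimono[OF e _ k] K by (auto intro: order_trans)
  moreover have "1 / (2 * K) > 0" using K by simp
  ultimately show ?thesis by linarith
qed

text \<open>The chord slope \<open>(1 - f t) / (1 - t)\<close> of the generating function \<open>f\<close> is the mean of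
  \<open>\<Sum>j<N. t ^ j\<close>, which is strictly increasing in \<open>t\<close> unless \<open>N \<le> 1\<close> almost surely.\<close>

lemma pgf_chord_slope:
  assumes e: "environment e" and ab: "0 \<le> a" "a \<le> b" "b < 1"
  shows "(1 - pgf (e k) a) * (1 - b) \<le> (1 - pgf (e k) b) * (1 - a)"
    and "a < b \<Longrightarrow> (1 - pgf (e k) a) * (1 - b) = (1 - pgf (e k) b) * (1 - a) \<Longrightarrow> offspring_mean (e k) \<le> 1"
proof -
  note e1 = environmentD(1)[OF e]
  interpret prob_space "e k" by (rule mark_lawsD[OF e1])
  let ?G = "\<lambda>t p. \<Sum>j<fst p. t ^ j :: real"
  have int: "integrable (e k) (\<lambda>p. ?G t p)" if "0 \<le> t" "t \<le> 1" for t
  proof (rule Bochner_Integration.integrable_bound[OF offspring_integrable(1)[OF e, of k]])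
    show "(\<lambda>p. ?G t p) \<in> borel_measurable (e k)"
      by (subst measurable_cong_sets[OF mark_lawsD(2)[OF e1] refl])
        (rule measurable_compose[OF mark_measurable(1), of "\<lambda>n. \<Sum>j<n. t ^ j"], simp)
    have "\<bar>?G t p\<bar> \<le> (\<Sum>j<fst p. 1)" for p :: mark
      using that by (intro order_trans[OF sum_abs] sum_mono) (auto simp: power_le_one power_abs)
    then show "AE p in e k. norm (?G t p) \<le> norm (real (fst p))" by (intro AE_I2) simp
  qed
  have slope: "1 - pgf (e k) t = (1 - t) * (\<integral>p. ?G t p \<partial>e k)" if "0 \<le> t" "t \<le> 1" for t
  proof -
    have "1 - pgf (e k) t = (\<integral>p. 1 - t ^ fst p \<partial>e k)"
      unfolding pgf_def using that
      by (subst Bochner_Integration.integral_diff) (auto intro!: mark_integrable[OF e1, where B=1] simp: prob_space power_abs power_le_one)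
    also have "\<dots> = (\<integral>p. (1 - t) * ?G t p \<partial>e k)" by (simp add: one_diff_power_eq)
    finally show ?thesis by simp
  qed
  have le: "?G a p \<le> ?G b p" for p :: mark using ab by (intro sum_mono power_mono) auto
  have D: "(1 - pgf (e k) b) * (1 - a) - (1 - pgf (e k) a) * (1 - b) = (1 - a) * (1 - b) * (\<integral>p. ?G b p - ?G a p \<partial>e k)"
  proof -
    have "(\<integral>p. ?G b p - ?G a p \<partial>e k) = (\<integral>p. ?G b p \<partial>e k) - (\<integral>p. ?G a p \<partial>e k)"
      using ab by (intro Bochner_Integration.integral_diff int) auto
    moreover have "1 - pgf (e k) a = (1 - a) * (\<integral>p. ?G a p \<partial>e k)" "1 - pgf (e k) b = (1 - b) * (\<integral>p. ?G b p \<partial>e k)"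
      using ab by (auto intro!: slope)
    ultimately show ?thesis by (simp only:) (simp only: algebra_simps)
  qed
  have "0 \<le> (\<integral>p. ?G b p - ?G a p \<partial>e k)" using le by (intro Bochner_Integration.integral_nonneg) simp
  then have "0 \<le> (1 - a) * (1 - b) * (\<integral>p. ?G b p - ?G a p \<partial>e k)" using ab by (intro mult_nonneg_nonneg) auto
  then show "(1 - pgf (e k) a) * (1 - b) \<le> (1 - pgf (e k) b) * (1 - a)" using D by linarith
  assume "a < b" and "(1 - pgf (e k) a) * (1 - b) = (1 - pgf (e k) b) * (1 - a)"
  then have "(1 - a) * (1 - b) * (\<integral>p. ?G b p - ?G a p \<partial>e k) = 0" using D by linarith
  then have "(\<integral>p. ?G b p - ?G a p \<partial>e k) = 0" using ab by auto
  then have AE0: "AE p in e k. ?G b p - ?G a p = 0"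
    using ab int[of a] int[of b] le by (subst integral_nonneg_eq_0_iff_AE[symmetric]) auto
  have "AE p in e k. real (fst p) \<le> 1"
    using AE0
  proof eventually_elim
    case (elim p)
    show ?case
    proof (rule ccontr)
      assume "\<not> real (fst p) \<le> 1"
      then have "1 < fst p" by simp
      then have "?G a p < ?G b p"
        using ab \<open>a < b\<close> by (intro sum_strict_mono_ex1) (auto intro!: power_mono bexI[of _ 1])
      then show False using elim by simp
    qed
  qed
  then have "(\<integral>p. real (fst p) \<partial>e k) \<le> (\<integral>p. 1 \<partial>e k)"
    by (intro integral_mono_AE offspring_integrable[OF e]) auto
  then show "offspring_mean (e k) \<le> 1"
    by (simp add: offspring_integrable[OF e] prob_space)
qed

text \<open>In terms of the limit of the normalised population, this is the conditional probability
  that the limit is positive given survival.\<close>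

definition survival_ratio :: "(nat \<Rightarrow> mark measure) \<Rightarrow> real" where
  "survival_ratio e = (1 - null_prob e) / (1 - extinct_prob e)"

text \<open>Both probabilities are images, under the same generating function, of those of the
  shifted environment. Cross-multiplication turns the comparison of the ratios into the comparison
  of chord slopes at \<open>?a\<close> and \<open>?b\<close>. If the ratio is less than one, these
  points differ, and equality of slopes then forces the offspring mean to be at most one.\<close>

lemma survival_ratio:
  assumes e: "environment e" and q: "null_prob e < 1" "null_prob (shift e) < 1"
  shows "0 \<le> survival_ratio e" "survival_ratio e \<le> 1" "survival_ratio (shift e) \<le> survival_ratio e"
    "survival_ratio e < 1 \<longleftrightarrow> extinct_prob e < null_prob e"
    "survival_ratio (shift e) = survival_ratio e \<Longrightarrow> survival_ratio e < 1 \<Longrightarrow> offspring_mean (e 0) \<le> 1"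
proof -
  note e' = environment_shift[OF e]
  let ?a = "extinct_prob (shift e)" and ?b = "null_prob (shift e)"
  have ab: "0 \<le> ?a" "?a \<le> ?b" "?b < 1" using extinct_prob_limit[OF e'] q by auto
  have ab': "extinct_prob e < 1" "extinct_prob e \<le> null_prob e" using extinct_prob_limit(4)[OF e] q by auto
  show "0 \<le> survival_ratio e" "survival_ratio e \<le> 1" "survival_ratio e < 1 \<longleftrightarrow> extinct_prob e < null_prob e"
    using ab' q by (auto simp: survival_ratio_def divide_simps)
  have fp: "null_prob e = pgf (e 0) ?b" "extinct_prob e = pgf (e 0) ?a"
    using null_prob_fixed_point[OF e] extinct_prob_fixed_point[OF e] .
  have 1: "survival_ratio (shift e) \<le> survival_ratio e \<longleftrightarrow> (1 - pgf (e 0) ?a) * (1 - ?b) \<le> (1 - pgf (e 0) ?b) * (1 - ?a)"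
    and 2: "survival_ratio (shift e) = survival_ratio e \<longleftrightarrow> (1 - pgf (e 0) ?a) * (1 - ?b) = (1 - pgf (e 0) ?b) * (1 - ?a)"
    using ab ab' fp by (auto simp: survival_ratio_def field_simps)
  show "survival_ratio (shift e) \<le> survival_ratio e"
    using pgf_chord_slope(1)[OF e ab] 1 by simp
  assume eq: "survival_ratio (shift e) = survival_ratio e" and less: "survival_ratio e < 1"
  have "survival_ratio (shift e) < 1" using eq less by simp
  then have "?a < ?b" using ab by (auto simp: survival_ratio_def less_divide_eq divide_less_eq split: if_splits)
  then show "offspring_mean (e 0) \<le> 1"
    using pgf_chord_slope(2)[OF e ab] 2 eq by blast
qed

section \<open>Lindeberg's theorem and the intensity walk\<close>

lemma exp_minus_approx: "\<bar>exp (- y) - (1 - y)\<bar> \<le> y\<^sup>2" if "y \<ge> 0" for y :: real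
proof -
  have "exp (- y) \<le> 1 / (1 + y)"
    using exp_ge_add_one_self[of y] that by (simp add: exp_minus inverse_eq_divide field_simps)
  also have "\<dots> \<le> 1 - y + y\<^sup>2"
    using that by (simp add: field_simps power2_eq_square)
  finally show ?thesis using exp_ge_add_one_self[of "- y"] by (simp add: abs_le_iff)
qed

text \<open>To be read with \<open>a\<close> as the square of \<open>t\<close>, \<open>d\<close> as
  the square of \<delta> and \<open>B\<close> as the total variance. The 9 is a quarter of the 36 in
  the bound for a single variance.\<close>

lemma lindeberg_algebra:
  "a / B / 6 * S + a / B / 2 * (36 / d + S) * (a / 2) = (a / 6 + a * a / 4) * (S / B) + 9 * (a * a) / d * (1 / B)"
  if "B \<noteq> 0" "d \<noteq> 0" for a B S d :: real
  using that by (simp add: field_simps)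

text \<open>The hypothesis on \<open>\<psi>\<close> is
  Lindeberg's condition, in the form in which the third order Taylor estimate provides it.\<close>

theorem lindeberg_char:
  fixes \<mu> :: "nat \<Rightarrow> real measure" and v :: "nat \<Rightarrow> real" and \<psi> :: "nat \<Rightarrow> real" and V t :: real
  assumes dist: "\<And>j. real_distribution (\<mu> j)"
    and mean: "\<And>j. integrable (\<mu> j) (\<lambda>x. x)" "\<And>j. (\<integral>x. x \<partial>\<mu> j) = 0"
    and var: "\<And>j. integrable (\<mu> j) (\<lambda>x. x\<^sup>2)" "\<And>j. (\<integral>x. x\<^sup>2 \<partial>\<mu> j) = v j"
    and V: "(\<lambda>n. (\<Sum>j<n. v j) / n) \<longlonglongrightarrow> V" "V > 0"
    and \<psi>: "\<And>k. (\<lambda>n. (\<Sum>j<n. \<integral>x. min (6 * x\<^sup>2) (1 / Suc k * \<bar>x\<bar> ^ 3) \<partial>\<mu> j) / n) \<longlonglongrightarrow> \<psi> k" "\<psi> \<longlonglongrightarrow> 0"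
  shows "(\<lambda>n. \<Prod>j<n. char (\<mu> j) (t / sqrt (\<Sum>j<n. v j))) \<longlonglongrightarrow> of_real (exp (- t\<^sup>2 / 2))"
proof -
  interpret real_distribution "\<mu> j" for j by (rule dist)
  define B where "B n = (\<Sum>j<n. v j)" for n
  define m where "m \<delta> j = (\<integral>x. min (6 * x\<^sup>2) (\<delta> * \<bar>x\<bar> ^ 3) \<partial>\<mu> j)" for \<delta> j
  have m_int: "integrable (\<mu> j) (\<lambda>x. min (6 * x\<^sup>2) (\<delta> * \<bar>x\<bar> ^ 3))" if "\<delta> \<ge> 0" for \<delta> j
    by (rule Bochner_Integration.integrable_bound[where f="\<lambda>x. 6 * x\<^sup>2"]) (use var that in \<open>auto simp: min_def\<close>)
  have m_mono: "m \<delta> j \<le> m \<delta>' j" if "0 \<le> \<delta>" "\<delta> \<le> \<delta>'" for \<delta> \<delta>' j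
    unfolding m_def using that by (intro integral_mono m_int min.mono mult_right_mono) auto
  have m_nonneg: "0 \<le> m \<delta> j" if "0 \<le> \<delta>" for \<delta> j
    unfolding m_def using that by (intro Bochner_Integration.integral_nonneg) auto
  have v_nonneg: "0 \<le> v j" for j
    unfolding var(2)[symmetric] by (intro Bochner_Integration.integral_nonneg) auto
  \<comment> \<open>The two terms of the minimum cross at
    \<open>\<bar>x\<bar> = 6 / \<delta>\<close>, which is the origin of 36. The estimate makes
    single variances small against their sum without a separate hypothesis.\<close>
  have v_le: "v j \<le> 36 / \<delta>\<^sup>2 + m \<delta> j" if "\<delta> > 0" for \<delta> j
  proof -
    have "v j \<le> (\<integral>x. 36 / \<delta>\<^sup>2 + min (6 * x\<^sup>2) (\<delta> * \<bar>x\<bar> ^ 3) \<partial>\<mu> j)"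
      unfolding var(2)[symmetric]
    proof (rule integral_mono)
      show "integrable (\<mu> j) (\<lambda>x. 36 / \<delta>\<^sup>2 + min (6 * x\<^sup>2) (\<delta> * \<bar>x\<bar> ^ 3))"
        using m_int[of \<delta> j] that by simp
      fix x :: real
      show "x\<^sup>2 \<le> 36 / \<delta>\<^sup>2 + min (6 * x\<^sup>2) (\<delta> * \<bar>x\<bar> ^ 3)"
      proof (cases "\<bar>x\<bar> \<le> 6 / \<delta>")
        case True
        then have "\<bar>x\<bar>\<^sup>2 \<le> (6 / \<delta>)\<^sup>2" by (intro power_mono) auto
        then have "x\<^sup>2 \<le> 36 / \<delta>\<^sup>2" by (simp add: power_divide)
        moreover have "0 \<le> min (6 * x\<^sup>2) (\<delta> * \<bar>x\<bar> ^ 3)" using that by simp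
        ultimately show ?thesis by linarith
      next
        case False
        then have "6 \<le> \<delta> * \<bar>x\<bar>" using that by (simp add: field_simps)
        then have "6 * \<bar>x\<bar>\<^sup>2 \<le> \<delta> * \<bar>x\<bar> * \<bar>x\<bar>\<^sup>2" by (intro mult_right_mono) auto
        then have "min (6 * x\<^sup>2) (\<delta> * \<bar>x\<bar> ^ 3) = 6 * x\<^sup>2" by (simp add: eval_nat_numeral mult.assoc)
        moreover have "0 \<le> 36 / \<delta>\<^sup>2" by simp
        moreover have "0 \<le> x\<^sup>2" by simp
        ultimately show ?thesis by linarith
      qed
    qed (rule var)
    also have "\<dots> = 36 / \<delta>\<^sup>2 + m \<delta> j"
      using m_int[of \<delta> j] that by (simp add: m_def prob_space del: space_eq_univ)
    finally show ?thesis .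
  qed
  have B_ratio: "(\<lambda>n. B n / n) \<longlonglongrightarrow> V" using V by (simp add: B_def)
  have B_pos: "eventually (\<lambda>n. B n > 0) sequentially"
    using order_tendstoD(1)[OF B_ratio V(2)]
    by eventually_elim (auto simp: zero_less_divide_iff)
  have inv_B: "(\<lambda>n. 1 / B n) \<longlonglongrightarrow> 0"
  proof -
    have "(\<lambda>n. (1 / real n) / (B n / real n)) \<longlonglongrightarrow> 0 / V"
      using V(2) by (intro tendsto_divide B_ratio lim_const_over_n) auto
    moreover have "eventually (\<lambda>n. (1 / real n) / (B n / real n) = 1 / B n) sequentially"
      using eventually_gt_at_top[of 0] by eventually_elim auto
    ultimately have "(\<lambda>n. 1 / B n) \<longlonglongrightarrow> 0 / V" by (rule Lim_transform_eventually)
    then show ?thesis by simp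
  qed
  \<comment> \<open>The characteristic functions are compared with \<open>exp (- ?y j)\<close>
    factor by factor, where the product of the exponentials is exactly the Gaussian value. The
    smallness of \<open>u\<close> lets the Taylor remainder at frequency
    \<open>\<bar>u\<bar>\<close> be replaced by the one at \<delta>, for which averages are
    available.\<close>
  have key: "norm ((\<Prod>j<n. char (\<mu> j) (t / sqrt (B n))) - of_real (exp (- t\<^sup>2 / 2)))
      \<le> (t\<^sup>2 / 6 + t\<^sup>2 * t\<^sup>2 / 4) * ((\<Sum>j<n. m \<delta> j) / B n) + 9 * (t\<^sup>2 * t\<^sup>2) / \<delta>\<^sup>2 * (1 / B n)"
    if Bn: "B n > 0" and d: "\<delta> > 0" and u_small: "t\<^sup>2 / B n \<le> \<delta>\<^sup>2" for n \<delta>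
  proof -
    define u where "u = t / sqrt (B n)"
    have u2: "u\<^sup>2 = t\<^sup>2 / B n" using Bn by (simp add: u_def power_divide)
    have "\<bar>u\<bar>\<^sup>2 \<le> \<delta>\<^sup>2" using u_small u2 by simp
    then have u_le: "\<bar>u\<bar> \<le> \<delta>" using d by (metis abs_of_pos abs_le_square_iff abs_abs power2_abs)
    let ?y = "\<lambda>j. u\<^sup>2 * v j / 2"
    let ?S = "\<Sum>j<n. m \<delta> j"
    have S0: "?S \<ge> 0" using m_nonneg d by (intro sum_nonneg) auto
    have y0: "?y j \<ge> 0" for j using v_nonneg[of j] by simp
    have sum_y: "(\<Sum>j<n. ?y j) = t\<^sup>2 / 2"
    proof -
      have "(\<Sum>j<n. ?y j) = u\<^sup>2 * B n / 2" by (simp only: B_def sum_distrib_left sum_divide_distrib)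
      then show ?thesis using Bn by (simp add: u2)
    qed
    have y_le: "?y j \<le> u\<^sup>2 / 2 * (36 / \<delta>\<^sup>2 + ?S)" if "j < n" for j
    proof -
      have "m \<delta> j \<le> ?S" using that m_nonneg d by (intro member_le_sum) auto
      then have "v j \<le> 36 / \<delta>\<^sup>2 + ?S" using v_le[OF d, of j] by simp
      then have "u\<^sup>2 / 2 * v j \<le> u\<^sup>2 / 2 * (36 / \<delta>\<^sup>2 + ?S)" by (intro mult_left_mono) auto
      then show ?thesis by simp
    qed
    have tri: "norm (a - c) \<le> norm (a - b) + norm (c - b)" for a b c :: complex
      using norm_triangle_ineq4[of "a - b" "c - b"] by simp
    have char_bound: "norm (char (\<mu> j) u - of_real (exp (- ?y j))) \<le> u\<^sup>2 / 6 * m \<delta> j + (?y j)\<^sup>2" for j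
    proof -
      have "norm (char (\<mu> j) u - (1 - u\<^sup>2 * v j / 2)) \<le> u\<^sup>2 / 6 * m \<bar>u\<bar> j"
        unfolding m_def by (rule char_approx3) (use mean var in auto)
      also have "\<dots> \<le> u\<^sup>2 / 6 * m \<delta> j" using m_mono[OF _ u_le] by (intro mult_left_mono) auto
      finally have 1: "norm (char (\<mu> j) u - of_real (1 - ?y j)) \<le> u\<^sup>2 / 6 * m \<delta> j" by simp
      have "norm (of_real (exp (- ?y j)) - of_real (1 - ?y j) :: complex) = \<bar>exp (- ?y j) - (1 - ?y j)\<bar>"
        unfolding of_real_diff[symmetric] norm_of_real ..
      then have 2: "norm (of_real (exp (- ?y j)) - of_real (1 - ?y j) :: complex) \<le> (?y j)\<^sup>2"
        using exp_minus_approx[OF y0[of j]] by simp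
      have "norm (char (\<mu> j) u - of_real (exp (- ?y j)))
        \<le> norm (char (\<mu> j) u - of_real (1 - ?y j)) + norm (of_real (exp (- ?y j)) - of_real (1 - ?y j) :: complex)"
        by (rule tri)
      then show ?thesis using 1 2 by linarith
    qed
    have "(\<Prod>j<n. exp (- ?y j)) = exp (\<Sum>j<n. - ?y j)" by (rule exp_sum[symmetric]) simp
    also have "(\<Sum>j<n. - ?y j) = - t\<^sup>2 / 2" using sum_y by (simp only: sum_negf)
    finally have prod_exp: "(\<Prod>j<n. of_real (exp (- ?y j)) :: complex) = of_real (exp (- t\<^sup>2 / 2))"
      by (simp only: of_real_prod[symmetric])
    have "norm ((\<Prod>j<n. char (\<mu> j) u) - (\<Prod>j<n. of_real (exp (- ?y j)))) \<le> (\<Sum>j<n. norm (char (\<mu> j) u - of_real (exp (- ?y j))))"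
    proof (rule norm_prod_diff)
      show "norm (char (\<mu> j) u) \<le> 1" for j by (rule cmod_char_le_1)
      show "norm (of_real (exp (- ?y j)) :: complex) \<le> 1" for j
        unfolding norm_of_real using y0[of j] by simp
    qed
    also have "\<dots> \<le> (\<Sum>j<n. u\<^sup>2 / 6 * m \<delta> j + u\<^sup>2 / 2 * (36 / \<delta>\<^sup>2 + ?S) * ?y j)"
    proof (rule sum_mono)
      \<comment> \<open>The sum of squares is at most a common bound for the \<open>?y j\<close>
        times their sum, which is half the square of \<open>t\<close>.\<close>
      fix j assume j: "j \<in> {..<n}"
      have "(?y j)\<^sup>2 \<le> u\<^sup>2 / 2 * (36 / \<delta>\<^sup>2 + ?S) * ?y j"
        unfolding power2_eq_square[of "?y j"] using y_le[of j] j y0[of j] by (intro mult_right_mono) auto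
      then show "norm (char (\<mu> j) u - of_real (exp (- ?y j))) \<le> u\<^sup>2 / 6 * m \<delta> j + u\<^sup>2 / 2 * (36 / \<delta>\<^sup>2 + ?S) * ?y j"
        using char_bound[of j] by linarith
    qed
    also have "\<dots> = u\<^sup>2 / 6 * ?S + u\<^sup>2 / 2 * (36 / \<delta>\<^sup>2 + ?S) * (\<Sum>j<n. ?y j)"
      by (simp only: sum.distrib sum_distrib_left)
    also have "\<dots> = (t\<^sup>2 / 6 + t\<^sup>2 * t\<^sup>2 / 4) * (?S / B n) + 9 * (t\<^sup>2 * t\<^sup>2) / \<delta>\<^sup>2 * (1 / B n)"
      unfolding sum_y unfolding u2 by (rule lindeberg_algebra) (use Bn d in simp_all)
    finally show ?thesis unfolding prod_exp unfolding u_def .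
  qed
  have "(\<lambda>n. \<Prod>j<n. char (\<mu> j) (t / sqrt (B n))) \<longlonglongrightarrow> of_real (exp (- t\<^sup>2 / 2))"
  proof (rule tendstoI)
    fix \<epsilon> :: real assume "\<epsilon> > 0"
    let ?C = "t\<^sup>2 / 6 + t\<^sup>2 * t\<^sup>2 / 4"
    \<comment> \<open>The level \<open>k\<close> is fixed before \<open>n\<close> grows: at fixed
      \<open>k\<close> the error tends to \<open>?C * (\<psi> k / V)\<close>, which becomes small
      only through the choice of \<open>k\<close>.\<close>
    have "(\<lambda>k. ?C * (\<psi> k / V)) \<longlonglongrightarrow> ?C * (0 / V)"
      using V(2) by (intro tendsto_intros \<psi>(2)) auto
    then have "eventually (\<lambda>k. ?C * (\<psi> k / V) < \<epsilon>) sequentially"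
      using \<open>\<epsilon> > 0\<close> by (intro order_tendstoD) auto
    from eventually_happens'[OF sequentially_bot this]
    obtain k where k: "?C * (\<psi> k / V) < \<epsilon>" by blast
    define \<delta> where "\<delta> = 1 / real (Suc k)"
    have d: "\<delta> > 0" by (simp add: \<delta>_def)
    have "(\<lambda>n. (\<Sum>j<n. m \<delta> j) / real n) \<longlonglongrightarrow> \<psi> k"
      using \<psi>(1)[of k] unfolding m_def \<delta>_def .
    then have "(\<lambda>n. ((\<Sum>j<n. m \<delta> j) / real n) / (B n / real n)) \<longlonglongrightarrow> \<psi> k / V"
      using V(2) by (intro tendsto_divide B_ratio) simp_all
    moreover have "eventually (\<lambda>n. ((\<Sum>j<n. m \<delta> j) / real n) / (B n / real n) = (\<Sum>j<n. m \<delta> j) / B n) sequentially"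
      using eventually_gt_at_top[of 0] by eventually_elim auto
    ultimately have lim: "(\<lambda>n. (\<Sum>j<n. m \<delta> j) / B n) \<longlonglongrightarrow> \<psi> k / V" by (rule Lim_transform_eventually)
    have "(\<lambda>n. ?C * ((\<Sum>j<n. m \<delta> j) / B n) + 9 * (t\<^sup>2 * t\<^sup>2) / \<delta>\<^sup>2 * (1 / B n)) \<longlonglongrightarrow> ?C * (\<psi> k / V) + 9 * (t\<^sup>2 * t\<^sup>2) / \<delta>\<^sup>2 * 0"
      by (intro tendsto_add tendsto_mult tendsto_const inv_B lim)
    then have ev1: "eventually (\<lambda>n. ?C * ((\<Sum>j<n. m \<delta> j) / B n) + 9 * (t\<^sup>2 * t\<^sup>2) / \<delta>\<^sup>2 * (1 / B n) < \<epsilon>) sequentially"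
      by (rule order_tendstoD) (use k in simp)
    have "(\<lambda>n. t\<^sup>2 * (1 / B n)) \<longlonglongrightarrow> t\<^sup>2 * 0" by (intro tendsto_mult tendsto_const inv_B)
    then have ev2: "eventually (\<lambda>n. t\<^sup>2 * (1 / B n) < \<delta>\<^sup>2) sequentially"
      by (rule order_tendstoD) (use d in simp)
    show "eventually (\<lambda>n. dist (\<Prod>j<n. char (\<mu> j) (t / sqrt (B n))) (of_real (exp (- t\<^sup>2 / 2))) < \<epsilon>) sequentially"
      using ev1 ev2 B_pos
    proof eventually_elim
      case (elim n)
      have "dist (\<Prod>j<n. char (\<mu> j) (t / sqrt (B n))) (of_real (exp (- t\<^sup>2 / 2)))
        \<le> ?C * ((\<Sum>j<n. m \<delta> j) / B n) + 9 * (t\<^sup>2 * t\<^sup>2) / \<delta>\<^sup>2 * (1 / B n)"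
        unfolding dist_norm by (rule key) (use elim d in simp_all)
      then show ?case using elim(1) by linarith
    qed
  qed
  then show ?thesis by (simp add: B_def)
qed

section \<open>The central limit theorem for the intensity walk\<close>

lemma char_convolution:
  assumes "real_distribution M" "real_distribution N"
  shows "char (convolution M N) t = char M t * char N t"
proof -
  interpret M: real_distribution M by fact
  interpret N: real_distribution N by fact
  interpret pair_prob_space M N ..
  have m: "(\<lambda>(x, y). x + y) \<in> borel_measurable (M \<Otimes>\<^sub>M N)" by measurable
  have "char (convolution M N) t = (\<integral>z. iexp (t * (case z of (x, y) \<Rightarrow> x + y)) \<partial>(M \<Otimes>\<^sub>M N))"
    unfolding char_def convolution_def by (subst integral_distr[OF m]) auto
  also have "\<dots> = (\<integral>z. (case z of (x, y) \<Rightarrow> iexp (t * x) * iexp (t * y)) \<partial>(M \<Otimes>\<^sub>M N))"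
    by (intro Bochner_Integration.integral_cong) (auto simp: exp_add[symmetric] algebra_simps)
  also have "\<dots> = (\<integral>x. (\<integral>y. iexp (t * x) * iexp (t * y) \<partial>N) \<partial>M)"
  proof -
    have "integrable (M \<Otimes>\<^sub>M N) (\<lambda>z. (case z of (x, y) \<Rightarrow> iexp (t * x) * iexp (t * y)))"
      by (rule P.integrable_const_bound[where B=1]) (auto simp: norm_mult)
    from integral_fst'[OF this] show ?thesis by simp
  qed
  finally show ?thesis by (simp add: char_def)
qed

lemma char_walk_law:
  assumes e: "environment e"
  shows "char (walk_law n e) t = (\<Prod>j<n. char (disp_law (e j)) t)"
  using e
proof (induction n arbitrary: e)
  case 0
  show ?case by (simp add: char_def integral_return)
next
  case (Suc n)
  note e' = environment_shift[OF Suc.prems]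
  have d: "real_distribution (disp_law (e 0))"
    using prob_space_disp_law[OF Suc.prems] by (simp add: real_distribution_def real_distribution_axioms_def)
  have w: "real_distribution (walk_law n (shift e))"
    using prob_space_walk_law[OF e'] by (simp add: real_distribution_def real_distribution_axioms_def)
  have "char (walk_law n (shift e)) t = (\<Prod>j<n. char (disp_law (e (Suc j))) t)"
    by (rule trans[OF Suc.IH[OF e']]) (simp only: shift_def)
  then show ?case
    by (simp add: char_convolution[OF d w] prod.lessThan_Suc_shift del: prod.lessThan_Suc)
qed

definition disp_mean :: "mark measure \<Rightarrow> real" where
  "disp_mean \<kappa> = (\<integral>p. (\<Sum>i<fst p. snd p i) \<partial>\<kappa>) / offspring_mean \<kappa>"

definition disp_var :: "mark measure \<Rightarrow> ennreal" where
  "disp_var \<kappa> = (\<integral>\<^sup>+p. ennreal (\<Sum>i<fst p. (snd p i - disp_mean \<kappa>)\<^sup>2) \<partial>\<kappa>) / (\<integral>\<^sup>+p. of_nat (fst p) \<partial>\<kappa>)"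

definition centered_law :: "mark measure \<Rightarrow> real measure" where
  "centered_law \<kappa> = distr (disp_law \<kappa>) borel (\<lambda>x. x - disp_mean \<kappa>)"

lemma integral_disp_law_nonneg:
  fixes f :: "real \<Rightarrow> real"
  assumes e: "environment e" and f: "integrable (disp_law (e k)) f" "f \<in> borel_measurable borel" "\<And>x. f x \<ge> 0"
  shows "integrable (e k) (\<lambda>p. \<Sum>i<fst p. f (snd p i))"
    "(\<integral>x. f x \<partial>disp_law (e k)) = (\<integral>p. (\<Sum>i<fst p. f (snd p i)) \<partial>e k) / offspring_mean (e k)"
proof -
  have m: "offspring_mean (e k) > 0" by (rule environmentD(2)[OF e])
  have fm: "(\<lambda>p. f (snd p i)) \<in> borel_measurable mark_space" for i
    by (rule measurable_compose[OF mark_measurable(2) f(2)])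
  have meas: "(\<lambda>p. \<Sum>i<fst p. f (snd p i)) \<in> borel_measurable (e k)"
    by (subst measurable_cong_sets[OF mark_lawsD(2)[OF environmentD(1)[OF e]] refl])
      (rule sum_random_length_measurable[OF fm mark_measurable(1)])
  have sum0: "(\<Sum>i<fst p. f (snd p i)) \<ge> 0" for p :: mark using f(3) by (intro sum_nonneg) auto
  have "(\<integral>\<^sup>+x. ennreal (f x) \<partial>disp_law (e k)) = (\<integral>\<^sup>+p. ennreal (1 / offspring_mean (e k)) * ennreal (\<Sum>i<fst p. f (snd p i)) \<partial>e k)"
    using f by (subst nn_integral_disp_law[OF e]) (auto intro!: nn_integral_cong simp: sum_ennreal mult.commute)
  also have "\<dots> = ennreal (1 / offspring_mean (e k)) * (\<integral>\<^sup>+p. ennreal (\<Sum>i<fst p. f (snd p i)) \<partial>e k)"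
    using meas by (intro nn_integral_cmult) auto
  finally have eq: "(\<integral>\<^sup>+x. ennreal (f x) \<partial>disp_law (e k))
    = ennreal (1 / offspring_mean (e k)) * (\<integral>\<^sup>+p. ennreal (\<Sum>i<fst p. f (snd p i)) \<partial>e k)" .
  have "(\<integral>\<^sup>+x. ennreal (f x) \<partial>disp_law (e k)) < \<infinity>"
    using nn_integral_eq_integral[OF f(1)] f(3) by simp
  then have fin: "(\<integral>\<^sup>+p. ennreal (\<Sum>i<fst p. f (snd p i)) \<partial>e k) < \<infinity>"
    unfolding eq using m by (auto simp: ennreal_mult_less_top)
  show int: "integrable (e k) (\<lambda>p. \<Sum>i<fst p. f (snd p i))"
    by (rule integrableI_nonneg[OF meas _ fin]) (use sum0 in auto)
  have "ennreal (\<integral>x. f x \<partial>disp_law (e k)) = ennreal (1 / offspring_mean (e k)) * ennreal (\<integral>p. (\<Sum>i<fst p. f (snd p i)) \<partial>e k)"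
    using eq nn_integral_eq_integral[OF f(1)] nn_integral_eq_integral[OF int] f(3) sum0 by simp
  also have "\<dots> = ennreal ((\<integral>p. (\<Sum>i<fst p. f (snd p i)) \<partial>e k) / offspring_mean (e k))"
    using m sum0 by (subst ennreal_mult[symmetric]) (auto intro!: Bochner_Integration.integral_nonneg)
  finally show "(\<integral>x. f x \<partial>disp_law (e k)) = (\<integral>p. (\<Sum>i<fst p. f (snd p i)) \<partial>e k) / offspring_mean (e k)"
    using m f(3) sum0 by (subst (asm) ennreal_inj) (auto intro!: Bochner_Integration.integral_nonneg divide_nonneg_pos)
qed

lemma integral_disp_law:
  fixes f :: "real \<Rightarrow> real"
  assumes e: "environment e" and f: "integrable (disp_law (e k)) f" "f \<in> borel_measurable borel"
  shows "(\<integral>x. f x \<partial>disp_law (e k)) = (\<integral>p. (\<Sum>i<fst p. f (snd p i)) \<partial>e k) / offspring_mean (e k)"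
proof -
  let ?p = "\<lambda>x. max 0 (f x)" and ?n = "\<lambda>x. max 0 (- f x)"
  have split: "f x = ?p x - ?n x" for x by (simp add: max_def)
  have i: "integrable (disp_law (e k)) ?p" "integrable (disp_law (e k)) ?n" using f by auto
  have m: "?p \<in> borel_measurable borel" "?n \<in> borel_measurable borel" using f(2) by auto
  note P = integral_disp_law_nonneg[OF e i(1) m(1)] and N = integral_disp_law_nonneg[OF e i(2) m(2)]
  have "(\<integral>x. f x \<partial>disp_law (e k)) = (\<integral>x. ?p x \<partial>disp_law (e k)) - (\<integral>x. ?n x \<partial>disp_law (e k))"
    by (subst split, rule Bochner_Integration.integral_diff) (use i in auto)
  also have "\<dots> = ((\<integral>p. (\<Sum>i<fst p. ?p (snd p i)) \<partial>e k) - (\<integral>p. (\<Sum>i<fst p. ?n (snd p i)) \<partial>e k)) / offspring_mean (e k)"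
    using P(2) N(2) by (simp add: diff_divide_distrib)
  also have "(\<integral>p. (\<Sum>i<fst p. ?p (snd p i)) \<partial>e k) - (\<integral>p. (\<Sum>i<fst p. ?n (snd p i)) \<partial>e k)
    = (\<integral>p. (\<Sum>i<fst p. ?p (snd p i)) - (\<Sum>i<fst p. ?n (snd p i)) \<partial>e k)"
    by (rule Bochner_Integration.integral_diff[symmetric]) (use P(1) N(1) in auto)
  also have "\<dots> = (\<integral>p. (\<Sum>i<fst p. f (snd p i)) \<partial>e k)"
    by (simp only: sum_subtractf[symmetric] split[symmetric])
  finally show ?thesis .
qed

text \<open>A Bochner integral defaults to 0, so \<open>disp_mean\<close> is not known in advance to
  be a mean. A finite second moment about this number, whatever it is, forces integrability of the
  displacement, and only then is the number identified as the mean of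
  \<open>disp_law\<close>.\<close>

lemma centered_law:
  assumes e: "environment e" and fin: "disp_var (e k) < \<infinity>"
  shows "real_distribution (centered_law (e k))"
    "integrable (centered_law (e k)) (\<lambda>x. x)" "(\<integral>x. x \<partial>centered_law (e k)) = 0"
    "integrable (centered_law (e k)) (\<lambda>x. x\<^sup>2)" "(\<integral>x. x\<^sup>2 \<partial>centered_law (e k)) = enn2real (disp_var (e k))"
proof -
  let ?\<mu> = "disp_mean (e k)" and ?m = "offspring_mean (e k)"
  have m: "?m > 0" by (rule environmentD(2)[OF e])
  interpret D: prob_space "disp_law (e k)" by (rule prob_space_disp_law[OF e])
  show "real_distribution (centered_law (e k))" unfolding centered_law_def by (rule D.real_distribution_distr) simp
  have fm: "(\<lambda>p. (snd p i - ?\<mu>)\<^sup>2) \<in> borel_measurable mark_space" for i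
    by (intro borel_measurable_power borel_measurable_diff mark_measurable borel_measurable_const)
  have meas: "(\<lambda>p. \<Sum>i<fst p. (snd p i - ?\<mu>)\<^sup>2) \<in> borel_measurable (e k)"
    by (subst measurable_cong_sets[OF mark_lawsD(2)[OF environmentD(1)[OF e]] refl])
      (rule sum_random_length_measurable[OF fm mark_measurable(1)])
  have "(\<integral>\<^sup>+x. ennreal ((x - ?\<mu>)\<^sup>2) \<partial>disp_law (e k)) = (\<integral>\<^sup>+p. ennreal (\<Sum>i<fst p. (snd p i - ?\<mu>)\<^sup>2) * ennreal (1 / ?m) \<partial>e k)"
    by (subst nn_integral_disp_law[OF e]) (auto intro!: nn_integral_cong simp: sum_ennreal)
  also have "\<dots> = (\<integral>\<^sup>+p. ennreal (\<Sum>i<fst p. (snd p i - ?\<mu>)\<^sup>2) \<partial>e k) * ennreal (1 / ?m)"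
    using meas by (intro nn_integral_multc) auto
  also have "\<dots> = disp_var (e k)"
    using m by (simp add: disp_var_def environmentD(3)[OF e] divide_ennreal_def inverse_ennreal inverse_eq_divide)
  finally have sq: "(\<integral>\<^sup>+x. ennreal ((x - ?\<mu>)\<^sup>2) \<partial>disp_law (e k)) = disp_var (e k)" .
  have i2: "integrable (disp_law (e k)) (\<lambda>x. (x - ?\<mu>)\<^sup>2)"
    by (rule integrableI_nonneg) (use sq fin in auto)
  have i1: "integrable (disp_law (e k)) (\<lambda>x. x - ?\<mu>)"
    by (rule D.square_integrable_imp_integrable[OF _ i2]) simp
  have "integrable (disp_law (e k)) (\<lambda>x. (x - ?\<mu>) + ?\<mu>)"
    by (intro Bochner_Integration.integrable_add i1) simp
  then have i: "integrable (disp_law (e k)) (\<lambda>x. x)" by simp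
  have "(\<integral>x. x \<partial>disp_law (e k)) = ?\<mu>"
    using integral_disp_law[OF e i] by (simp add: disp_mean_def)
  then have z: "(\<integral>x. x - ?\<mu> \<partial>disp_law (e k)) = 0"
    using i by (simp add: D.prob_space[simplified])
  show "integrable (centered_law (e k)) (\<lambda>x. x)" "integrable (centered_law (e k)) (\<lambda>x. x\<^sup>2)"
    using i1 i2 by (auto simp: centered_law_def integrable_distr_eq)
  show "(\<integral>x. x \<partial>centered_law (e k)) = 0"
    using z by (simp add: centered_law_def integral_distr)
  have "(\<integral>x. (x - ?\<mu>)\<^sup>2 \<partial>disp_law (e k)) = enn2real (disp_var (e k))"
    using sq by (subst integral_eq_nn_integral) auto
  then show "(\<integral>x. x\<^sup>2 \<partial>centered_law (e k)) = enn2real (disp_var (e k))"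
    by (simp add: centered_law_def integral_distr)
qed

text \<open>Up to the factor \<open>u^2 / 6\<close>, the third order Taylor remainder of the
  characteristic function at a frequency \<open>u\<close> of absolute value
  \<open>1 / Suc k\<close>. Countably many levels allow the ergodic theorem to hold for all of them
  outside one null set.\<close>

definition truncated_third_moment :: "nat \<Rightarrow> mark measure \<Rightarrow> real" where
  "truncated_third_moment k \<kappa> = (\<integral>x. min (6 * x\<^sup>2) (1 / Suc k * \<bar>x\<bar> ^ 3) \<partial>centered_law \<kappa>)"

lemma isCont_cdf_std_normal: "isCont (cdf std_normal_distribution) x"
proof -
  interpret real_distribution std_normal_distribution by (rule real_dist_normal_dist)
  have "emeasure std_normal_distribution {x} = 0"
    by (subst emeasure_density) (auto intro!: nn_integral_null_set[of "{x}" lborel, THEN trans] simp: mult.commute)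
  then show ?thesis by (simp add: isCont_cdf measure_def)
qed

text \<open>The barrier may move as long as its standardised position tends to \<open>x\<close>.
  Monotonicity of the distribution functions compares it with a fixed point \<open>w\<close> near
  \<open>x\<close>, and continuity of the normal distribution function lets \<open>w\<close>
  approach \<open>x\<close>.\<close>

theorem walk_clt:
  assumes e: "environment e" and fin: "\<And>k. disp_var (e k) < \<infinity>"
    and V: "(\<lambda>n. (\<Sum>j<n. enn2real (disp_var (e j))) / n) \<longlonglongrightarrow> V" "V > 0"
    and \<psi>: "\<And>k. (\<lambda>n. (\<Sum>j<n. truncated_third_moment k (e j)) / n) \<longlonglongrightarrow> \<psi> k" "\<psi> \<longlonglongrightarrow> 0"
    and y: "(\<lambda>n. (y n - (\<Sum>j<n. disp_mean (e j))) / sqrt (\<Sum>j<n. enn2real (disp_var (e j)))) \<longlonglongrightarrow> x"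
  shows "(\<lambda>n. measure (walk_law n e) {..y n}) \<longlonglongrightarrow> cdf std_normal_distribution x"
proof -
  let ?a = "\<lambda>n. \<Sum>j<n. disp_mean (e j)" and ?s = "\<lambda>n. sqrt (\<Sum>j<n. enn2real (disp_var (e j)))"
  note cl = centered_law[OF e fin]
  have W: "real_distribution (walk_law n e)" for n
    using prob_space_walk_law[OF e] by (simp add: real_distribution_def real_distribution_axioms_def)
  define D where "D n = distr (walk_law n e) borel (\<lambda>x. (x - ?a n) / ?s n)" for n
  have D: "real_distribution (D n)" for n
    unfolding D_def using W[of n] by (intro prob_space.real_distribution_distr) (auto simp: real_distribution_def)
  have char_D: "char (D n) t = (\<Prod>j<n. char (centered_law (e j)) (t / ?s n))" for n t
  proof -
    have "char (D n) t = (\<integral>x. iexp (t * ((x - ?a n) / ?s n)) \<partial>walk_law n e)"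
      unfolding D_def char_def by (subst integral_distr) auto
    also have "\<dots> = (\<integral>x. iexp (- (t / ?s n) * ?a n) * iexp ((t / ?s n) * x) \<partial>walk_law n e)"
      by (intro Bochner_Integration.integral_cong refl)
        (simp add: exp_add[symmetric] diff_divide_distrib algebra_simps)
    also have "\<dots> = iexp (- (t / ?s n) * ?a n) * char (walk_law n e) (t / ?s n)"
      unfolding char_def by (subst integral_mult_right_zero) simp
    also have "\<dots> = (\<Prod>j<n. iexp (- (t / ?s n) * disp_mean (e j)) * char (disp_law (e j)) (t / ?s n))"
      unfolding char_walk_law[OF e] prod.distrib
      by (simp add: exp_sum[symmetric] sum_distrib_left)
    also have "\<dots> = (\<Prod>j<n. char (centered_law (e j)) (t / ?s n))"
    proof (intro prod.cong refl)
      fix j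
      have "char (centered_law (e j)) (t / ?s n) = (\<integral>x. iexp (t / ?s n * (x - disp_mean (e j))) \<partial>disp_law (e j))"
        unfolding centered_law_def char_def by (subst integral_distr) auto
      also have "\<dots> = (\<integral>x. iexp (- (t / ?s n) * disp_mean (e j)) * iexp (t / ?s n * x) \<partial>disp_law (e j))"
        by (intro Bochner_Integration.integral_cong refl)
          (simp add: exp_add[symmetric] diff_divide_distrib algebra_simps)
      also have "\<dots> = iexp (- (t / ?s n) * disp_mean (e j)) * char (disp_law (e j)) (t / ?s n)"
        unfolding char_def by (subst integral_mult_right_zero) simp
      finally show "iexp (- (t / ?s n) * disp_mean (e j)) * char (disp_law (e j)) (t / ?s n) = char (centered_law (e j)) (t / ?s n)" ..
    qed
    finally show ?thesis .
  qed
  have "weak_conv_m D std_normal_distribution"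
  proof (rule levy_continuity[OF D real_dist_normal_dist])
    fix t
    show "(\<lambda>n. char (D n) t) \<longlonglongrightarrow> char std_normal_distribution t"
      unfolding char_D using lindeberg_char[of "\<lambda>j. centered_law (e j)", OF cl(1-5) V \<psi>(1)[unfolded truncated_third_moment_def] \<psi>(2)]
      by (simp add: char_std_normal_distribution)
  qed
  then have conv: "(\<lambda>n. cdf (D n) z) \<longlonglongrightarrow> cdf std_normal_distribution z" for z
    by (simp add: weak_conv_m_def weak_conv_def isCont_cdf_std_normal)
  let ?z = "\<lambda>n. (y n - ?a n) / ?s n"
  have "(\<lambda>n. (\<Sum>j<n. enn2real (disp_var (e j))) / n) \<longlonglongrightarrow> V" by (rule V)
  from order_tendstoD(1)[OF this V(2)]
  have s_pos: "eventually (\<lambda>n. ?s n > 0) sequentially"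
    by eventually_elim (auto simp: zero_less_divide_iff)
  have eq: "eventually (\<lambda>n. measure (walk_law n e) {..y n} = cdf (D n) (?z n)) sequentially"
    using s_pos
  proof eventually_elim
    case (elim n)
    have "cdf (D n) (?z n) = measure (walk_law n e) ((\<lambda>x. (x - ?a n) / ?s n) -` {..?z n} \<inter> space (walk_law n e))"
      unfolding D_def cdf_def by (subst measure_distr) auto
    also have "(\<lambda>x. (x - ?a n) / ?s n) -` {..?z n} \<inter> space (walk_law n e) = {..y n}"
      using elim by (auto simp: divide_le_cancel)
    finally show ?case ..
  qed
  have mono: "cdf (D n) a \<le> cdf (D n) b" if "a \<le> b" for n a b
  proof -
    interpret real_distribution "D n" by (rule D)
    show ?thesis using that by (rule cdf_nondecreasing)
  qed
  have lim: "(\<lambda>n. cdf (D n) (?z n)) \<longlonglongrightarrow> cdf std_normal_distribution x"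
  proof (rule order_tendstoI)
    fix c assume c: "c < cdf std_normal_distribution x"
    have "((cdf std_normal_distribution) \<longlongrightarrow> cdf std_normal_distribution x) (at_left x)"
      using isCont_cdf_std_normal[of x] by (simp add: isCont_def filterlim_at_split)
    from order_tendstoD(1)[OF this c] have "eventually (\<lambda>w. c < cdf std_normal_distribution w \<and> w < x) (at_left x)"
      by (simp add: eventually_at_filter)
    then obtain w where w: "c < cdf std_normal_distribution w" "w < x"
      by (auto dest!: eventually_happens simp: trivial_limit_at_left_real)
    show "eventually (\<lambda>n. c < cdf (D n) (?z n)) sequentially"
      using order_tendstoD(1)[OF y w(2)] order_tendstoD(1)[OF conv w(1)]
    proof eventually_elim
      case (elim n)
      then show ?case using mono[of w "?z n" n] by linarith
    qed
  next
    fix c assume c: "cdf std_normal_distribution x < c"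
    have "((cdf std_normal_distribution) \<longlongrightarrow> cdf std_normal_distribution x) (at_right x)"
      using isCont_cdf_std_normal[of x] by (simp add: isCont_def filterlim_at_split)
    from order_tendstoD(2)[OF this c] have "eventually (\<lambda>w. cdf std_normal_distribution w < c \<and> x < w) (at_right x)"
      using eventually_at_right_less[of x] by eventually_elim auto
    then obtain w where w: "cdf std_normal_distribution w < c" "x < w"
      by (auto dest!: eventually_happens simp: trivial_limit_at_right_real)
    show "eventually (\<lambda>n. cdf (D n) (?z n) < c) sequentially"
      using order_tendstoD(2)[OF y w(2)] order_tendstoD(2)[OF conv w(1)]
    proof eventually_elim
      case (elim n)
      then show ?case using mono[of "?z n" w n] by linarith
    qed
  qed
  show ?thesis using lim eq by (simp add: tendsto_cong)
qed

section \<open>Stationary ergodic environments\<close>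

text \<open>The integrand equals the population where it exceeds \<open>Suc K\<close>, so it
  controls the tail mass uniformly in the generation. This form is the one that satisfies the
  size-biased recursion.\<close>

definition unif_int :: "nat \<Rightarrow> nat \<Rightarrow> (nat \<Rightarrow> mark measure) \<Rightarrow> bool" where
  "unif_int j K e \<longleftrightarrow> (\<forall>n. (\<integral>\<^sup>+X. ennreal (norm_pop n e X * min 1 (1 / Suc K * norm_pop n e X)) \<partial>tree_law e) \<le> ennreal (1 / Suc j))"

lemma size_biased_tail_mono:
  assumes "c \<le> c'"
  shows "size_biased_tail \<kappa> c \<le> size_biased_tail \<kappa> c'"
  unfolding size_biased_tail_def using assms
  by (intro nn_integral_mono ennreal_leI mult_left_mono min.mono mult_right_mono) (auto simp: offspring_mean_nonneg)

section \<open>Measurability of the quenched moments as functions of the environment\<close>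

locale mark_kernel =
  fixes \<nu> :: "(nat \<Rightarrow> 't) measure" and \<Theta> :: "'t measure" and \<eta> :: "'t \<Rightarrow> mark measure"
  assumes sets_\<nu> [measurable_cong]: "sets \<nu> = sets (\<Pi>\<^sub>M n\<in>UNIV. \<Theta>)"
    and kernel: "\<eta> \<in> \<Theta> \<rightarrow>\<^sub>M prob_algebra mark_space"
begin

definition env :: "(nat \<Rightarrow> 't) \<Rightarrow> nat \<Rightarrow> mark measure" where
  "env s n = \<eta> (s n)"

lemma funpow_shift: "(shift ^^ k) s n = s (k + n)"
  by (induction k arbitrary: s) (simp_all add: funpow_swap1, simp add: shift_def)

lemma env_shift: "shift (env s) = env (shift s)"
  by (simp add: env_def shift_def fun_eq_iff)

lemma env_funpow_shift: "(shift ^^ k) (env s) = env ((shift ^^ k) s)"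
  by (simp add: env_def fun_eq_iff) (metis env_def funpow_shift add.commute)

lemma space_\<nu>: "space \<nu> = UNIV \<rightarrow>\<^sub>E space \<Theta>"
  using sets_eq_imp_space_eq[OF sets_\<nu>] by (simp add: space_PiM)

lemma in_space: "s \<in> space \<nu> \<Longrightarrow> s n \<in> space \<Theta>"
  by (auto simp: space_\<nu>)

lemma mark_laws_env: "s \<in> space \<nu> \<Longrightarrow> mark_laws (env s)"
  unfolding mark_laws_def env_def by (auto intro!: measurable_space[OF kernel] in_space)

lemma coordinate_measurable [measurable]: "(\<lambda>s. s n) \<in> \<nu> \<rightarrow>\<^sub>M \<Theta>"
  by measurable

lemma kernel_subprob: "\<eta> \<in> \<Theta> \<rightarrow>\<^sub>M subprob_algebra mark_space"
  by (rule measurable_prob_algebraD[OF kernel])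

lemma kernel_nn_integral_measurable:
  assumes "(\<lambda>(t, p). f t p) \<in> borel_measurable (\<Theta> \<Otimes>\<^sub>M mark_space)"
  shows "(\<lambda>t. \<integral>\<^sup>+p. f t p \<partial>\<eta> t) \<in> borel_measurable \<Theta>"
  by (rule nn_integral_measurable_subprob_algebra2[OF assms kernel_subprob])

lemma offspring_pair_measurable: "(\<lambda>x. fst (snd x)) \<in> \<Theta> \<Otimes>\<^sub>M mark_space \<rightarrow>\<^sub>M count_space UNIV"
  by (rule measurable_compose[OF measurable_snd mark_measurable(1)])

lemma offspring_total_measurable: "(\<lambda>t. \<integral>\<^sup>+p. of_nat (fst p) \<partial>\<eta> t) \<in> borel_measurable \<Theta>"
  by (rule kernel_nn_integral_measurable, unfold case_prod_beta')
    (rule measurable_compose[OF offspring_pair_measurable], simp)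

lemma offspring_mean_measurable [measurable]: "(\<lambda>t. offspring_mean (\<eta> t)) \<in> borel_measurable \<Theta>"
  unfolding offspring_mean_def using offspring_total_measurable by measurable

lemma disp_mean_measurable [measurable]: "(\<lambda>t. disp_mean (\<eta> t)) \<in> borel_measurable \<Theta>"
proof -
  have "(\<lambda>p. \<Sum>i<fst p. snd p i) \<in> borel_measurable mark_space"
    by (rule sum_random_length_measurable[OF mark_measurable(2,1)])
  from measurable_compose[OF kernel_subprob integral_measurable_subprob_algebra[OF this]]
  show ?thesis unfolding disp_mean_def using offspring_mean_measurable by measurable
qed

lemma centered_sum_measurable:
  fixes f :: "real \<Rightarrow> real"
  assumes f: "f \<in> borel_measurable borel"
  shows "(\<lambda>(t, p). ennreal (\<Sum>i<fst p. f (snd p i - disp_mean (\<eta> t)))) \<in> borel_measurable (\<Theta> \<Otimes>\<^sub>M mark_space)"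
proof -
  have "(\<lambda>x. snd (snd x) i - disp_mean (\<eta> (fst x))) \<in> borel_measurable (\<Theta> \<Otimes>\<^sub>M mark_space)" for i
    using measurable_compose[OF measurable_snd mark_measurable(2)] measurable_compose[OF measurable_fst disp_mean_measurable]
    by (intro borel_measurable_diff)
  from measurable_compose[OF this f]
  have "(\<lambda>x. \<Sum>i<fst (snd x). f (snd (snd x) i - disp_mean (\<eta> (fst x)))) \<in> borel_measurable (\<Theta> \<Otimes>\<^sub>M mark_space)"
    by (rule sum_random_length_measurable[OF _ offspring_pair_measurable])
  then show ?thesis unfolding case_prod_beta' by (rule measurable_compose[OF _ measurable_ennreal])
qed

lemma disp_var_measurable [measurable]: "(\<lambda>t. disp_var (\<eta> t)) \<in> borel_measurable \<Theta>"
proof -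
  have "(\<lambda>t. \<integral>\<^sup>+p. ennreal (\<Sum>i<fst p. (snd p i - disp_mean (\<eta> t))\<^sup>2) \<partial>\<eta> t) \<in> borel_measurable \<Theta>"
    by (rule kernel_nn_integral_measurable[OF centered_sum_measurable]) simp
  then show ?thesis
    unfolding disp_var_def using offspring_total_measurable by (rule borel_measurable_divide_ennreal)
qed

lemma size_biased_tail_measurable [measurable]: "(\<lambda>t. size_biased_tail (\<eta> t) c) \<in> borel_measurable \<Theta>"
proof -
  have "(\<lambda>x. real (fst (snd x)) / offspring_mean (\<eta> (fst x)) * min 1 (c * real (fst (snd x)))) \<in> borel_measurable (\<Theta> \<Otimes>\<^sub>M mark_space)"
    using measurable_compose[OF offspring_pair_measurable, of real borel]
      measurable_compose[OF measurable_fst offspring_mean_measurable]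
    by (intro borel_measurable_times borel_measurable_divide borel_measurable_min borel_measurable_const) auto
  then show ?thesis
    unfolding size_biased_tail_def
    by (intro kernel_nn_integral_measurable) (simp add: case_prod_beta')
qed

end

locale random_environment = ergodic_system \<nu> shift + mark_kernel \<nu> \<Theta> \<eta>
  for \<nu> :: "(nat \<Rightarrow> 't) measure" and \<Theta> :: "'t measure" and \<eta> :: "'t \<Rightarrow> mark measure" +
  assumes mean_finite: "AE s in \<nu>. 0 < (\<integral>\<^sup>+p. of_nat (fst p) \<partial>\<eta> (s 0)) \<and> (\<integral>\<^sup>+p. of_nat (fst p) \<partial>\<eta> (s 0)) < \<infinity>"
    and ln_mean: "integrable \<nu> (\<lambda>s. ln (offspring_mean (\<eta> (s 0))))" "0 < (\<integral>s. ln (offspring_mean (\<eta> (s 0))) \<partial>\<nu>)"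
    and N_log_N: "(\<integral>\<^sup>+s. \<integral>\<^sup>+p. ennreal (real (fst p) / offspring_mean (\<eta> (s 0)) * log_plus (real (fst p))) \<partial>\<eta> (s 0) \<partial>\<nu>) < \<infinity>"
    and mean_var: "0 < (\<integral>\<^sup>+s. disp_var (\<eta> (s 0)) \<partial>\<nu>)" "(\<integral>\<^sup>+s. disp_var (\<eta> (s 0)) \<partial>\<nu>) < \<infinity>"
begin

section \<open>Almost sure averages along the environment\<close>

lemma AE_environment: "AE s in \<nu>. environment (env s)"
  using AE_funpow[OF mean_finite] AE_space
proof eventually_elim
  case (elim s)
  then show ?case
    using mark_laws_env[of s] by (simp add: environment_def env_def funpow_shift)
qed

lemma AE_disp_var_finite: "AE s in \<nu>. \<forall>n. disp_var (env s n) < \<infinity>"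
proof -
  have "(\<lambda>s. disp_var (\<eta> (s 0))) \<in> borel_measurable \<nu>" by measurable
  then have "AE s in \<nu>. disp_var (\<eta> (s 0)) \<noteq> \<infinity>"
    using mean_var(2) by (intro nn_integral_noteq_infinite) auto
  from AE_funpow[OF this] show ?thesis
    by eventually_elim (simp add: funpow_shift env_def less_top)
qed

lemma birkhoff_env:
  assumes "integrable \<nu> (\<lambda>s. f (\<eta> (s 0)))"
  shows "AE s in \<nu>. (\<lambda>n. (\<Sum>j<n. f (env s j)) / n) \<longlonglongrightarrow> (\<integral>s. f (\<eta> (s 0)) \<partial>\<nu>)"
  using birkhoff[OF assms] by (simp add: birkhoff_sum_def funpow_shift env_def)

definition mean_variance :: real where
  "mean_variance = (\<integral>s. enn2real (disp_var (\<eta> (s 0))) \<partial>\<nu>)"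

lemma disp_var_integrable: "integrable \<nu> (\<lambda>s. enn2real (disp_var (\<eta> (s 0))))"
  and mean_variance_pos: "mean_variance > 0"
proof -
  have "(\<lambda>s. disp_var (\<eta> (s 0))) \<in> borel_measurable \<nu>" by measurable
  then have neq: "AE s in \<nu>. disp_var (\<eta> (s 0)) \<noteq> \<infinity>"
    using mean_var(2) by (intro nn_integral_noteq_infinite) auto
  have eq: "(\<integral>\<^sup>+s. ennreal (enn2real (disp_var (\<eta> (s 0)))) \<partial>\<nu>) = (\<integral>\<^sup>+s. disp_var (\<eta> (s 0)) \<partial>\<nu>)"
    using neq by (intro nn_integral_cong_AE) (auto simp: less_top elim!: eventually_mono)
  show int: "integrable \<nu> (\<lambda>s. enn2real (disp_var (\<eta> (s 0))))"
    using eq mean_var(2) by (intro integrableI_nonneg) auto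
  have "ennreal mean_variance = (\<integral>\<^sup>+s. disp_var (\<eta> (s 0)) \<partial>\<nu>)"
    using nn_integral_eq_integral[OF int] eq by (simp add: mean_variance_def)
  then show "mean_variance > 0" using mean_var(1) by (metis ennreal_less_zero_iff)
qed

text \<open>The left side integrates against a law that itself varies with the environment. The
  right side is a kernel integral, whose measurability in the environment is available.\<close>

lemma truncated_third_moment_eq:
  assumes s: "environment (env s)" "disp_var (env s j) < \<infinity>"
  shows "truncated_third_moment k (env s j) = enn2real ((\<integral>\<^sup>+p. ennreal (\<Sum>i<fst p. (\<lambda>x. min (6 * x\<^sup>2) (1 / Suc k * \<bar>x\<bar> ^ 3)) (snd p i - disp_mean (env s j))) \<partial>env s j)
    * ennreal (1 / offspring_mean (env s j)))"
proof -
  let ?f = "\<lambda>x :: real. min (6 * x\<^sup>2) (1 / Suc k * \<bar>x\<bar> ^ 3)" and ?\<mu> = "disp_mean (env s j)"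
  have f0: "?f x \<ge> 0" for x by simp
  have fm: "(\<lambda>x. ?f (x - ?\<mu>)) \<in> borel_measurable borel" by measurable
  have fmi: "(\<lambda>p. ?f (snd p i - ?\<mu>)) \<in> borel_measurable mark_space" for i
    by (rule measurable_compose[OF mark_measurable(2) fm])
  have meas: "(\<lambda>p. \<Sum>i<fst p. ?f (snd p i - ?\<mu>)) \<in> borel_measurable (env s j)"
    by (subst measurable_cong_sets[OF mark_lawsD(2)[OF environmentD(1)[OF s(1)]] refl])
      (rule sum_random_length_measurable[OF fmi mark_measurable(1)])
  have "truncated_third_moment k (env s j) = (\<integral>x. ?f (x - ?\<mu>) \<partial>disp_law (env s j))"
    unfolding truncated_third_moment_def centered_law_def by (subst integral_distr) auto
  also have "\<dots> = enn2real (\<integral>\<^sup>+x. ennreal (?f (x - ?\<mu>)) \<partial>disp_law (env s j))"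
    using fm by (intro integral_eq_nn_integral) auto
  also have "(\<integral>\<^sup>+x. ennreal (?f (x - ?\<mu>)) \<partial>disp_law (env s j))
    = (\<integral>\<^sup>+p. ennreal (\<Sum>i<fst p. ?f (snd p i - ?\<mu>)) * ennreal (1 / offspring_mean (env s j)) \<partial>env s j)"
    using fm by (subst nn_integral_disp_law[OF s(1)]) (auto intro!: nn_integral_cong simp: sum_ennreal)
  also have "\<dots> = (\<integral>\<^sup>+p. ennreal (\<Sum>i<fst p. ?f (snd p i - ?\<mu>)) \<partial>env s j) * ennreal (1 / offspring_mean (env s j))"
    using meas by (intro nn_integral_multc) auto
  finally show ?thesis .
qed

text \<open>The limit \<open>\<psi> k\<close> is the mean of the functional over the environment. It
  tends to 0 by dominated convergence applied twice: within one environment with dominating function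
  \<open>6 * x^2\<close>, then over environments with six times the variance.\<close>

lemma AE_truncated_third_moment:
  "\<exists>\<psi>. (AE s in \<nu>. \<forall>k. (\<lambda>n. (\<Sum>j<n. truncated_third_moment k (env s j)) / n) \<longlonglongrightarrow> \<psi> k) \<and> \<psi> \<longlonglongrightarrow> (0 :: real)"
proof -
  define f where "f k \<kappa> = enn2real ((\<integral>\<^sup>+p. ennreal (\<Sum>i<fst p. (\<lambda>x. min (6 * x\<^sup>2) (1 / Suc k * \<bar>x\<bar> ^ 3)) (snd p i - disp_mean \<kappa>)) \<partial>\<kappa>)
    * ennreal (1 / offspring_mean \<kappa>))" for k \<kappa>
  have meas: "(\<lambda>s. f k (\<eta> (s 0))) \<in> borel_measurable \<nu>" for k
  proof -
    have "(\<lambda>t. \<integral>\<^sup>+p. ennreal (\<Sum>i<fst p. (\<lambda>x. min (6 * x\<^sup>2) (1 / Suc k * \<bar>x\<bar> ^ 3)) (snd p i - disp_mean (\<eta> t))) \<partial>\<eta> t) \<in> borel_measurable \<Theta>"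
      by (rule kernel_nn_integral_measurable[OF centered_sum_measurable]) simp
    moreover have "(\<lambda>t. ennreal (1 / offspring_mean (\<eta> t))) \<in> borel_measurable \<Theta>" by measurable
    ultimately have "(\<lambda>t. f k (\<eta> t)) \<in> borel_measurable \<Theta>"
      unfolding f_def by (intro borel_measurable_enn2real borel_measurable_times_ennreal)
    from measurable_compose[OF coordinate_measurable this] show ?thesis .
  qed
  have eq: "AE s in \<nu>. environment (env s) \<and> disp_var (env s 0) < \<infinity> \<and> (\<forall>k. f k (\<eta> (s 0)) = truncated_third_moment k (\<eta> (s 0)))"
    using AE_environment AE_disp_var_finite
  proof eventually_elim
    case (elim s)
    have "truncated_third_moment k (env s 0) = f k (env s 0)" for k
      unfolding f_def by (rule truncated_third_moment_eq[OF elim(1) elim(2)[rule_format]])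
    then show ?case using elim by (auto simp: env_def)
  qed
  have bound: "AE s in \<nu>. \<forall>k. norm (f k (\<eta> (s 0))) \<le> 6 * enn2real (disp_var (\<eta> (s 0))) \<and> (\<lambda>k. f k (\<eta> (s 0))) \<longlonglongrightarrow> 0"
    using eq
  proof eventually_elim
    case (elim s)
    then have e: "environment (env s)" "disp_var (env s 0) < \<infinity>" by auto
    note cl = centered_law[OF e]
    interpret D: real_distribution "centered_law (env s 0)" by (rule cl)
    have t: "f k (\<eta> (s 0)) = (\<integral>x. min (6 * x\<^sup>2) (1 / Suc k * \<bar>x\<bar> ^ 3) \<partial>centered_law (env s 0))" for k
      using elim by (simp add: truncated_third_moment_def env_def)
    have nb: "norm (min (6 * x\<^sup>2) (1 / Suc k * \<bar>x\<bar> ^ 3)) \<le> 6 * x\<^sup>2" for k and x :: real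
    proof -
      have "0 \<le> min (6 * x\<^sup>2) (1 / Suc k * \<bar>x\<bar> ^ 3)" by (rule min.boundedI) auto
      then show ?thesis by (simp only: real_norm_def abs_of_nonneg min.cobounded1)
    qed
    have b: "norm (f k (\<eta> (s 0))) \<le> 6 * enn2real (disp_var (\<eta> (s 0)))" for k
    proof -
      have i: "integrable (centered_law (env s 0)) (\<lambda>x. min (6 * x\<^sup>2) (1 / Suc k * \<bar>x\<bar> ^ 3))"
        proof (rule Bochner_Integration.integrable_bound[where f="\<lambda>x. 6 * x\<^sup>2"])
        show "AE x in centered_law (env s 0). norm (min (6 * x\<^sup>2) (1 / Suc k * \<bar>x\<bar> ^ 3)) \<le> norm (6 * x\<^sup>2)"
          using nb by (intro AE_I2 order_trans[OF nb]) simp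
        show "integrable (centered_law (env s 0)) (\<lambda>x. 6 * x\<^sup>2)" using cl(4) by simp
      qed measurable
      have "(\<integral>x. min (6 * x\<^sup>2) (1 / Suc k * \<bar>x\<bar> ^ 3) \<partial>centered_law (env s 0)) \<le> (\<integral>x. 6 * x\<^sup>2 \<partial>centered_law (env s 0))"
        using cl i by (intro integral_mono) auto
      moreover have "0 \<le> (\<integral>x. min (6 * x\<^sup>2) (1 / Suc k * \<bar>x\<bar> ^ 3) \<partial>centered_law (env s 0))"
        by (intro Bochner_Integration.integral_nonneg) auto
      ultimately show ?thesis unfolding t using cl(5) by (simp add: env_def)
    qed
    have "(\<lambda>k. \<integral>x. min (6 * x\<^sup>2) (1 / Suc k * \<bar>x\<bar> ^ 3) \<partial>centered_law (env s 0)) \<longlonglongrightarrow> (\<integral>x. 0 \<partial>centered_law (env s 0))"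
    proof (rule integral_dominated_convergence)
      show "integrable (centered_law (env s 0)) (\<lambda>x. 6 * x\<^sup>2)" using cl by simp
      show "AE x in centered_law (env s 0). (\<lambda>k. min (6 * x\<^sup>2) (1 / Suc k * \<bar>x\<bar> ^ 3)) \<longlonglongrightarrow> 0"
      proof (rule AE_I2)
        fix x :: real
        have "(\<lambda>k. 1 / real (Suc k) * \<bar>x\<bar> ^ 3) \<longlonglongrightarrow> 0 * \<bar>x\<bar> ^ 3"
          by (intro tendsto_mult tendsto_const) (rule LIMSEQ_Suc[OF lim_1_over_n])
        then have "(\<lambda>k. min (6 * x\<^sup>2) (1 / real (Suc k) * \<bar>x\<bar> ^ 3)) \<longlonglongrightarrow> min (6 * x\<^sup>2) (0 * \<bar>x\<bar> ^ 3)"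
          by (intro tendsto_min tendsto_const)
        moreover have "min (6 * x\<^sup>2) (0 * \<bar>x\<bar> ^ 3) = 0" by simp
        ultimately show "(\<lambda>k. min (6 * x\<^sup>2) (1 / real (Suc k) * \<bar>x\<bar> ^ 3)) \<longlonglongrightarrow> 0" by (simp only:)
      qed
      show "AE x in centered_law (env s 0). norm (min (6 * x\<^sup>2) (1 / Suc k * \<bar>x\<bar> ^ 3)) \<le> 6 * x\<^sup>2" for k
        by (intro AE_I2 nb)
    qed measurable
    then show ?case using b by (simp only: t integral_zero) simp
  qed
  have int: "integrable \<nu> (\<lambda>s. f k (\<eta> (s 0)))" for k
  proof (rule Bochner_Integration.integrable_bound)
    show "integrable \<nu> (\<lambda>s. 6 * enn2real (disp_var (\<eta> (s 0))))" using disp_var_integrable by simp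
    show "AE s in \<nu>. norm (f k (\<eta> (s 0))) \<le> norm (6 * enn2real (disp_var (\<eta> (s 0))))"
      using bound by eventually_elim (simp add: abs_mult)
  qed (rule meas)
  define \<psi> where "\<psi> k = (\<integral>s. f k (\<eta> (s 0)) \<partial>\<nu>)" for k
  have "\<psi> \<longlonglongrightarrow> (\<integral>s. 0 \<partial>\<nu>)"
    unfolding \<psi>_def
  proof (rule integral_dominated_convergence)
    show "integrable \<nu> (\<lambda>s. 6 * enn2real (disp_var (\<eta> (s 0))))" using disp_var_integrable by simp
    show "AE s in \<nu>. (\<lambda>k. f k (\<eta> (s 0))) \<longlonglongrightarrow> 0" using bound by eventually_elim simp
    show "AE s in \<nu>. norm (f k (\<eta> (s 0))) \<le> 6 * enn2real (disp_var (\<eta> (s 0)))" for k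
      using bound by eventually_elim simp
  qed (use meas in auto)
  moreover have "AE s in \<nu>. \<forall>k. (\<lambda>n. (\<Sum>j<n. truncated_third_moment k (env s j)) / n) \<longlonglongrightarrow> \<psi> k"
  proof -
    have "AE s in \<nu>. \<forall>k. (\<lambda>n. (\<Sum>j<n. f k (env s j)) / n) \<longlonglongrightarrow> \<psi> k"
      unfolding \<psi>_def by (subst AE_all_countable) (intro allI birkhoff_env int)
    moreover have "AE s in \<nu>. \<forall>j. \<forall>k. f k (\<eta> (s j)) = truncated_third_moment k (\<eta> (s j))"
      using AE_funpow[OF eq] by eventually_elim (simp add: funpow_shift)
    ultimately show ?thesis by eventually_elim (simp add: env_def)
  qed
  ultimately show ?thesis by (intro exI[of _ \<psi>]) auto
qed

section \<open>Growth of the mean population and uniform integrability\<close>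

definition rate :: real where
  "rate = (\<integral>s. ln (offspring_mean (\<eta> (s 0))) \<partial>\<nu>) / 2"

lemma rate_pos: "rate > 0"
  using ln_mean(2) by (simp add: rate_def)

lemma AE_prod_mean_growth: "AE s in \<nu>. \<exists>C>0. \<forall>n. prod_mean (env s) n \<ge> C * exp (rate * n)"
  using birkhoff_env[OF ln_mean(1)] AE_environment
proof eventually_elim
  case (elim s)
  note e = elim(2)
  \<comment> \<open>Taking half of the mean of \<open>ln m\<close> leaves room for the averages to
    exceed \<open>rate\<close> from some index on.\<close>
  have "rate < (\<integral>s. ln (offspring_mean (\<eta> (s 0))) \<partial>\<nu>)" using ln_mean(2) by (simp add: rate_def)
  from order_tendstoD(1)[OF elim(1) this]
  obtain n0 where n0: "\<And>n. n \<ge> n0 \<Longrightarrow> rate < (\<Sum>j<n. ln (offspring_mean (env s j))) / n"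
    by (auto simp: eventually_sequentially)
  have big: "prod_mean (env s) n \<ge> exp (rate * n)" if "n \<ge> max 1 n0" for n
  proof -
    have "rate * n \<le> (\<Sum>j<n. ln (offspring_mean (env s j)))"
      using n0[of n] that by (simp add: field_simps)
    then have "exp (rate * n) \<le> exp (\<Sum>j<n. ln (offspring_mean (env s j)))" by simp
    also have "\<dots> = prod_mean (env s) n"
      unfolding prod_mean_def by (subst exp_sum) (auto intro!: prod.cong simp: environmentD(2)[OF e])
    finally show ?thesis .
  qed
  \<comment> \<open>The minimum repairs the finitely many indices before the averages settle; the
    entry 1 covers all later ones.\<close>
  define C where "C = Min (insert 1 ((\<lambda>n. prod_mean (env s) n / exp (rate * n)) ` {..max 1 n0}))"
  have "C > 0" unfolding C_def by (subst Min_gr_iff) (auto simp: prod_mean_pos[OF e])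
  moreover have "prod_mean (env s) n \<ge> C * exp (rate * n)" for n
  proof (cases "n \<le> max 1 n0")
    case True
    then have "C \<le> prod_mean (env s) n / exp (rate * n)" unfolding C_def by (intro Min_le) auto
    then show ?thesis by (simp add: field_simps)
  next
    case False
    have "C \<le> 1" unfolding C_def by (intro Min_le) auto
    then have "C * exp (rate * n) \<le> 1 * exp (rate * n)" by (intro mult_right_mono) auto
    also have "\<dots> \<le> prod_mean (env s) n" using big[of n] False by simp
    finally show ?thesis .
  qed
  ultimately show ?case by blast
qed

text \<open>\<open>Suc k\<close> matches \<open>prod_mean e (Suc k)\<close> in the error terms of
  \<open>norm_pop_truncated_moment\<close>.\<close>

definition decay :: "nat \<Rightarrow> real" where
  "decay k = exp (- (rate * Suc k))"

text \<open>About \<open>ln N / rate\<close> of the terms equal one, and the others are dominated by a geometric series.\<close>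

lemma sum_min_decay:
  "(\<Sum>k. ennreal (min 1 (decay k * real N))) \<le> ennreal (log_plus (real N) / rate + (1 + 1 / (1 - exp (- rate))))"
proof (cases "N = 0")
  case False
  define q where "q = exp (- rate)"
  have q: "0 < q" "q < 1" using rate_pos by (auto simp: q_def)
  define k0 where "k0 = nat \<lceil>ln (real N) / rate\<rceil>"
  have ln0: "ln (real N) \<ge> 0" using False by simp
  have k0: "ln (real N) / rate \<le> real k0" "real k0 \<le> ln (real N) / rate + 1"
    using ln0 rate_pos unfolding k0_def by (auto simp: real_nat_ceiling_ge)
  have tail: "decay (k0 + j) * real N \<le> q ^ j" for j
  proof -
    have "ln (real N) \<le> rate * real k0" using k0(1) rate_pos by (simp add: field_simps)
    then have "exp (ln (real N)) \<le> exp (rate * real k0)" by simp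
    then have "real N \<le> exp (rate * real k0)" using False by simp
    then have "decay (k0 + j) * real N \<le> exp (- (rate * Suc (k0 + j))) * exp (rate * real k0)"
      unfolding decay_def by (intro mult_left_mono) auto
    also have "\<dots> = exp (- (rate * Suc j))" by (simp add: exp_add[symmetric] algebra_simps)
    also have "\<dots> \<le> exp (- (rate * j))" using rate_pos by simp
    also have "\<dots> = q ^ j" by (simp add: q_def exp_of_nat_mult[symmetric])
    finally show ?thesis .
  qed
  have part: "(\<Sum>k<k0 + n. min 1 (decay k * real N)) \<le> real k0 + (\<Sum>j<n. q ^ j)" for n
  proof (induction n)
    case 0
    have "(\<Sum>k<k0. min 1 (decay k * real N)) \<le> (\<Sum>k<k0. 1)" by (intro sum_mono) auto
    then show ?case by simp
  next
    case (Suc n)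
    have "min 1 (decay (k0 + n) * real N) \<le> q ^ n" using tail[of n] by (rule min.coboundedI2)
    moreover have "(\<Sum>k<k0 + Suc n. min 1 (decay k * real N)) = (\<Sum>k<k0 + n. min 1 (decay k * real N)) + min 1 (decay (k0 + n) * real N)"
      by (simp only: add_Suc_right sum.lessThan_Suc)
    moreover have "(\<Sum>j<Suc n. q ^ j) = (\<Sum>j<n. q ^ j) + q ^ n" by (rule sum.lessThan_Suc)
    ultimately show ?case using Suc by linarith
  qed
  have nn: "min 1 (decay k * real N) \<ge> 0" for k by (simp add: decay_def)
  have "(\<Sum>k<n. min 1 (decay k * real N)) \<le> log_plus (real N) / rate + (1 + 1 / (1 - q))" for n
  proof -
    have 1: "(\<Sum>k<n. min 1 (decay k * real N)) \<le> (\<Sum>k<k0 + n. min 1 (decay k * real N))"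
      using nn by (intro sum_mono2) auto
    have 2: "(\<Sum>j<n. q ^ j) \<le> 1 / (1 - q)"
    proof -
      have "(\<Sum>j<n. q ^ j) = (1 - q ^ n) / (1 - q)" using q by (subst sum_gp_strict) auto
      also have "\<dots> \<le> 1 / (1 - q)" using q by (intro divide_right_mono) auto
      finally show ?thesis .
    qed
    have 3: "real k0 \<le> log_plus (real N) / rate + 1"
      using k0(2) ln0 by (simp add: log_plus_def)
    show ?thesis using 1 2 3 part[of n] by linarith
  qed
  then have "(\<Sum>k<n. ennreal (min 1 (decay k * real N))) \<le> ennreal (log_plus (real N) / rate + (1 + 1 / (1 - q)))" for n
    using nn by (simp add: sum_ennreal ennreal_leI)
  then show ?thesis unfolding q_def[symmetric] by (intro suminf_le_const summableI)
qed simp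

text \<open>The offset \<open>n\<close> multiplies every truncation parameter by
  \<open>exp (- (rate * n))\<close>; it is the effect of taking a larger threshold for the
  population.\<close>

definition tail_sum :: "nat \<Rightarrow> (nat \<Rightarrow> 't) \<Rightarrow> ennreal" where
  "tail_sum n s = (\<Sum>k. size_biased_tail (env s k) (decay (k + n)))"

text \<open>Here the logarithmic moment enters. Summing \<open>min 1 (decay k * N)\<close> over
  \<open>k\<close> costs \<open>log_plus N / rate\<close> plus a constant, and the constant is
  harmless since \<open>N / m\<close> has mean one.\<close>

lemma mean_tail_finite: "(\<Sum>k. \<integral>\<^sup>+s. size_biased_tail (\<eta> (s 0)) (decay k) \<partial>\<nu>) < \<infinity>"
proof -
  let ?c = "1 + 1 / (1 - exp (- rate))"
  have c: "?c \<ge> 0" using rate_pos by simp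
  have lp: "log_plus x \<ge> 0" for x by (simp add: log_plus_def)
  have sb: "(\<Sum>k. size_biased_tail (\<eta> (s 0)) (decay k)) \<le>
      ennreal (1 / rate) * (\<integral>\<^sup>+p. ennreal (real (fst p) / offspring_mean (\<eta> (s 0)) * log_plus (real (fst p))) \<partial>\<eta> (s 0)) + ennreal ?c"
    if e: "environment (env s)" for s
  proof -
    note e1 = environmentD(1)[OF e]
    have m: "offspring_mean (\<eta> (s 0)) > 0" using environmentD(2)[OF e, of 0] by (simp add: env_def)
    have sets: "sets (\<eta> (s 0)) = sets mark_space" using mark_lawsD(2)[OF e1, of 0] by (simp add: env_def)
    have meas: "(\<lambda>p. f (fst p)) \<in> borel_measurable (\<eta> (s 0))" for f :: "nat \<Rightarrow> ennreal"
      by (subst measurable_cong_sets[OF sets refl]) (rule measurable_compose[OF mark_measurable(1)], simp)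
    let ?w = "\<lambda>n. real n / offspring_mean (\<eta> (s 0))"
    have w: "?w n \<ge> 0" for n using m by simp
    have "(\<Sum>k. size_biased_tail (\<eta> (s 0)) (decay k)) = (\<integral>\<^sup>+p. (\<Sum>k. ennreal (?w (fst p) * min 1 (decay k * real (fst p)))) \<partial>\<eta> (s 0))"
      unfolding size_biased_tail_def by (rule nn_integral_suminf[symmetric]) (rule meas)
    also have "\<dots> \<le> (\<integral>\<^sup>+p. ennreal (1 / rate) * ennreal (?w (fst p) * log_plus (real (fst p))) + ennreal (real (fst p) * (?c / offspring_mean (\<eta> (s 0)))) \<partial>\<eta> (s 0))"
    proof (rule nn_integral_mono)
      fix p :: mark
      have "(\<Sum>k. ennreal (?w (fst p) * min 1 (decay k * real (fst p)))) = (\<Sum>k. ennreal (?w (fst p)) * ennreal (min 1 (decay k * real (fst p))))"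
        by (subst ennreal_mult) (auto simp: w decay_def)
      also have "\<dots> = ennreal (?w (fst p)) * (\<Sum>k. ennreal (min 1 (decay k * real (fst p))))"
        by (rule ennreal_suminf_cmult)
      also have "\<dots> \<le> ennreal (?w (fst p)) * ennreal (log_plus (real (fst p)) / rate + ?c)"
        by (intro mult_left_mono sum_min_decay) simp
      also have "\<dots> = ennreal (?w (fst p) * (log_plus (real (fst p)) / rate + ?c))"
        using w lp rate_pos c by (subst ennreal_mult[symmetric]) (auto intro!: add_nonneg_nonneg)
      also have "?w (fst p) * (log_plus (real (fst p)) / rate + ?c)
        = 1 / rate * (?w (fst p) * log_plus (real (fst p))) + real (fst p) * (?c / offspring_mean (\<eta> (s 0)))"
        by (simp add: algebra_simps add_divide_distrib)
      also have "ennreal \<dots> = ennreal (1 / rate * (?w (fst p) * log_plus (real (fst p)))) + ennreal (real (fst p) * (?c / offspring_mean (\<eta> (s 0))))"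
        using w lp rate_pos c m by (intro ennreal_plus mult_nonneg_nonneg divide_nonneg_nonneg) auto
      also have "ennreal (1 / rate * (?w (fst p) * log_plus (real (fst p)))) = ennreal (1 / rate) * ennreal (?w (fst p) * log_plus (real (fst p)))"
        using w lp rate_pos by (intro ennreal_mult mult_nonneg_nonneg) auto
      finally show "(\<Sum>k. ennreal (?w (fst p) * min 1 (decay k * real (fst p))))
        \<le> ennreal (1 / rate) * ennreal (?w (fst p) * log_plus (real (fst p))) + ennreal (real (fst p) * (?c / offspring_mean (\<eta> (s 0))))" .
    qed
    also have "\<dots> = (\<integral>\<^sup>+p. ennreal (1 / rate) * ennreal (?w (fst p) * log_plus (real (fst p))) \<partial>\<eta> (s 0))
        + (\<integral>\<^sup>+p. ennreal (real (fst p) * (?c / offspring_mean (\<eta> (s 0)))) \<partial>\<eta> (s 0))"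
      by (rule nn_integral_add) (rule meas)+
    also have "(\<integral>\<^sup>+p. ennreal (real (fst p) * (?c / offspring_mean (\<eta> (s 0)))) \<partial>\<eta> (s 0)) = ennreal ?c"
      using nn_integral_offspring[OF e, of "?c / offspring_mean (\<eta> (s 0))" 0] c m by (simp add: env_def)
    also have "(\<integral>\<^sup>+p. ennreal (1 / rate) * ennreal (?w (fst p) * log_plus (real (fst p))) \<partial>\<eta> (s 0))
      = ennreal (1 / rate) * (\<integral>\<^sup>+p. ennreal (?w (fst p) * log_plus (real (fst p))) \<partial>\<eta> (s 0))"
      by (rule nn_integral_cmult) (rule meas)
    finally show ?thesis .
  qed
  have L: "(\<lambda>s. \<integral>\<^sup>+p. ennreal (real (fst p) / offspring_mean (\<eta> (s 0)) * log_plus (real (fst p))) \<partial>\<eta> (s 0)) \<in> borel_measurable \<nu>"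
  proof -
    have "(\<lambda>x. real (fst (snd x)) / offspring_mean (\<eta> (fst x)) * log_plus (real (fst (snd x)))) \<in> borel_measurable (\<Theta> \<Otimes>\<^sub>M mark_space)"
      using measurable_compose[OF offspring_pair_measurable, of real borel]
        measurable_compose[OF offspring_pair_measurable, of "\<lambda>n. log_plus (real n)" borel]
        measurable_compose[OF measurable_fst offspring_mean_measurable]
      by (intro borel_measurable_times borel_measurable_divide) auto
    then have "(\<lambda>t. \<integral>\<^sup>+p. ennreal (real (fst p) / offspring_mean (\<eta> t) * log_plus (real (fst p))) \<partial>\<eta> t) \<in> borel_measurable \<Theta>"
      by (intro kernel_nn_integral_measurable) (simp add: case_prod_beta')
    from measurable_compose[OF coordinate_measurable this] show ?thesis .
  qed
  have "(\<Sum>k. \<integral>\<^sup>+s. size_biased_tail (\<eta> (s 0)) (decay k) \<partial>\<nu>) = (\<integral>\<^sup>+s. (\<Sum>k. size_biased_tail (\<eta> (s 0)) (decay k)) \<partial>\<nu>)"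
    by (rule nn_integral_suminf[symmetric]) measurable
  also have "\<dots> \<le> (\<integral>\<^sup>+s. ennreal (1 / rate) * (\<integral>\<^sup>+p. ennreal (real (fst p) / offspring_mean (\<eta> (s 0)) * log_plus (real (fst p))) \<partial>\<eta> (s 0)) + ennreal ?c \<partial>\<nu>)"
    by (intro nn_integral_mono_AE eventually_mono[OF AE_environment] sb)
  also have "\<dots> = (\<integral>\<^sup>+s. ennreal (1 / rate) * (\<integral>\<^sup>+p. ennreal (real (fst p) / offspring_mean (\<eta> (s 0)) * log_plus (real (fst p))) \<partial>\<eta> (s 0)) \<partial>\<nu>) + (\<integral>\<^sup>+s. ennreal ?c \<partial>\<nu>)"
    using L by (intro nn_integral_add) auto
  also have "\<dots> = ennreal (1 / rate) * (\<integral>\<^sup>+s. (\<integral>\<^sup>+p. ennreal (real (fst p) / offspring_mean (\<eta> (s 0)) * log_plus (real (fst p))) \<partial>\<eta> (s 0)) \<partial>\<nu>) + ennreal ?c"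
    using L by (simp add: nn_integral_cmult emeasure_space_1)
  also have "\<dots> < \<infinity>" using N_log_N by (simp add: ennreal_mult_less_top)
  finally show ?thesis .
qed

lemma tail_sum_antimono: "n \<le> n' \<Longrightarrow> tail_sum n' s \<le> tail_sum n s"
proof -
  assume n: "n \<le> n'"
  have "decay (k + n') \<le> decay (k + n)" for k
    using n rate_pos by (simp add: decay_def)
  then show ?thesis
    unfolding tail_sum_def by (intro suminf_le summableI size_biased_tail_mono)
qed

text \<open>Stationarity moves every term to coordinate 0, so the means of the tail sums are tails
  of one series.\<close>

lemma nn_integral_tail_sum: "(\<integral>\<^sup>+s. tail_sum n s \<partial>\<nu>) = (\<Sum>k. \<integral>\<^sup>+s. size_biased_tail (\<eta> (s 0)) (decay (k + n)) \<partial>\<nu>)"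
proof -
  have m: "(\<lambda>s. size_biased_tail (\<eta> (s k)) c) \<in> borel_measurable \<nu>" for k c
    by measurable
  have "(\<integral>\<^sup>+s. tail_sum n s \<partial>\<nu>) = (\<Sum>k. \<integral>\<^sup>+s. size_biased_tail (\<eta> (s k)) (decay (k + n)) \<partial>\<nu>)"
    unfolding tail_sum_def env_def by (rule nn_integral_suminf) (rule m)
  also have "\<dots> = (\<Sum>k. \<integral>\<^sup>+s. size_biased_tail (\<eta> (s 0)) (decay (k + n)) \<partial>\<nu>)"
  proof (intro suminf_cong)
    fix k
    show "(\<integral>\<^sup>+s. size_biased_tail (\<eta> (s k)) (decay (k + n)) \<partial>\<nu>) = (\<integral>\<^sup>+s. size_biased_tail (\<eta> (s 0)) (decay (k + n)) \<partial>\<nu>)"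
      using nn_integral_funpow[OF m[of 0 "decay (k + n)"], of k] by (simp add: funpow_shift)
  qed
  finally show ?thesis .
qed

text \<open>The means of the tail sums are remainders of a convergent series. Their infimum over
  \<open>n\<close> is nonnegative with integral zero, hence zero almost surely.\<close>

lemma AE_tail_sum: "AE s in \<nu>. \<forall>j. \<exists>n. tail_sum n s < ennreal (1 / Suc j)"
proof -
  let ?c = "\<lambda>k. \<integral>\<^sup>+s. size_biased_tail (\<eta> (s 0)) (decay k) \<partial>\<nu>"
  have fin: "?c k \<noteq> \<infinity>" for k
  proof -
    have "?c k \<le> (\<Sum>k. ?c k)" using sum_le_suminf[OF summableI, of "{k}" ?c] by simp
    then show ?thesis using mean_tail_finite by (auto simp: top_unique)
  qed
  define c where "c k = enn2real (?c k)" for k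
  have c: "ennreal (c k) = ?c k" "c k \<ge> 0" for k
    using fin[of k] by (auto simp: c_def less_top)
  have sum_c: "summable c"
    using mean_tail_finite c by (intro summable_suminf_not_top) auto
  have m [measurable]: "tail_sum n \<in> borel_measurable \<nu>" for n
  proof -
    have "(\<lambda>s. size_biased_tail (\<eta> (s k)) c) \<in> borel_measurable \<nu>" for k c by measurable
    then show ?thesis unfolding tail_sum_def env_def by (intro borel_measurable_suminf_order)
  qed
  have "(\<integral>\<^sup>+s. (INF n. tail_sum n s) \<partial>\<nu>) = 0"
  proof (rule ccontr)
    assume "(\<integral>\<^sup>+s. (INF n. tail_sum n s) \<partial>\<nu>) \<noteq> 0"
    then have pos: "(\<integral>\<^sup>+s. (INF n. tail_sum n s) \<partial>\<nu>) > 0" by (simp add: zero_less_iff_neq_zero)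
    have le: "(\<integral>\<^sup>+s. (INF n. tail_sum n s) \<partial>\<nu>) \<le> ennreal (\<Sum>k. c (k + n))" for n
    proof -
      have "(\<integral>\<^sup>+s. (INF n. tail_sum n s) \<partial>\<nu>) \<le> (\<integral>\<^sup>+s. tail_sum n s \<partial>\<nu>)"
        by (intro nn_integral_mono INF_lower) auto
      also have "\<dots> = (\<Sum>k. ennreal (c (k + n)))" by (simp add: nn_integral_tail_sum c)
      also have "\<dots> = ennreal (\<Sum>k. c (k + n))"
        using sum_c c(2) by (intro suminf_ennreal2) (auto simp: summable_iff_shift)
      finally show ?thesis .
    qed
    have "(\<integral>\<^sup>+s. (INF n. tail_sum n s) \<partial>\<nu>) < \<infinity>" using le_less_trans[OF le[of 0] ennreal_less_top] by simp
    then obtain x where x: "(\<integral>\<^sup>+s. (INF n. tail_sum n s) \<partial>\<nu>) = ennreal x" "x \<ge> 0"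
      by (cases "\<integral>\<^sup>+s. (INF n. tail_sum n s) \<partial>\<nu>") auto
    then have "x > 0" using pos by simp
    then obtain n where "norm (\<Sum>k. c (k + n)) < x" using suminf_exist_split[OF _ sum_c] by blast
    moreover have "x \<le> (\<Sum>k. c (k + n))"
      using le[of n] x sum_c c(2) by (subst (asm) x(1), subst (asm) ennreal_le_iff) (auto intro!: suminf_nonneg simp: summable_iff_shift)
    ultimately show False by simp
  qed
  then have "AE s in \<nu>. (INF n. tail_sum n s) = 0"
    by (subst (asm) nn_integral_0_iff_AE) auto
  then show ?thesis
  proof eventually_elim
    case (elim s)
    show ?case
    proof
      fix j
      have "(INF n. tail_sum n s) < ennreal (1 / Suc j)" by (simp add: elim)
      then show "\<exists>n. tail_sum n s < ennreal (1 / Suc j)" by (auto simp: INF_less_iff)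
    qed
  qed
qed

theorem AE_unif_int: "AE s in \<nu>. \<forall>j. \<exists>K. unif_int j K (env s)"
  using AE_environment AE_prod_mean_growth AE_tail_sum
proof eventually_elim
  case (elim s)
  note e = elim(1)
  obtain C where C: "C > 0" "\<And>n. prod_mean (env s) n \<ge> C * exp (rate * n)" using elim(2) by blast
  show ?case
  proof
    fix j
    \<comment> \<open>Two errors of size \<open>1 / Suc (2 * j + 1)\<close> add up to
      \<open>1 / Suc j\<close>.\<close>
    obtain n1 where n1: "tail_sum n1 s < ennreal (1 / Suc (2 * j + 1))" using elim(3) by blast
    have "(\<lambda>n. exp (- rate) ^ n) \<longlonglongrightarrow> 0" using rate_pos by (intro LIMSEQ_power_zero) simp
    then have "(\<lambda>n. exp (- (rate * real n))) \<longlonglongrightarrow> 0" by (simp add: exp_of_nat_mult[symmetric] mult.commute)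
    then have "eventually (\<lambda>n. exp (- (rate * real n)) < 1 / Suc (2 * j + 1)) sequentially"
      by (rule order_tendstoD) simp
    then obtain n2 where n2: "\<And>n. n \<ge> n2 \<Longrightarrow> exp (- (rate * real n)) < 1 / Suc (2 * j + 1)"
      by (auto simp: eventually_sequentially)
    \<comment> \<open>\<open>n1\<close> handles the sum of size-biased tails and \<open>n2\<close>
      the remaining term. A threshold with \<open>1 / Suc K \<le> C * exp (- (rate * L))\<close>
      absorbs the constant \<open>C\<close> of the growth estimate, so every parameter is at most
      \<open>exp (- (rate * (L + n)))\<close>.\<close>
    define L where "L = max n1 n2"
    define l where "l = C * exp (- (rate * L))"
    have l: "l > 0" using C by (simp add: l_def)
    obtain K where K: "1 / l \<le> real K" using real_arch_simple by blast
    have Kl: "1 / real (Suc K) \<le> l"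
    proof -
      have "1 / l \<le> real (Suc K)" using K by simp
      then show ?thesis using l by (simp add: field_simps)
    qed
    have quot: "1 / Suc K / prod_mean (env s) n \<le> exp (- (rate * (L + n)))" for n
    proof -
      have "1 / Suc K / prod_mean (env s) n \<le> l / (C * exp (rate * n))"
        using Kl C(2)[of n] C(1) l by (intro frac_le) auto
      also have "\<dots> = exp (- (rate * L)) / exp (rate * n)" using C(1) by (simp add: l_def)
      also have "\<dots> = exp (- (rate * (L + n)))" by (simp add: exp_diff[symmetric] algebra_simps)
      finally show ?thesis .
    qed
    have "unif_int j K (env s)"
      unfolding unif_int_def
    proof
      fix n
      have "(\<integral>\<^sup>+X. ennreal (norm_pop n (env s) X * min 1 (1 / Suc K * norm_pop n (env s) X)) \<partial>tree_law (env s))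
        \<le> ennreal (min 1 (1 / Suc K / prod_mean (env s) n)) + (\<Sum>k<n. size_biased_tail (env s k) (1 / Suc K / prod_mean (env s) (Suc k)))"
        by (rule norm_pop_truncated_moment[OF e]) simp
      also have "\<dots> \<le> ennreal (1 / Suc (2 * j + 1)) + ennreal (1 / Suc (2 * j + 1))"
      proof (rule add_mono)
        have "min 1 (1 / Suc K / prod_mean (env s) n) \<le> exp (- (rate * (L + n)))" using quot[of n] by simp
        also have "\<dots> \<le> 1 / Suc (2 * j + 1)" 
        proof -
          have "n2 \<le> L + n" unfolding L_def by linarith
          from less_imp_le[OF n2[OF this]] show ?thesis by simp
        qed
        finally show "ennreal (min 1 (1 / Suc K / prod_mean (env s) n)) \<le> ennreal (1 / Suc (2 * j + 1))" by (rule ennreal_leI)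
        have "(\<Sum>k<n. size_biased_tail (env s k) (1 / Suc K / prod_mean (env s) (Suc k))) \<le> (\<Sum>k<n. size_biased_tail (env s k) (decay (k + L)))"
        proof (intro sum_mono size_biased_tail_mono)
          fix k
          show "1 / Suc K / prod_mean (env s) (Suc k) \<le> decay (k + L)"
            using quot[of "Suc k"] by (simp add: decay_def algebra_simps)
        qed
        also have "\<dots> \<le> tail_sum L s" unfolding tail_sum_def by (intro sum_le_suminf summableI) auto
        also have "\<dots> \<le> tail_sum n1 s" by (rule tail_sum_antimono) (simp add: L_def)
        also note less_imp_le[OF n1]
        finally show "(\<Sum>k<n. size_biased_tail (env s k) (1 / Suc K / prod_mean (env s) (Suc k))) \<le> ennreal (1 / Suc (2 * j + 1))" .
      qed
      also have "\<dots> = ennreal (1 / Suc (2 * j + 1) + 1 / Suc (2 * j + 1))" by (rule ennreal_plus[symmetric]) auto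
      also have "1 / real (Suc (2 * j + 1)) + 1 / real (Suc (2 * j + 1)) = 1 / real (Suc j)" by (simp add: field_simps)
      finally show "(\<integral>\<^sup>+X. ennreal (norm_pop n (env s) X * min 1 (1 / Suc K * norm_pop n (env s) X)) \<partial>tree_law (env s)) \<le> ennreal (1 / Suc j)" .
    qed
    then show "\<exists>K. unif_int j K (env s)" ..
  qed
qed

end

definition clt_data :: "(nat \<Rightarrow> mark measure) \<Rightarrow> bool" where
  "clt_data e \<longleftrightarrow> (\<forall>n. disp_var (e n) < \<infinity>)
    \<and> (\<exists>V>0. (\<lambda>n. (\<Sum>j<n. enn2real (disp_var (e j))) / n) \<longlonglongrightarrow> V)
    \<and> (\<exists>\<psi>. (\<forall>k. (\<lambda>n. (\<Sum>j<n. truncated_third_moment k (e j)) / n) \<longlonglongrightarrow> \<psi> k) \<and> \<psi> \<longlonglongrightarrow> (0 :: real))"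

text \<open>All that the argument in a fixed environment uses. The limit theorem is required for
  every shift because it is applied from generation \<open>k\<close> on; in the last clause
  \<open>K\<close> is chosen before \<open>n\<close>, so one threshold serves arbitrarily late
  generations.\<close>

definition regular :: "(nat \<Rightarrow> mark measure) \<Rightarrow> bool" where
  "regular e \<longleftrightarrow> environment e \<and> (\<forall>k. clt_data ((shift ^^ k) e))
    \<and> filterlim (prod_mean e) at_top sequentially
    \<and> null_prob e < 1 \<and> extinct_prob e = null_prob e
    \<and> (\<forall>j. \<exists>K. \<forall>n. \<exists>k\<ge>n. unif_int j K ((shift ^^ k) e))"

section \<open>Measurability of the tree law in the environment\<close>

context mark_kernel
begin

text \<open>Cylinders form a generating family stable under intersection, and the measure of a
  cylinder is a finite product of kernel values at coordinates of the environment.\<close>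

lemma tree_law_kernel: "(\<lambda>s. tree_law (env s)) \<in> \<nu> \<rightarrow>\<^sub>M prob_algebra tree_space"
proof (rule measurable_prob_algebra_generated[where \<Omega>="\<Pi>\<^sub>E u\<in>UNIV. space mark_space" and G="prod_algebra UNIV (\<lambda>_ :: nat list. mark_space)"])
  show "sets tree_space = sigma_sets (\<Pi>\<^sub>E u\<in>UNIV. space mark_space) (prod_algebra UNIV (\<lambda>_ :: nat list. mark_space))"
    unfolding tree_space_def by (rule sets_PiM)
  show "Int_stable (prod_algebra UNIV (\<lambda>_ :: nat list. mark_space))" by (rule Int_stable_prod_algebra)
  show "prod_algebra UNIV (\<lambda>_ :: nat list. mark_space) \<subseteq> Pow (\<Pi>\<^sub>E u\<in>UNIV. space mark_space)"
    by (rule prod_algebra_sets_into_space)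
  show "prob_space (tree_law (env s))" "sets (tree_law (env s)) = sets tree_space" if "s \<in> space \<nu>" for s
    using prob_space_tree_law sets_tree_law mark_laws_env[OF that] by auto
  fix A assume "A \<in> prod_algebra UNIV (\<lambda>_ :: nat list. mark_space)"
  then obtain J E where A: "A = prod_emb UNIV (\<lambda>_. mark_space) J (\<Pi>\<^sub>E j\<in>J. E j)" and J: "finite J"
    and E: "\<And>j. j \<in> J \<Longrightarrow> E j \<in> sets mark_space"
    by (rule prod_algebraE) auto
  have "(\<lambda>s. emeasure (tree_law (env s)) A) \<in> borel_measurable \<nu> \<longleftrightarrow>
    (\<lambda>s. \<Prod>j\<in>J. emeasure (\<eta> (s (length j))) (E j)) \<in> borel_measurable \<nu>"
  proof (rule measurable_cong)
    fix s assume s: "s \<in> space \<nu>"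
    note e = mark_laws_env[OF s]
    have "A = prod_emb UNIV (\<lambda>u. env s (length u)) J (\<Pi>\<^sub>E j\<in>J. E j)"
      unfolding A prod_emb_def using mark_lawsD(3)[OF e] by (simp add: space_PiM)
    then show "emeasure (tree_law (env s)) A = (\<Prod>j\<in>J. emeasure (\<eta> (s (length j))) (E j))"
      unfolding tree_law_def using J E mark_lawsD(1,2)[OF e]
      by (simp, subst emeasure_PiM_emb) (auto simp: env_def)
  qed
  moreover have "(\<lambda>s. emeasure (\<eta> (s (length j))) (E j)) \<in> borel_measurable \<nu>" if "j \<in> J" for j
    by (rule measurable_compose[OF coordinate_measurable[of "length j"] measurable_emeasure_kernel[OF kernel_subprob E[OF that]]])
  then have "(\<lambda>s. \<Prod>j\<in>J. emeasure (\<eta> (s (length j))) (E j)) \<in> borel_measurable \<nu>"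
    by (rule borel_measurable_prod_ennreal)
  ultimately show "(\<lambda>s. emeasure (tree_law (env s)) A) \<in> borel_measurable \<nu>" by simp
qed

lemma tree_nn_integral_measurable:
  assumes "(\<lambda>x. f (fst x) (snd x)) \<in> borel_measurable (\<nu> \<Otimes>\<^sub>M tree_space)"
  shows "(\<lambda>s. \<integral>\<^sup>+X. f s X \<partial>tree_law (env s)) \<in> borel_measurable \<nu>"
  by (rule nn_integral_measurable_subprob_algebra2[OF _ measurable_prob_algebraD[OF tree_law_kernel]])
    (use assms in \<open>simp add: case_prod_beta'\<close>)

lemma tree_integral_measurable:
  fixes f :: "(nat \<Rightarrow> 't) \<Rightarrow> marks \<Rightarrow> real"
  assumes f: "(\<lambda>x. f (fst x) (snd x)) \<in> borel_measurable (\<nu> \<Otimes>\<^sub>M tree_space)" and "\<And>s X. f s X \<ge> 0"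
  shows "(\<lambda>s. \<integral>X. f s X \<partial>tree_law (env s)) \<in> borel_measurable \<nu>"
proof -
  have "(\<lambda>s. \<integral>X. f s X \<partial>tree_law (env s)) \<in> borel_measurable \<nu> \<longleftrightarrow>
    (\<lambda>s. enn2real (\<integral>\<^sup>+X. ennreal (f s X) \<partial>tree_law (env s))) \<in> borel_measurable \<nu>"
  proof (rule measurable_cong)
    fix s assume s: "s \<in> space \<nu>"
    have "(\<lambda>X. (s, X)) \<in> tree_space \<rightarrow>\<^sub>M \<nu> \<Otimes>\<^sub>M tree_space" using s by (intro measurable_Pair1') 
    from measurable_compose[OF this f] have "f s \<in> borel_measurable tree_space" by simp
    then have "f s \<in> borel_measurable (tree_law (env s))"
      by (subst measurable_cong_sets[OF sets_tree_law[OF mark_laws_env[OF s]] refl])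
    then show "(\<integral>X. f s X \<partial>tree_law (env s)) = enn2real (\<integral>\<^sup>+X. ennreal (f s X) \<partial>tree_law (env s))"
      using assms(2) by (intro integral_eq_nn_integral) auto
  qed
  moreover have "(\<lambda>s. enn2real (\<integral>\<^sup>+X. ennreal (f s X) \<partial>tree_law (env s))) \<in> borel_measurable \<nu>"
    using f by (intro borel_measurable_enn2real tree_nn_integral_measurable measurable_compose[OF _ measurable_ennreal])
  ultimately show ?thesis by simp
qed

end

context random_environment
begin

lemma norm_pop_joint_measurable: "(\<lambda>x. norm_pop n (env (fst x)) (snd x)) \<in> borel_measurable (\<nu> \<Otimes>\<^sub>M tree_space)"
proof (induction n)
  case (Suc n)
  have 1: "(\<lambda>x. norm_pop n (env (shift (fst x))) (subtree (snd x) i)) \<in> borel_measurable (\<nu> \<Otimes>\<^sub>M tree_space)" for i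
  proof -
    have "(\<lambda>x. (shift (fst x), subtree (snd x) i)) \<in> \<nu> \<Otimes>\<^sub>M tree_space \<rightarrow>\<^sub>M \<nu> \<Otimes>\<^sub>M tree_space"
      using measurable_compose[OF measurable_fst T_measurable] measurable_compose[OF measurable_snd subtree_measurable]
      by (intro measurable_Pair)
    from measurable_compose[OF this Suc] show ?thesis by simp
  qed
  have 2: "(\<lambda>x. fst (snd x [])) \<in> \<nu> \<Otimes>\<^sub>M tree_space \<rightarrow>\<^sub>M count_space UNIV"
    by (rule measurable_compose[OF measurable_compose[OF measurable_snd root_measurable] mark_measurable(1)])
  have 3: "(\<lambda>x. offspring_mean (\<eta> (fst x 0))) \<in> borel_measurable (\<nu> \<Otimes>\<^sub>M tree_space)"
    by (rule measurable_compose[OF measurable_compose[OF measurable_fst coordinate_measurable] offspring_mean_measurable])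
  show ?case
    using borel_measurable_divide[OF sum_random_length_measurable[OF 1 2] 3]
    by (simp add: env_shift) (simp add: env_def)
qed simp

lemma unif_int_event: "{s \<in> space \<nu>. unif_int j K (env s)} \<in> sets \<nu>"
proof -
  have "(\<lambda>s. \<integral>\<^sup>+X. ennreal (norm_pop n (env s) X * min 1 (1 / Suc K * norm_pop n (env s) X)) \<partial>tree_law (env s)) \<in> borel_measurable \<nu>" for n
    using norm_pop_joint_measurable[of n]
    by (intro tree_nn_integral_measurable measurable_compose[OF _ measurable_ennreal] borel_measurable_times
        borel_measurable_min borel_measurable_const)
  then show ?thesis unfolding unif_int_def by measurable
qed

lemma laplace_measurable: "(\<lambda>s. laplace n (env s) l) \<in> borel_measurable \<nu>"
  unfolding laplace_def using norm_pop_joint_measurable[of n]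
  by (intro tree_integral_measurable measurable_compose[OF _ borel_measurable_exp] borel_measurable_uminus borel_measurable_times) auto

lemma extinct_measurable: "(\<lambda>s. extinct n (env s)) \<in> borel_measurable \<nu>"
proof -
  have "(\<lambda>w :: real. if w = 0 then 1 else 0 :: real) \<in> borel_measurable borel" by measurable
  from measurable_compose[OF norm_pop_joint_measurable[of n] this]
  show ?thesis unfolding extinct_def by (intro tree_integral_measurable) auto
qed

text \<open>Since \<open>lim\<close> is total, measurability extends over the null set of
  environments on which convergence has not been established.\<close>

lemma survival_ratio_measurable: "(\<lambda>s. survival_ratio (env s)) \<in> borel_measurable \<nu>"
  unfolding survival_ratio_def null_prob_def extinct_prob_def laplace_lim_def
  using laplace_measurable extinct_measurable
  by (intro borel_measurable_divide borel_measurable_diff borel_measurable_const borel_measurable_lim_metric)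

lemma AE_null_prob_less_one: "AE s in \<nu>. null_prob (env s) < 1"
  using AE_environment AE_unif_int
proof eventually_elim
  case (elim s)
  \<comment> \<open>Index \<open>j = 1\<close> is the level \<open>1 / 2\<close> demanded by
    \<open>null_prob_less_one\<close>.\<close>
  obtain K where "unif_int 1 K (env s)" using elim by blast
  then show ?case
    using elim(1) by (intro null_prob_less_one[where K="real (Suc K)"]) (auto simp: unif_int_def)
qed

text \<open>The ratio \<open>survival_ratio\<close> decreases along the shift by convexity of the generating
  functions, so it is invariant by stationarity. Where it is less than one, every generating
  function is affine, which is incompatible with a positive mean of \<open>ln m\<^sub>0\<close>.\<close>

theorem AE_extinct_eq_null: "AE s in \<nu>. extinct_prob (env s) = null_prob (env s)"
proof -
  have Q: "AE s in \<nu>. \<forall>n. environment (env ((shift ^^ n) s)) \<and> null_prob (env ((shift ^^ n) s)) < 1"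
    using AE_environment AE_null_prob_less_one by (intro AE_funpow) (auto elim: eventually_elim2)
  let ?h = "\<lambda>s. survival_ratio (env s)"
  have bounds: "AE s in \<nu>. 0 \<le> ?h s \<and> ?h s \<le> 1 \<and> ?h (shift s) \<le> ?h s"
    using Q
  proof eventually_elim
    case (elim s)
    have "environment (env s)" "null_prob (env s) < 1" using elim[THEN spec, of 0] by auto
    moreover have "null_prob (shift (env s)) < 1" using elim[THEN spec, of 1] by (simp add: env_shift)
    ultimately show ?case using survival_ratio[of "env s"] by (simp add: env_shift)
  qed
  have int: "integrable \<nu> ?h"
  proof (rule integrable_const_bound[where B=1])
    show "AE s in \<nu>. norm (?h s) \<le> 1" using bounds by eventually_elim auto
  qed (rule survival_ratio_measurable)
  have "AE s in \<nu>. ?h (shift s) \<le> ?h s" using bounds by eventually_elim simp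
  from AE_funpow[OF AE_eq_of_decreasing[OF int this]]
  have inv: "AE s in \<nu>. \<forall>n. ?h (shift ((shift ^^ n) s)) = ?h ((shift ^^ n) s)" .
  show ?thesis
    using Q inv birkhoff_env[OF ln_mean(1)]
  proof eventually_elim
    case (elim s)
    note e = elim(1)[THEN spec, THEN conjunct1] and q = elim(1)[THEN spec, THEN conjunct2]
    have step: "environment (env ((shift ^^ n) s))" "null_prob (env ((shift ^^ n) s)) < 1"
      "null_prob (shift (env ((shift ^^ n) s))) < 1" for n
      using e[of n] q[of n] q[of "Suc n"] by (auto simp: env_shift)
    have "\<not> ?h s < 1"
    proof
      assume less: "?h s < 1"
      have const: "?h ((shift ^^ n) s) = ?h s" for n
        by (induction n) (use elim(2) in auto)
      have "offspring_mean (env ((shift ^^ n) s) 0) \<le> 1" for n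
      proof (rule survival_ratio(5)[OF step])
        show "survival_ratio (shift (env ((shift ^^ n) s))) = ?h ((shift ^^ n) s)"
          using elim(2) by (simp add: env_shift)
        show "?h ((shift ^^ n) s) < 1" using const less by simp
      qed
      then have "offspring_mean (env s n) \<le> 1" for n by (simp add: env_def funpow_shift)
      moreover have "offspring_mean (env s n) > 0" for n
        using environmentD(2)[OF e[of 0], of n] by simp
      ultimately have "ln (offspring_mean (env s n)) \<le> 0" for n by simp
      then have "(\<Sum>j<n. ln (offspring_mean (env s j))) / n \<le> 0" for n
        by (intro divide_nonpos_nonneg sum_nonpos) auto
      then have "(\<integral>s. ln (offspring_mean (\<eta> (s 0))) \<partial>\<nu>) \<le> 0"
        by (intro LIMSEQ_le_const2[OF elim(3)]) auto
      then show False using ln_mean(2) by simp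
    qed
    then have "\<not> extinct_prob (env s) < null_prob (env s)"
      using survival_ratio(4)[OF step[of 0]] by simp
    then show ?case using extinct_prob_limit(4)[OF e[of 0]] by simp
  qed
qed

text \<open>For each \<open>j\<close> the countably many events \<open>?A K\<close> cover almost
  every environment, so one of them has positive probability, and the shifted environment returns to
  it infinitely often.\<close>

lemma AE_recurrent_unif_int: "AE s in \<nu>. \<forall>j. \<exists>K. \<forall>n. \<exists>k\<ge>n. unif_int j K ((shift ^^ k) (env s))"
proof (subst AE_all_countable, rule allI)
  fix j
  let ?A = "\<lambda>K. {s \<in> space \<nu>. unif_int j K (env s)}"
  have "\<exists>K. prob (?A K) > 0"
  proof (rule ccontr)
    assume "\<not> (\<exists>K. prob (?A K) > 0)"
    then have z: "prob (?A K) = 0" for K by (metis measure_nonneg order_le_less)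
    have "AE s in \<nu>. \<forall>K. s \<notin> ?A K"
    proof (subst AE_all_countable, rule allI)
      fix K
      show "AE s in \<nu>. s \<notin> ?A K"
        using unif_int_event[of j K] z[of K] by (subst AE_iff_measurable[of "?A K"]) (auto simp: emeasure_eq_measure)
    qed
    then have "AE s in \<nu>. False"
      using AE_unif_int AE_space
    proof eventually_elim
      case (elim s)
      then show ?case by auto
    qed
    then show False by simp
  qed
  then obtain K where "prob (?A K) > 0" by blast
  from recurrence[OF unif_int_event this]
  show "AE s in \<nu>. \<exists>K. \<forall>n. \<exists>k\<ge>n. unif_int j K ((shift ^^ k) (env s))"
  proof eventually_elim
    case (elim s)
    then show ?case by (intro exI[of _ K]) (auto simp: env_funpow_shift)
  qed
qed

lemma AE_clt_data: "AE s in \<nu>. clt_data (env s)"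
proof -
  obtain \<psi> where \<psi>: "AE s in \<nu>. \<forall>k. (\<lambda>n. (\<Sum>j<n. truncated_third_moment k (env s j)) / n) \<longlonglongrightarrow> \<psi> k" "\<psi> \<longlonglongrightarrow> (0 :: real)"
    using AE_truncated_third_moment by blast
  show ?thesis
    using \<psi>(1) AE_disp_var_finite birkhoff_env[OF disp_var_integrable]
  proof eventually_elim
    case (elim s)
    then show ?case
      unfolding clt_data_def using mean_variance_pos \<psi>(2) by (auto simp: mean_variance_def)
  qed
qed

theorem AE_regular: "AE s in \<nu>. regular (env s)"
  using AE_environment AE_funpow[OF AE_clt_data] AE_prod_mean_growth AE_null_prob_less_one AE_extinct_eq_null AE_recurrent_unif_int
proof eventually_elim
  case (elim s)
  obtain C where C: "C > 0" "\<And>n. prod_mean (env s) n \<ge> C * exp (rate * n)" using elim(3) by blast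
  have "filterlim (\<lambda>n. C * exp (rate * real n)) at_top sequentially"
    by (intro filterlim_tendsto_pos_mult_at_top[OF tendsto_const C(1)] filterlim_compose[OF exp_at_top]
        filterlim_tendsto_pos_mult_at_top[OF tendsto_const rate_pos] filterlim_real_sequentially)
  then have "filterlim (prod_mean (env s)) at_top sequentially"
    by (rule filterlim_at_top_mono) (use C(2) in auto)
  then show ?case using elim by (simp add: regular_def env_funpow_shift)
qed

end

section \<open>Concentration of the branching sums\<close>

text \<open>With \<open>z\<close> the barrier minus the position, \<open>z \<ge> 0\<close> says that
  the particle lies at or below the barrier. Subtracting the target value \<open>c\<close> reduces
  the theorem to showing that a branching sum is small; the tree argument \<open>X\<close> is there
  to fit \<open>branching_sum\<close>.\<close>

definition half_line :: "real \<Rightarrow> marks \<Rightarrow> real \<Rightarrow> real" where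
  "half_line c X z = indicator {0..} z - c"

lemma half_line_measurable: "(\<lambda>(X, z). half_line c X z) \<in> borel_measurable (tree_space \<Otimes>\<^sub>M borel)"
  unfolding half_line_def by measurable

lemma indicator_measurable_pair: "(\<lambda>(X :: marks, z :: real). indicator {0..} z :: real) \<in> borel_measurable (tree_space \<Otimes>\<^sub>M borel)"
  by measurable

context
  fixes c :: real
  assumes c: "0 \<le> c" "c \<le> 1"
begin

lemma abs_branching_half_line: "\<bar>branching_sum n e (half_line c) X z\<bar> \<le> norm_pop n e X"
proof -
  have "\<bar>branching_sum n e (half_line c) X z\<bar> \<le> branching_sum n e (\<lambda>X z. \<bar>half_line c X z\<bar>) X z"
    by (rule abs_branching_sum_le)
  also have "\<dots> \<le> branching_sum n e (\<lambda>_ _. 1) X z"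
    using c by (intro branching_sum_mono) (auto simp: half_line_def indicator_def)
  finally show ?thesis by (simp only: branching_sum_one)
qed

lemma branching_half_line_eq:
  "branching_sum n e (half_line c) X z = branching_sum n e (\<lambda>_ z. indicator {0..} z) X z - c * norm_pop n e X"
proof -
  have "branching_sum n e (half_line c) X z = branching_sum n e (\<lambda>X z. indicator {0..} z - c * 1) X z"
    by (intro arg_cong[where f="\<lambda>F. branching_sum n e F X z"]) (simp add: half_line_def fun_eq_iff)
  also have "\<dots> = branching_sum n e (\<lambda>_ z. indicator {0..} z) X z - branching_sum n e (\<lambda>_ _. c * 1) X z"
    by (rule branching_sum_diff)
  also have "branching_sum n e (\<lambda>_ _. c * 1) X z = c * branching_sum n e (\<lambda>_ _. 1) X z"
    by (rule branching_sum_scale)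
  finally show ?thesis by (simp only: branching_sum_one)
qed

lemma norm_pop_integrable:
  assumes e: "environment e"
  shows "integrable (tree_law e) (norm_pop n e)" "(\<integral>X. norm_pop n e X \<partial>tree_law e) = 1"
proof -
  have m: "norm_pop n e \<in> borel_measurable (tree_law e)"
    by (subst measurable_cong_sets[OF sets_tree_law[OF environmentD(1)[OF e]] refl]) measurable
  show "integrable (tree_law e) (norm_pop n e)"
    using nn_integral_norm_pop[OF e, of n] by (intro integrableI_nonneg m) (auto simp: norm_pop_nonneg)
  show "(\<integral>X. norm_pop n e X \<partial>tree_law e) = 1"
    using nn_integral_norm_pop[OF e, of n] m by (subst integral_eq_nn_integral) (auto simp: norm_pop_nonneg)
qed

lemma branching_half_line_measurable:
  assumes e: "environment e"
  shows "(\<lambda>X. branching_sum n e' (half_line c) X z) \<in> borel_measurable (tree_law e)"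
  by (subst measurable_cong_sets[OF sets_tree_law[OF environmentD(1)[OF e]] refl])
    (rule branching_sum_measurable1[OF half_line_measurable])

lemma branching_half_line_integrable:
  assumes e: "environment e"
  shows "integrable (tree_law e) (\<lambda>X. branching_sum n e (half_line c) X z)"
  by (rule Bochner_Integration.integrable_bound[OF norm_pop_integrable(1)[OF e, of n] branching_half_line_measurable[OF e]])
    (use abs_branching_half_line in \<open>auto intro!: AE_I2 simp: norm_pop_nonneg\<close>)

text \<open>Many-to-one for the indicator, together with mean one of \<open>norm_pop\<close> for the
  subtracted constant.\<close>

lemma integral_branching_half_line:
  assumes e: "environment e"
  shows "(\<integral>X. branching_sum n e (half_line c) X z \<partial>tree_law e) = measure (walk_law n e) {..z} - c"
proof -
  interpret T: prob_space "tree_law ((shift ^^ n) e)"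
    by (intro prob_space_tree_law environmentD environment_funpow_shift e)
  interpret W: prob_space "walk_law n e" by (rule prob_space_walk_law[OF e])
  let ?G = "\<lambda>X. branching_sum n e (\<lambda>_ z. indicator {0..} z) X z"
  have G0: "?G X \<ge> 0" for X by (rule branching_sum_nonneg) simp
  have Gm: "?G \<in> borel_measurable (tree_law e)"
    by (subst measurable_cong_sets[OF sets_tree_law[OF environmentD(1)[OF e]] refl])
      (rule branching_sum_measurable1[OF indicator_measurable_pair])
  have "(\<integral>\<^sup>+X. ennreal (?G X) \<partial>tree_law e) = (\<integral>\<^sup>+x. (\<integral>\<^sup>+X. ennreal (indicator {0..} (z - x)) \<partial>tree_law ((shift ^^ n) e)) \<partial>walk_law n e)"
    by (rule many_to_one[OF e indicator_measurable_pair]) simp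
  also have "\<dots> = (\<integral>\<^sup>+x. indicator {..z} x \<partial>walk_law n e)"
    by (intro nn_integral_cong) (auto simp: T.emeasure_space_1 indicator_def)
  also have "\<dots> = emeasure (walk_law n e) {..z}" by (rule nn_integral_indicator) simp
  finally have nn: "(\<integral>\<^sup>+X. ennreal (?G X) \<partial>tree_law e) = ennreal (measure (walk_law n e) {..z})"
    by (simp add: W.emeasure_eq_measure)
  have Gi: "integrable (tree_law e) ?G"
    using nn G0 by (intro integrableI_nonneg Gm) auto
  have "(\<integral>X. ?G X \<partial>tree_law e) = measure (walk_law n e) {..z}"
    using nn G0 Gm by (subst integral_eq_nn_integral) auto
  then show ?thesis
    using Gi norm_pop_integrable[OF e, of n] by (simp add: branching_half_line_eq)
qed

text \<open>At generation \<open>k\<close> the sum is truncated on \<open>norm_pop \<le> K\<close> and centred. The centred part is small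
  in \<open>L\<^sup>2\<close> once \<open>prod_mean e k\<close> is large, the truncated mass is controlled by uniform integrability
  and the means by the central limit theorem.\<close>

lemma fluctuation_bound:
  assumes e: "environment e" and ui: "unif_int j K ((shift ^^ k) e)" and a: "\<alpha> > 0"
  shows "(\<integral>\<^sup>+X. ennreal \<bar>branching_sum (k + i) e (half_line c) X y\<bar> \<partial>tree_law e)
    \<le> ennreal (\<alpha> + (2 * real (Suc K))\<^sup>2 / prod_mean e k / \<alpha>) + ennreal (2 / Suc j)
      + (\<integral>\<^sup>+w. ennreal \<bar>measure (walk_law i ((shift ^^ k) e)) {..y - w} - c\<bar> \<partial>walk_law k e)"
proof -
  let ?e = "(shift ^^ k) e" and ?K = "real (Suc K)"
  note e' = environment_funpow_shift[OF e, of k]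
  note e1 = environmentD(1)[OF e] and e1' = environmentD(1)[OF e']
  note sets_Q = sets_tree_law[OF e1']
  interpret Q: prob_space "tree_law ?e" by (rule prob_space_tree_law[OF e1'])
  interpret T: prob_space "tree_law e" by (rule prob_space_tree_law[OF e1])
  interpret W: prob_space "walk_law k e" by (rule prob_space_walk_law[OF e])
  define F where "F = branching_sum i ?e (half_line c)"
  define W where "W = norm_pop i ?e"
  define F1 where "F1 X z = (if W X \<le> ?K then F X z else 0)" for X z
  define F2 where "F2 X z = (if W X \<le> ?K then 0 else F X z)" for X z
  define c1 where "c1 z = (\<integral>X. F1 X z \<partial>tree_law ?e)" for z
  have FW: "\<bar>F X z\<bar> \<le> W X" for X z unfolding F_def W_def by (rule abs_branching_half_line)
  have W0: "0 \<le> W X" for X unfolding W_def by (rule norm_pop_nonneg)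
  have Wm: "W \<in> borel_measurable tree_space" unfolding W_def by (rule norm_pop_measurable)
  have Fm: "(\<lambda>x. F (fst x) (snd x)) \<in> borel_measurable (tree_space \<Otimes>\<^sub>M borel)"
    using branching_sum_measurable[OF half_line_measurable, of i ?e c] by (simp add: F_def case_prod_beta')
  have Wm': "(\<lambda>x. W (fst x)) \<in> borel_measurable (tree_space \<Otimes>\<^sub>M (borel :: real measure))"
    by (rule measurable_compose[OF measurable_fst Wm])
  have F1m: "(\<lambda>x. F1 (fst x) (snd x)) \<in> borel_measurable (tree_space \<Otimes>\<^sub>M borel)"
    unfolding F1_def using Fm Wm' by measurable
  have F2m: "(\<lambda>x. F2 (fst x) (snd x)) \<in> borel_measurable (tree_space \<Otimes>\<^sub>M borel)"
    unfolding F2_def using Fm Wm' by measurable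
  have F1b: "\<bar>F1 X z\<bar> \<le> ?K" for X z using FW[of X z] by (auto simp: F1_def)
  have F1z: "(\<lambda>X. F1 X z) \<in> borel_measurable (tree_law ?e)" for z
    using measurable_compose[OF measurable_Pair2'[of z borel tree_space] F1m]
    by (subst measurable_cong_sets[OF sets_Q refl]) simp
  have F2z: "(\<lambda>X. F2 X z) \<in> borel_measurable (tree_law ?e)" for z
    using measurable_compose[OF measurable_Pair2'[of z borel tree_space] F2m]
    by (subst measurable_cong_sets[OF sets_Q refl]) simp
  have F1i: "integrable (tree_law ?e) (\<lambda>X. F1 X z)" for z
    by (rule Q.integrable_const_bound[where B="?K"]) (use F1b F1z in auto)
  have F2i: "integrable (tree_law ?e) (\<lambda>X. F2 X z)" for z
    by (rule Bochner_Integration.integrable_bound[OF norm_pop_integrable(1)[OF e', of i] F2z])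
      (use FW W0 in \<open>auto intro!: AE_I2 simp: F2_def W_def[symmetric]\<close>)
  have c1m: "c1 \<in> borel_measurable borel"
  proof -
    have "(\<lambda>x. (snd x, fst x)) \<in> borel \<Otimes>\<^sub>M tree_law ?e \<rightarrow>\<^sub>M tree_space \<Otimes>\<^sub>M (borel :: real measure)"
      using measurable_compose[OF measurable_snd, of "\<lambda>x. x" "tree_law ?e" tree_space borel] sets_Q
      by (intro measurable_Pair) (auto intro: measurable_ident_sets)
    from measurable_compose[OF this F1m]
    have "(\<lambda>x. F1 (snd x) (fst x)) \<in> borel_measurable (borel \<Otimes>\<^sub>M tree_law ?e)" by simp
    then show ?thesis
      unfolding c1_def by (intro Q.borel_measurable_lebesgue_integral) (simp add: case_prod_beta')
  qed
  have c1abs: "(\<lambda>(X :: marks, z). \<bar>c1 z\<bar>) \<in> borel_measurable (tree_space \<Otimes>\<^sub>M borel)"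
    unfolding case_prod_beta' by (rule borel_measurable_abs[OF measurable_compose[OF measurable_snd c1m]])
  have F2abs: "(\<lambda>(X, z). \<bar>F2 X z\<bar>) \<in> borel_measurable (tree_space \<Otimes>\<^sub>M borel)"
    unfolding case_prod_beta' by (rule borel_measurable_abs[OF F2m])
  have c1b: "\<bar>c1 z\<bar> \<le> ?K" for z
  proof -
    have "\<bar>c1 z\<bar> \<le> (\<integral>X. \<bar>F1 X z\<bar> \<partial>tree_law ?e)" unfolding c1_def by (rule integral_abs_bound)
    also have "\<dots> \<le> (\<integral>X. ?K \<partial>tree_law ?e)" using F1i F1b by (intro integral_mono) auto
    finally show ?thesis by (simp add: Q.prob_space)
  qed
  have tail: "(\<integral>\<^sup>+X. ennreal \<bar>F2 X z\<bar> \<partial>tree_law ?e) \<le> ennreal (1 / Suc j)" for z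
  proof -
    have "(\<integral>\<^sup>+X. ennreal \<bar>F2 X z\<bar> \<partial>tree_law ?e) \<le> (\<integral>\<^sup>+X. ennreal (W X * min 1 (1 / ?K * W X)) \<partial>tree_law ?e)"
    proof (intro nn_integral_mono ennreal_leI)
      fix X
      show "\<bar>F2 X z\<bar> \<le> W X * min 1 (1 / ?K * W X)"
      proof (cases "W X \<le> ?K")
        case True
        then show ?thesis using W0[of X] by (simp add: F2_def)
      next
        case False
        then have "min 1 (1 / ?K * W X) = 1" by (simp add: field_simps)
        then show ?thesis using False FW[of X z] by (simp add: F2_def)
      qed
    qed
    also have "\<dots> \<le> ennreal (1 / Suc j)" using ui unfolding unif_int_def W_def by blast
    finally show ?thesis .
  qed
  \<comment> \<open>The truncated mean differs from the full mean, a centred walk probability, by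
    the mean of the discarded part \<open>F2\<close>.\<close>
  have c1_le: "\<bar>c1 z\<bar> \<le> \<bar>measure (walk_law i ?e) {..z} - c\<bar> + 1 / Suc j" for z
  proof -
    have "F X z = F1 X z + F2 X z" for X by (simp add: F1_def F2_def)
    then have "(\<integral>X. F X z \<partial>tree_law ?e) = c1 z + (\<integral>X. F2 X z \<partial>tree_law ?e)"
      unfolding c1_def using F1i F2i by simp
    moreover have "(\<integral>X. F X z \<partial>tree_law ?e) = measure (walk_law i ?e) {..z} - c"
      unfolding F_def by (rule integral_branching_half_line[OF e'])
    moreover have "\<bar>\<integral>X. F2 X z \<partial>tree_law ?e\<bar> \<le> 1 / Suc j"
    proof -
      have "\<bar>\<integral>X. F2 X z \<partial>tree_law ?e\<bar> \<le> (\<integral>X. \<bar>F2 X z\<bar> \<partial>tree_law ?e)" by (rule integral_abs_bound)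
      also have "ennreal (\<integral>X. \<bar>F2 X z\<bar> \<partial>tree_law ?e) \<le> ennreal (1 / Suc j)"
        using tail[of z] F2i[of z] by (subst nn_integral_eq_integral[symmetric]) auto
      then have "(\<integral>X. \<bar>F2 X z\<bar> \<partial>tree_law ?e) \<le> 1 / Suc j" by (subst (asm) ennreal_le_iff) auto
      finally show ?thesis .
    qed
    ultimately show ?thesis by linarith
  qed
  let ?D = "\<lambda>X z. F1 X z - c1 z"
  let ?S = "\<lambda>G X. branching_sum k e G X y"
  have Dm: "(\<lambda>(X, z). ?D X z) \<in> borel_measurable (tree_space \<Otimes>\<^sub>M borel)"
    unfolding case_prod_beta' by (rule borel_measurable_diff[OF F1m measurable_compose[OF measurable_snd c1m]])
  have Db: "\<bar>?D X z\<bar> \<le> 2 * ?K" for X z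
    using order_trans[OF abs_triangle_ineq4 add_mono[OF F1b c1b]] by (simp only: mult_2)
  have D0: "(\<integral>X. ?D X z \<partial>tree_law ?e) = 0" for z
    using F1i by (simp add: c1_def Q.prob_space)
  have second: "(\<integral>\<^sup>+X. ennreal ((?S ?D X)\<^sup>2) \<partial>tree_law e) \<le> ennreal ((2 * ?K)\<^sup>2 / prod_mean e k)"
    using branching_sum_second_moment[OF e Dm Db D0] by blast
  have SDm: "?S ?D \<in> borel_measurable (tree_law e)"
    by (subst measurable_cong_sets[OF sets_tree_law[OF e1] refl]) (rule branching_sum_measurable1[OF Dm])
  have part1: "(\<integral>\<^sup>+X. ennreal \<bar>?S ?D X\<bar> \<partial>tree_law e) \<le> ennreal (\<alpha> + (2 * ?K)\<^sup>2 / prod_mean e k / \<alpha>)"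
  proof -
    \<comment> \<open>This elementary inequality passes from the second moment to the first with a
      free parameter \<alpha>, which is later fixed before \<open>k\<close>.\<close>
    have am: "\<bar>x\<bar> \<le> \<alpha> + x\<^sup>2 * (1 / \<alpha>)" for x :: real
    proof (cases "\<bar>x\<bar> \<le> \<alpha>")
      case True
      moreover have "0 \<le> x\<^sup>2 * (1 / \<alpha>)" using a by simp
      ultimately show ?thesis by linarith
    next
      case False
      then have "\<bar>x\<bar> * \<alpha> \<le> \<bar>x\<bar> * \<bar>x\<bar>" by (intro mult_left_mono) auto
      then have "\<bar>x\<bar> \<le> x\<^sup>2 * (1 / \<alpha>)" using a by (simp add: field_simps power2_eq_square)
      then show ?thesis using a by linarith
    qed
    have "(\<integral>\<^sup>+X. ennreal \<bar>?S ?D X\<bar> \<partial>tree_law e) \<le> (\<integral>\<^sup>+X. ennreal \<alpha> + ennreal ((?S ?D X)\<^sup>2) * ennreal (1 / \<alpha>) \<partial>tree_law e)"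
    proof (intro nn_integral_mono)
      fix X
      have "ennreal \<bar>?S ?D X\<bar> \<le> ennreal (\<alpha> + (?S ?D X)\<^sup>2 * (1 / \<alpha>))" by (intro ennreal_leI am)
      also have "\<dots> = ennreal \<alpha> + ennreal ((?S ?D X)\<^sup>2) * ennreal (1 / \<alpha>)"
      proof -
        have nn: "0 \<le> 1 / \<alpha>" using a by simp
        have "ennreal (\<alpha> + (?S ?D X)\<^sup>2 * (1 / \<alpha>)) = ennreal \<alpha> + ennreal ((?S ?D X)\<^sup>2 * (1 / \<alpha>))"
          using a by (intro ennreal_plus mult_nonneg_nonneg nn) auto
        then show ?thesis by (simp only: ennreal_mult[OF zero_le_power2 nn])
      qed
      finally show "ennreal \<bar>?S ?D X\<bar> \<le> ennreal \<alpha> + ennreal ((?S ?D X)\<^sup>2) * ennreal (1 / \<alpha>)" .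
    qed
    also have "\<dots> = ennreal \<alpha> + (\<integral>\<^sup>+X. ennreal ((?S ?D X)\<^sup>2) \<partial>tree_law e) * ennreal (1 / \<alpha>)"
      using SDm by (subst nn_integral_add) (auto simp: T.emeasure_space_1 nn_integral_multc)
    also have "\<dots> \<le> ennreal \<alpha> + ennreal ((2 * ?K)\<^sup>2 / prod_mean e k) * ennreal (1 / \<alpha>)"
      by (intro add_left_mono mult_right_mono second) simp
    also have "\<dots> = ennreal (\<alpha> + (2 * ?K)\<^sup>2 / prod_mean e k * (1 / \<alpha>))"
      using a prod_mean_pos[OF e, of k]
      by (subst ennreal_mult[symmetric]) (auto simp flip: ennreal_plus)
    finally show ?thesis by simp
  qed
  have part2: "(\<integral>\<^sup>+X. ennreal (?S (\<lambda>X z. \<bar>c1 z\<bar>) X) \<partial>tree_law e)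
    \<le> (\<integral>\<^sup>+w. ennreal \<bar>measure (walk_law i ?e) {..y - w} - c\<bar> \<partial>walk_law k e) + ennreal (1 / Suc j)"
  proof -
    have "(\<integral>\<^sup>+X. ennreal (?S (\<lambda>X z. \<bar>c1 z\<bar>) X) \<partial>tree_law e)
      = (\<integral>\<^sup>+w. (\<integral>\<^sup>+X. ennreal \<bar>c1 (y - w)\<bar> \<partial>tree_law ?e) \<partial>walk_law k e)"
      by (rule many_to_one[OF e c1abs]) simp
    also have "\<dots> \<le> (\<integral>\<^sup>+w. ennreal \<bar>measure (walk_law i ?e) {..y - w} - c\<bar> + ennreal (1 / Suc j) \<partial>walk_law k e)"
    proof (intro nn_integral_mono)
      fix w
      have "(\<integral>\<^sup>+X. ennreal \<bar>c1 (y - w)\<bar> \<partial>tree_law ?e) = ennreal \<bar>c1 (y - w)\<bar>" by (simp add: Q.emeasure_space_1)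
      also have "\<dots> \<le> ennreal (\<bar>measure (walk_law i ?e) {..y - w} - c\<bar> + 1 / Suc j)" by (intro ennreal_leI c1_le)
      also have "\<dots> = ennreal \<bar>measure (walk_law i ?e) {..y - w} - c\<bar> + ennreal (1 / Suc j)" by (rule ennreal_plus) auto
      finally show "(\<integral>\<^sup>+X. ennreal \<bar>c1 (y - w)\<bar> \<partial>tree_law ?e) \<le> ennreal \<bar>measure (walk_law i ?e) {..y - w} - c\<bar> + ennreal (1 / Suc j)" .
    qed
    also have "\<dots> = (\<integral>\<^sup>+w. ennreal \<bar>measure (walk_law i ?e) {..y - w} - c\<bar> \<partial>walk_law k e) + ennreal (1 / Suc j)"
    proof (subst nn_integral_add)
      interpret Wi: real_distribution "walk_law i ?e"
        using prob_space_walk_law[OF e'] by (simp add: real_distribution_def real_distribution_axioms_def)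
      have "mono (\<lambda>z. measure (walk_law i ?e) {..z})"
        by (intro monoI Wi.finite_measure_mono) auto
      then have "(\<lambda>z. measure (walk_law i ?e) {..z}) \<in> borel_measurable borel" by (rule borel_measurable_mono)
      then have "(\<lambda>w. measure (walk_law i ?e) {..y - w}) \<in> borel_measurable borel"
        by (rule measurable_compose[rotated]) simp
      then show "(\<lambda>w. ennreal \<bar>measure (walk_law i ?e) {..y - w} - c\<bar>) \<in> borel_measurable (walk_law k e)" by simp
    qed (auto simp: W.emeasure_space_1[simplified])
    finally show ?thesis .
  qed
  have part3: "(\<integral>\<^sup>+X. ennreal (?S (\<lambda>X z. \<bar>F2 X z\<bar>) X) \<partial>tree_law e) \<le> ennreal (1 / Suc j)"
  proof -
    have "(\<integral>\<^sup>+X. ennreal (?S (\<lambda>X z. \<bar>F2 X z\<bar>) X) \<partial>tree_law e)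
      = (\<integral>\<^sup>+w. (\<integral>\<^sup>+X. ennreal \<bar>F2 X (y - w)\<bar> \<partial>tree_law ?e) \<partial>walk_law k e)"
      by (rule many_to_one[OF e F2abs]) simp
    also have "\<dots> \<le> (\<integral>\<^sup>+w. ennreal (1 / Suc j) \<partial>walk_law k e)" by (intro nn_integral_mono tail)
    also have "\<dots> = ennreal (1 / Suc j)" by (simp add: W.emeasure_space_1[simplified])
    finally show ?thesis .
  qed
  have split: "\<bar>branching_sum (k + i) e (half_line c) X y\<bar> \<le> \<bar>?S ?D X\<bar> + ?S (\<lambda>X z. \<bar>c1 z\<bar>) X + ?S (\<lambda>X z. \<bar>F2 X z\<bar>) X" for X
  proof -
    \<comment> \<open>Three pieces: the truncated and centred part, small in second moment; its
      centring, controlled by the walk; and the discarded part, controlled by uniform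
      integrability.\<close>
    have "F = (\<lambda>X z. ?D X z + (c1 z + F2 X z))" by (auto simp: fun_eq_iff F1_def F2_def)
    then have "branching_sum (k + i) e (half_line c) X y = ?S (\<lambda>X z. ?D X z + (c1 z + F2 X z)) X"
      by (simp only: branching_sum_funpow F_def[symmetric])
    also have "\<dots> = ?S ?D X + ?S (\<lambda>X z. c1 z + F2 X z) X" by (rule branching_sum_add)
    also have "?S (\<lambda>X z. c1 z + F2 X z) X = ?S (\<lambda>X z. c1 z) X + ?S F2 X" by (rule branching_sum_add)
    finally show ?thesis
      using abs_branching_sum_le[of k e "\<lambda>X z. c1 z" X y] abs_branching_sum_le[of k e F2 X y] by linarith
  qed
  have Sc1m: "?S (\<lambda>X z. \<bar>c1 z\<bar>) \<in> borel_measurable (tree_law e)"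
    by (subst measurable_cong_sets[OF sets_tree_law[OF e1] refl]) (rule branching_sum_measurable1[OF c1abs])
  have SF2m: "?S (\<lambda>X z. \<bar>F2 X z\<bar>) \<in> borel_measurable (tree_law e)"
    by (subst measurable_cong_sets[OF sets_tree_law[OF e1] refl]) (rule branching_sum_measurable1[OF F2abs])
  have nn1: "0 \<le> ?S (\<lambda>X z. \<bar>c1 z\<bar>) X" and nn2: "0 \<le> ?S (\<lambda>X z. \<bar>F2 X z\<bar>) X" for X
    by (auto intro!: branching_sum_nonneg)
  have "(\<integral>\<^sup>+X. ennreal \<bar>branching_sum (k + i) e (half_line c) X y\<bar> \<partial>tree_law e)
    \<le> (\<integral>\<^sup>+X. ennreal \<bar>?S ?D X\<bar> + (ennreal (?S (\<lambda>X z. \<bar>c1 z\<bar>) X) + ennreal (?S (\<lambda>X z. \<bar>F2 X z\<bar>) X)) \<partial>tree_law e)"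
  proof (intro nn_integral_mono)
    fix X
    have "ennreal \<bar>branching_sum (k + i) e (half_line c) X y\<bar>
      \<le> ennreal (\<bar>?S ?D X\<bar> + (?S (\<lambda>X z. \<bar>c1 z\<bar>) X + ?S (\<lambda>X z. \<bar>F2 X z\<bar>) X))"
      using split[of X] by (intro ennreal_leI) linarith
    also have "\<dots> = ennreal \<bar>?S ?D X\<bar> + ennreal (?S (\<lambda>X z. \<bar>c1 z\<bar>) X + ?S (\<lambda>X z. \<bar>F2 X z\<bar>) X)"
      by (intro ennreal_plus abs_ge_zero add_nonneg_nonneg nn1 nn2)
    also have "ennreal (?S (\<lambda>X z. \<bar>c1 z\<bar>) X + ?S (\<lambda>X z. \<bar>F2 X z\<bar>) X) = ennreal (?S (\<lambda>X z. \<bar>c1 z\<bar>) X) + ennreal (?S (\<lambda>X z. \<bar>F2 X z\<bar>) X)"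
      by (intro ennreal_plus nn1 nn2)
    finally show "ennreal \<bar>branching_sum (k + i) e (half_line c) X y\<bar>
      \<le> ennreal \<bar>?S ?D X\<bar> + (ennreal (?S (\<lambda>X z. \<bar>c1 z\<bar>) X) + ennreal (?S (\<lambda>X z. \<bar>F2 X z\<bar>) X))" .
  qed
  also have "\<dots> = (\<integral>\<^sup>+X. ennreal \<bar>?S ?D X\<bar> \<partial>tree_law e)
      + ((\<integral>\<^sup>+X. ennreal (?S (\<lambda>X z. \<bar>c1 z\<bar>) X) \<partial>tree_law e) + (\<integral>\<^sup>+X. ennreal (?S (\<lambda>X z. \<bar>F2 X z\<bar>) X) \<partial>tree_law e))"
    using SDm Sc1m SF2m by (simp add: nn_integral_add)
  also have "\<dots> \<le> ennreal (\<alpha> + (2 * ?K)\<^sup>2 / prod_mean e k / \<alpha>)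
      + (((\<integral>\<^sup>+w. ennreal \<bar>measure (walk_law i ?e) {..y - w} - c\<bar> \<partial>walk_law k e) + ennreal (1 / Suc j)) + ennreal (1 / Suc j))"
    by (intro add_mono part1 part2 part3)
  finally have fin: "(\<integral>\<^sup>+X. ennreal \<bar>branching_sum (k + i) e (half_line c) X y\<bar> \<partial>tree_law e)
    \<le> ennreal (\<alpha> + (2 * ?K)\<^sup>2 / prod_mean e k / \<alpha>)
      + (((\<integral>\<^sup>+w. ennreal \<bar>measure (walk_law i ?e) {..y - w} - c\<bar> \<partial>walk_law k e) + ennreal (1 / Suc j)) + ennreal (1 / Suc j))" .
  \<comment> \<open>The tail mass is paid twice, once for \<open>F2\<close> itself and once inside
    the bound for \<open>c1\<close>.\<close>
  have two: "ennreal (2 / Suc j) = ennreal (1 / Suc j) + ennreal (1 / Suc j)"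
    by (subst ennreal_plus[symmetric]) auto
  show ?thesis unfolding two using fin by (simp only: add.assoc add.commute add.left_commute)
qed

end

section \<open>Convergence in mean of the branching sums\<close>

definition barrier :: "(nat \<Rightarrow> mark measure) \<Rightarrow> real \<Rightarrow> nat \<Rightarrow> real" where
  "barrier e x n = sqrt (\<Sum>j<n. enn2real (disp_var (e j))) * x + (\<Sum>j<n. disp_mean (e j))"

lemma sum_shift_split:
  "(\<Sum>j<k + i. f (e j)) = (\<Sum>j<k. f (e j)) + (\<Sum>j<i. f ((shift ^^ k) e j))" for f :: "'a \<Rightarrow> real"
proof -
  have "(shift ^^ k) e j = e (k + j)" for j
    by (induction k arbitrary: e) (simp_all add: funpow_swap1, simp add: shift_def)
  then show ?thesis by (induction i) auto
qed

text \<open>For fixed \<open>k\<close> the first \<open>k\<close> means and variances and the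
  displacement \<open>w\<close> are negligible against the standard deviation of the remaining walk,
  so the standardised barrier still tends to \<open>x\<close>.\<close>

lemma clt_shifted_barrier:
  assumes e: "environment ((shift ^^ k) e)" and clt: "clt_data ((shift ^^ k) e)"
  shows "(\<lambda>i. measure (walk_law i ((shift ^^ k) e)) {..barrier e x (k + i) - w}) \<longlonglongrightarrow> cdf std_normal_distribution x"
proof -
  let ?e = "(shift ^^ k) e"
  obtain V \<psi> where fin: "\<And>n. disp_var (?e n) < \<infinity>" and V: "V > 0" "(\<lambda>n. (\<Sum>j<n. enn2real (disp_var (?e j))) / n) \<longlonglongrightarrow> V"
    and \<psi>: "\<And>k. (\<lambda>n. (\<Sum>j<n. truncated_third_moment k (?e j)) / n) \<longlonglongrightarrow> \<psi> k" "\<psi> \<longlonglongrightarrow> (0 :: real)"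
    using clt unfolding clt_data_def by blast
  define B where "B i = (\<Sum>j<i. enn2real (disp_var (?e j)))" for i
  define b where "b = (\<Sum>j<k. enn2real (disp_var (e j)))"
  define a where "a = (\<Sum>j<k. disp_mean (e j))"
  have "filterlim (\<lambda>i. B i / real i * real i) at_top sequentially"
    using V by (intro filterlim_tendsto_pos_mult_at_top[of _ V] filterlim_real_sequentially) (auto simp: B_def)
  moreover have "eventually (\<lambda>i. B i / real i * real i = B i) sequentially"
    using eventually_gt_at_top[of 0] by eventually_elim auto
  ultimately have B_top: "filterlim B at_top sequentially"
    by (rule filterlim_cong[OF refl refl, THEN iffD1, rotated])
  have s_top: "filterlim (\<lambda>i. sqrt (B i)) at_top sequentially"
    by (rule filterlim_compose[OF sqrt_at_top B_top])
  have 1: "(\<lambda>i. b / B i) \<longlonglongrightarrow> 0"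
    by (rule real_tendsto_divide_at_top[OF tendsto_const B_top])
  have 2: "(\<lambda>i. (a - w) / sqrt (B i)) \<longlonglongrightarrow> 0"
    by (rule real_tendsto_divide_at_top[OF tendsto_const s_top])
  have "(\<lambda>i. sqrt (b / B i + 1) * x + (a - w) / sqrt (B i)) \<longlonglongrightarrow> sqrt (0 + 1) * x + 0"
    by (intro tendsto_intros 1 2)
  moreover have "eventually (\<lambda>i. sqrt (b / B i + 1) * x + (a - w) / sqrt (B i)
      = ((barrier e x (k + i) - w) - (\<Sum>j<i. disp_mean (?e j))) / sqrt (\<Sum>j<i. enn2real (disp_var (?e j)))) sequentially"
    using filterlim_at_top_dense[THEN iffD1, OF B_top, rule_format, of 0]
  proof eventually_elim
    case (elim i)
    have "sqrt (b + B i) / sqrt (B i) = sqrt (b / B i + 1)"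
      using elim by (simp add: real_sqrt_divide[symmetric] add_divide_distrib)
    moreover have "barrier e x (k + i) = sqrt (b + B i) * x + (a + (\<Sum>j<i. disp_mean (?e j)))"
      unfolding barrier_def sum_shift_split a_def b_def B_def
        sum_shift_split[of "\<lambda>\<kappa>. enn2real (disp_var \<kappa>)"] ..
    ultimately show ?case
      by (simp add: B_def[symmetric] diff_divide_distrib add_divide_distrib) (metis times_divide_eq_left)
  qed
  ultimately have "(\<lambda>i. ((barrier e x (k + i) - w) - (\<Sum>j<i. disp_mean (?e j))) / sqrt (\<Sum>j<i. enn2real (disp_var (?e j))))
      \<longlonglongrightarrow> sqrt (0 + 1) * x + 0"
    by (rule Lim_transform_eventually)
  then show ?thesis
    by (intro walk_clt[OF e fin V(2,1) \<psi>]) simp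
qed

lemma cdf_std_normal_bounds: "0 \<le> cdf std_normal_distribution x" "cdf std_normal_distribution x \<le> 1"
proof -
  interpret real_distribution std_normal_distribution by (rule real_dist_normal_dist)
  show "0 \<le> cdf std_normal_distribution x" by (rule cdf_nonneg)
  show "cdf std_normal_distribution x \<le> 1" by (rule cdf_bounded_prob)
qed

text \<open>The choices are made in the order \<open>j\<close>, \<open>K\<close>, \<open>k\<close>,
  and finally \<open>n\<close>. \<open>K\<close> depends only on \<open>j\<close>; recurrence then
  supplies a \<open>k\<close> that is both good for \<open>K\<close> and so late that
  \<open>prod_mean e k\<close> outweighs the square of \<open>K\<close>.\<close>

theorem regular_fluctuation:
  fixes x :: real
  defines "c \<equiv> cdf std_normal_distribution x"
  assumes reg: "regular e"
  shows "(\<lambda>n. \<integral>X. \<bar>branching_sum n e (half_line c) X (barrier e x n)\<bar> \<partial>tree_law e) \<longlonglongrightarrow> 0"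
proof -
  have c: "0 \<le> c" "c \<le> 1" unfolding c_def by (rule cdf_std_normal_bounds)+
  have e: "environment e" using reg by (simp add: regular_def)
  define I where "I n = (\<integral>X. \<bar>branching_sum n e (half_line c) X (barrier e x n)\<bar> \<partial>tree_law e)" for n
  have I0: "I n \<ge> 0" for n unfolding I_def by (intro Bochner_Integration.integral_nonneg) simp
  have I_nn: "ennreal (I n) = (\<integral>\<^sup>+X. ennreal \<bar>branching_sum n e (half_line c) X (barrier e x n)\<bar> \<partial>tree_law e)" for n
    unfolding I_def using branching_half_line_integrable[OF c e, of n "barrier e x n"]
    by (intro nn_integral_eq_integral[symmetric]) auto
  have "I \<longlonglongrightarrow> 0"
  proof (rule LIMSEQ_I)
    fix \<epsilon> :: real assume \<epsilon>: "\<epsilon> > 0"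
    \<comment> \<open>The contributions below add up to less than
      \<open>5 * \<alpha>\<close>.\<close>
    define \<alpha> where "\<alpha> = \<epsilon> / 8"
    have \<alpha>: "\<alpha> > 0" using \<epsilon> by (simp add: \<alpha>_def)
    obtain j where j: "1 / Suc j < \<alpha>" using \<alpha> nat_approx_posE by blast
    obtain K where K: "\<And>n. \<exists>k\<ge>n. unif_int j K ((shift ^^ k) e)" using reg unfolding regular_def by blast
    let ?K = "(2 * real (Suc K))\<^sup>2"
    \<comment> \<open>This size makes the variance term \<open>?K / prod_mean e k / \<alpha>\<close>
      at most \<alpha>.\<close>
    have "eventually (\<lambda>n. prod_mean e n \<ge> ?K / (\<alpha> * \<alpha>)) sequentially"
      using reg unfolding regular_def filterlim_at_top by blast
    then obtain n0 where n0: "\<And>n. n \<ge> n0 \<Longrightarrow> prod_mean e n \<ge> ?K / (\<alpha> * \<alpha>)"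
      by (auto simp: eventually_sequentially)
    obtain k where k: "k \<ge> n0" "unif_int j K ((shift ^^ k) e)" using K by blast
    have p: "prod_mean e k > 0" by (rule prod_mean_pos[OF e])
    have Kp: "?K / prod_mean e k / \<alpha> \<le> \<alpha>"
    proof -
      have "?K \<le> prod_mean e k * (\<alpha> * \<alpha>)" using n0[OF k(1)] \<alpha> by (subst (asm) divide_le_eq) auto
      then show ?thesis using \<alpha> p by (simp add: divide_le_eq ac_simps)
    qed
    let ?e = "(shift ^^ k) e"
    have e': "environment ?e" by (rule environment_funpow_shift[OF e])
    have clt: "clt_data ?e" using reg by (simp add: regular_def)
    interpret W: prob_space "walk_law k e" by (rule prob_space_walk_law[OF e])
    define J where "J i = (\<integral>w. \<bar>measure (walk_law i ?e) {..barrier e x (k + i) - w} - c\<bar> \<partial>walk_law k e)" for i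
    have Wi: "real_distribution (walk_law i ?e)" for i
      using prob_space_walk_law[OF e'] by (simp add: real_distribution_def real_distribution_axioms_def)
    have m: "(\<lambda>w. measure (walk_law i ?e) {..barrier e x (k + i) - w}) \<in> borel_measurable (walk_law k e)" for i
    proof -
      interpret Wi: real_distribution "walk_law i ?e" by (rule Wi)
      have "mono (\<lambda>z. measure (walk_law i ?e) {..z})" by (intro monoI Wi.finite_measure_mono) auto
      then have "(\<lambda>z. measure (walk_law i ?e) {..z}) \<in> borel_measurable borel" by (rule borel_measurable_mono)
      then have "(\<lambda>w. measure (walk_law i ?e) {..barrier e x (k + i) - w}) \<in> borel_measurable borel"
        by (rule measurable_compose[rotated]) simp
      then show ?thesis by simp
    qed
    have b: "\<bar>measure (walk_law i ?e) {..z} - c\<bar> \<le> 1" for i z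
    proof -
      interpret Wi: real_distribution "walk_law i ?e" by (rule Wi)
      have "0 \<le> measure (walk_law i ?e) {..z}" "measure (walk_law i ?e) {..z} \<le> 1" by auto
      then show ?thesis using c by linarith
    qed
    \<comment> \<open>With \<open>k\<close> fixed, the position \<open>w\<close> in generation
      \<open>k\<close> is integrated out by dominated convergence while the remaining number
      \<open>i\<close> of generations grows.\<close>
    have "J \<longlonglongrightarrow> (\<integral>w. 0 \<partial>walk_law k e)"
      unfolding J_def
    proof (rule integral_dominated_convergence[where w="\<lambda>_. 1"])
      show "AE w in walk_law k e. (\<lambda>i. \<bar>measure (walk_law i ?e) {..barrier e x (k + i) - w} - c\<bar>) \<longlonglongrightarrow> 0"
      proof (rule AE_I2)
        fix w
        have "(\<lambda>i. \<bar>measure (walk_law i ?e) {..barrier e x (k + i) - w} - c\<bar>) \<longlonglongrightarrow> \<bar>c - c\<bar>"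
          by (intro tendsto_intros clt_shifted_barrier[OF e' clt, of x w, folded c_def])
        then show "(\<lambda>i. \<bar>measure (walk_law i ?e) {..barrier e x (k + i) - w} - c\<bar>) \<longlonglongrightarrow> 0" by simp
      qed
    qed (use m b in auto)
    then have "eventually (\<lambda>i. J i < \<alpha>) sequentially"
      using \<alpha> by (intro order_tendstoD) auto
    then obtain i0 where i0: "\<And>i. i \<ge> i0 \<Longrightarrow> J i < \<alpha>" by (auto simp: eventually_sequentially)
    have "I n < \<epsilon>" if n: "n \<ge> k + i0" for n
    proof -
      obtain i where i: "n = k + i" "i \<ge> i0" using n by (metis add_le_cancel_left le_Suc_ex le_add1 order_trans)
      have int: "integrable (walk_law k e) (\<lambda>w. \<bar>measure (walk_law i ?e) {..barrier e x (k + i) - w} - c\<bar>)"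
        by (rule W.integrable_const_bound[where B=1]) (use m b in auto)
      have J_nn: "(\<integral>\<^sup>+w. ennreal \<bar>measure (walk_law i ?e) {..barrier e x n - w} - c\<bar> \<partial>walk_law k e) = ennreal (J i)"
        unfolding J_def i(1) by (rule nn_integral_eq_integral[OF int]) simp
      have J0: "J i \<ge> 0" unfolding J_def by (intro Bochner_Integration.integral_nonneg) simp
      have "ennreal (I n) \<le> ennreal (\<alpha> + ?K / prod_mean e k / \<alpha>) + ennreal (2 / Suc j) + ennreal (J i)"
        using fluctuation_bound[OF c e k(2) \<alpha>, of i "barrier e x n"] unfolding I_nn J_nn i(1)[symmetric] .
      also have "\<dots> = ennreal (\<alpha> + ?K / prod_mean e k / \<alpha> + 2 / Suc j + J i)"
        using \<alpha> p J0 by (simp flip: ennreal_plus)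
      finally have "I n \<le> \<alpha> + ?K / prod_mean e k / \<alpha> + 2 / Suc j + J i"
        using \<alpha> p J0 by (subst (asm) ennreal_le_iff) auto
      moreover have "2 / real (Suc j) < 2 * \<alpha>" using j by simp
      ultimately have "I n < \<alpha> + \<alpha> + 2 * \<alpha> + \<alpha>" using Kp i0[OF i(2)] by linarith
      then show ?thesis using \<epsilon> by (simp add: \<alpha>_def)
    qed
    then show "\<exists>no. \<forall>n\<ge>no. norm (I n - 0) < \<epsilon>" using I0 by (intro exI[of _ "k + i0"]) auto
  qed
  then show ?thesis unfolding I_def .
qed

section \<open>Division by the population on survival\<close>

definition ratio :: "nat \<Rightarrow> (nat \<Rightarrow> mark measure) \<Rightarrow> marks \<Rightarrow> real \<Rightarrow> real" where
  "ratio n e X y = branching_sum n e (\<lambda>_ z. indicator {0..} z) X y / norm_pop n e X"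

lemma ratio_bounds: "0 \<le> ratio n e X y" "ratio n e X y \<le> 1"
proof -
  have "branching_sum n e (\<lambda>_ z. indicator {0..} z) X y \<le> branching_sum n e (\<lambda>_ _. 1) X y"
    by (rule branching_sum_mono) simp
  then have "branching_sum n e (\<lambda>_ z. indicator {0..} z) X y \<le> norm_pop n e X"
    by (simp only: branching_sum_one)
  moreover have "0 \<le> branching_sum n e (\<lambda>_ z. indicator {0..} z) X y"
    by (rule branching_sum_nonneg) simp
  ultimately show "0 \<le> ratio n e X y" "ratio n e X y \<le> 1"
    unfolding ratio_def using norm_pop_nonneg[of n e X] by (auto simp: divide_le_eq)
qed

lemma ratio_measurable: "(\<lambda>X. ratio n e X y) \<in> borel_measurable tree_space"
  unfolding ratio_def
  by (intro borel_measurable_divide branching_sum_measurable1[OF indicator_measurable_pair] norm_pop_measurable)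

text \<open>Where the normalised population exceeds \<open>1 / l\<close>, dividing by it costs at
  most a factor \<open>l\<close>. The event that it is positive but at most \<open>1 / l\<close> has
  probability bounded by a difference of transforms, which tends to
  \<open>exp 1 * (null_prob e - extinct_prob e) = 0\<close> as first \<open>n\<close> and then
  \<open>l\<close> grows.\<close>

lemma regular_ratio:
  fixes x :: real
  defines "c \<equiv> cdf std_normal_distribution x"
  assumes reg: "regular e"
  shows "(\<lambda>n. \<integral>X. (if norm_pop n e X = 0 then 0 else \<bar>ratio n e X (barrier e x n) - c\<bar>) \<partial>tree_law e) \<longlonglongrightarrow> 0"
proof -
  have c: "0 \<le> c" "c \<le> 1" unfolding c_def by (rule cdf_std_normal_bounds)+
  have e: "environment e" using reg by (simp add: regular_def)
  note e1 = environmentD(1)[OF e]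
  note sets_T = sets_tree_law[OF e1]
  interpret T: prob_space "tree_law e" by (rule prob_space_tree_law[OF e1])
  define F where "F n X = \<bar>branching_sum n e (half_line c) X (barrier e x n)\<bar>" for n X
  let ?R = "\<lambda>n X. if norm_pop n e X = 0 then 0 else \<bar>ratio n e X (barrier e x n) - c\<bar>"
  let ?A = "\<lambda>n l. {X. 0 < norm_pop n e X \<and> norm_pop n e X \<le> 1 / l}"
  have Rm: "?R n \<in> borel_measurable (tree_law e)" for n
  proof (subst measurable_cong_sets[OF sets_T refl])
    have "(\<lambda>X. \<bar>ratio n e X (barrier e x n) - c\<bar>) \<in> borel_measurable tree_space"
      using ratio_measurable[of n e "barrier e x n"] by measurable
    then show "?R n \<in> borel_measurable tree_space" using norm_pop_measurable[of n e] by measurable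
  qed
  have R1: "0 \<le> ?R n X" "?R n X \<le> 1" for n X
    using ratio_bounds[of n e X "barrier e x n"] c by auto
  have Ri: "integrable (tree_law e) (?R n)" for n
  proof (rule T.integrable_const_bound[OF _ Rm, where B=1])
    show "AE X in tree_law e. norm (?R n X) \<le> 1" using R1 by (intro AE_I2) (simp only: real_norm_def abs_of_nonneg)
  qed
  have Fi: "integrable (tree_law e) (F n)" for n
    unfolding F_def using branching_half_line_integrable[OF c e, of n "barrier e x n"] by simp
  have Am: "?A n l \<in> sets (tree_law e)" for n l
  proof -
    have "{X \<in> space tree_space. 0 < norm_pop n e X \<and> norm_pop n e X \<le> 1 / l} \<in> sets tree_space" by measurable
    then show ?thesis by (simp add: sets_T)
  qed
  have bound: "(\<integral>X. ?R n X \<partial>tree_law e) \<le> l * (\<integral>X. F n X \<partial>tree_law e) + exp 1 * (laplace n e l - extinct n e)"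
    if l: "l > 0" for n l
  proof -
    have Ai: "integrable (tree_law e) (indicator (?A n l) :: _ \<Rightarrow> real)" using Am[of n l] by (simp add: T.emeasure_eq_measure)
    have "(\<integral>X. ?R n X \<partial>tree_law e) \<le> (\<integral>X. l * F n X + indicator (?A n l) X \<partial>tree_law e)"
    proof (rule integral_mono[OF Ri])
      show "integrable (tree_law e) (\<lambda>X. l * F n X + indicator (?A n l) X)" using Fi Ai by simp
      fix X
      have F0: "0 \<le> l * F n X" using l by (simp add: F_def)
      show "?R n X \<le> l * F n X + indicator (?A n l) X"
      proof (cases "norm_pop n e X \<le> 1 / l")
        case True
        then show ?thesis
          using R1(2)[of n X] F0 norm_pop_nonneg[of n e X] by (cases "norm_pop n e X = 0") (auto simp: indicator_def)
      next
        case False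
        then have W: "norm_pop n e X > 1 / l" by simp
        moreover have "1 / l > 0" using l by simp
        ultimately have W0: "norm_pop n e X > 0" by linarith
        have "ratio n e X (barrier e x n) - c = branching_sum n e (half_line c) X (barrier e x n) / norm_pop n e X"
          unfolding ratio_def branching_half_line_eq[OF c] using W0 by (simp add: diff_divide_distrib)
        then have "?R n X = F n X / norm_pop n e X" using W0 by (simp add: F_def)
        also have "\<dots> = 1 / norm_pop n e X * F n X" by simp
        also have "\<dots> \<le> l * F n X"
        proof (rule mult_right_mono)
          show "1 / norm_pop n e X \<le> l" using W W0 l by (simp add: field_simps)
        qed (simp add: F_def)
        finally have "?R n X \<le> l * F n X" .
        then show ?thesis by (rule order_trans) simp
      qed
    qed
    also have "\<dots> = l * (\<integral>X. F n X \<partial>tree_law e) + measure (tree_law e) (?A n l)"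
      using Fi Ai Am[of n l] by simp
    also have "\<dots> \<le> l * (\<integral>X. F n X \<partial>tree_law e) + exp 1 * (laplace n e l - extinct n e)"
      by (intro add_left_mono prob_small_norm_pop[OF e l])
    finally show ?thesis .
  qed
  show ?thesis
  proof (rule LIMSEQ_I)
    fix \<epsilon> :: real assume \<epsilon>: "\<epsilon> > 0"
    have "(\<lambda>k. exp 1 * (laplace_lim e (real k) - extinct_prob e)) \<longlonglongrightarrow> exp 1 * (null_prob e - extinct_prob e)"
      by (intro tendsto_intros null_prob_limit(1)[OF e])
    moreover have "null_prob e = extinct_prob e" using reg by (simp add: regular_def)
    ultimately have "(\<lambda>k. exp 1 * (laplace_lim e (real k) - extinct_prob e)) \<longlonglongrightarrow> 0" by simp
    then have "eventually (\<lambda>k. exp 1 * (laplace_lim e (real k) - extinct_prob e) < \<epsilon>) sequentially"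
      by (rule order_tendstoD) (rule \<epsilon>)
    then have "eventually (\<lambda>k. exp 1 * (laplace_lim e (real k) - extinct_prob e) < \<epsilon> \<and> k > 0) sequentially"
      using eventually_gt_at_top[of 0] by eventually_elim auto
    from eventually_happens'[OF sequentially_bot this]
    obtain k where k: "exp 1 * (laplace_lim e (real k) - extinct_prob e) < \<epsilon>" "k > 0" by blast
    have "(\<lambda>n. real k * (\<integral>X. F n X \<partial>tree_law e) + exp 1 * (laplace n e (real k) - extinct n e))
      \<longlonglongrightarrow> real k * 0 + exp 1 * (laplace_lim e (real k) - extinct_prob e)"
      unfolding F_def c_def using regular_fluctuation[OF reg]
      by (intro tendsto_add tendsto_mult tendsto_diff tendsto_const laplace_lim(1)[OF e] extinct_prob_limit(1)[OF e]) auto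
    then have "eventually (\<lambda>n. real k * (\<integral>X. F n X \<partial>tree_law e) + exp 1 * (laplace n e (real k) - extinct n e) < \<epsilon>) sequentially"
      by (rule order_tendstoD) (use k in simp)
    then obtain n0 where n0: "\<And>n. n \<ge> n0 \<Longrightarrow> real k * (\<integral>X. F n X \<partial>tree_law e) + exp 1 * (laplace n e (real k) - extinct n e) < \<epsilon>"
      by (auto simp: eventually_sequentially)
    have "norm ((\<integral>X. ?R n X \<partial>tree_law e) - 0) < \<epsilon>" if "n \<ge> n0" for n
    proof -
      have "0 \<le> (\<integral>X. ?R n X \<partial>tree_law e)" using R1(1) by (intro Bochner_Integration.integral_nonneg)
      moreover have "(\<integral>X. ?R n X \<partial>tree_law e) < \<epsilon>"
        using bound[of "real k" n] n0[OF that] k(2) by linarith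
      ultimately show ?thesis by (simp only: real_norm_def diff_0_right abs_of_nonneg)
    qed
    then show "\<exists>no. \<forall>n\<ge>no. norm ((\<integral>X. ?R n X \<partial>tree_law e) - 0) < \<epsilon>" by blast
  qed
qed

section \<open>The branching random walk\<close>

text \<open>Generations are defined by appending the youngest child, while all recursions on trees
  start at the root. This lemma reconciles the two.\<close>

lemma generation_Suc_root: "generation X (Suc n) = (\<Union>i<fst (X []). (#) i ` generation (subtree X i) n)"
proof (induction n)
  case (Suc n)
  have "generation X (Suc (Suc n)) = {u @ [i] |u i. u \<in> (\<Union>j<fst (X []). (#) j ` generation (subtree X j) n) \<and> i < fst (X u)}"
    by (subst generation.simps(2)) (simp only: Suc)
  also have "\<dots> = (\<Union>j<fst (X []). (#) j ` generation (subtree X j) (Suc n))"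
  proof (intro set_eqI iffI)
    fix w assume "w \<in> {u @ [i] |u i. u \<in> (\<Union>j<fst (X []). (#) j ` generation (subtree X j) n) \<and> i < fst (X u)}"
    then obtain j v i where "j < fst (X [])" "v \<in> generation (subtree X j) n" "i < fst (X (j # v))" "w = j # (v @ [i])"
      by auto
    then show "w \<in> (\<Union>j<fst (X []). (#) j ` generation (subtree X j) (Suc n))"
      by (auto simp: subtree_def intro!: bexI[of _ j] imageI)
  next
    fix w assume "w \<in> (\<Union>j<fst (X []). (#) j ` generation (subtree X j) (Suc n))"
    then obtain j v i where w: "j < fst (X [])" "v \<in> generation (subtree X j) n" "i < fst (X (j # v))" "w = (j # v) @ [i]"
      by (auto simp: subtree_def)
    then show "w \<in> {u @ [i] |u i. u \<in> (\<Union>j<fst (X []). (#) j ` generation (subtree X j) n) \<and> i < fst (X u)}"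
      by blast
  qed
  finally show ?case .
qed auto

lemma finite_generation: "finite (generation X n)"
proof (induction n arbitrary: X)
  case (Suc n)
  then show ?case unfolding generation_Suc_root by blast
qed simp

lemma position_Cons: "position X (i # v) = snd (X []) i + position (subtree X i) v"
  by (simp add: position_def sum.lessThan_Suc_shift subtree_def del: sum.lessThan_Suc)

text \<open>The nested divisions by offspring means collect into \<open>prod_mean e n\<close>, and
  the successive subtractions from the barrier into the position.\<close>

lemma branching_sum_generation:
  "branching_sum n e (\<lambda>_ z. f z) X y = (\<Sum>u\<in>generation X n. f (y - position X u)) / prod_mean e n"
proof (induction n arbitrary: e X y)
  case 0
  show ?case by (simp add: position_def prod_mean_def)
next
  case (Suc n)
  have "(\<Sum>u\<in>generation X (Suc n). f (y - position X u))
    = (\<Sum>i<fst (X []). \<Sum>u\<in>(#) i ` generation (subtree X i) n. f (y - position X u))"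
    unfolding generation_Suc_root by (rule sum.UNION_disjoint) (auto simp: finite_generation)
  also have "\<dots> = (\<Sum>i<fst (X []). \<Sum>v\<in>generation (subtree X i) n. f (y - snd (X []) i - position (subtree X i) v))"
    by (rule sum.cong[OF refl], subst sum.reindex) (auto simp: inj_on_def position_Cons diff_diff_eq)
  finally show ?case
    by (simp add: Suc prod_mean_Suc_shift sum_divide_distrib[symmetric])
qed

lemma measure_Z:
  assumes "A \<in> sets borel"
  shows "measure (Z X n) A = (\<Sum>u\<in>generation X n. indicator A (position X u))"
proof -
  have "measure (Z X n) A = measure (count_space (generation X n)) (position X -` A \<inter> generation X n)"
    unfolding Z_def using assms by (subst measure_distr) auto
  also have "\<dots> = card (position X -` A \<inter> generation X n)"
    unfolding measure_def
    by (subst emeasure_count_space_finite) (auto simp: finite_generation ennreal_of_nat_eq_real_of_nat)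
  also have "\<dots> = (\<Sum>u\<in>generation X n. indicator A (position X u))"
    using finite_generation[of X n] by (simp add: indicator_def sum.If_cases vimage_def Int_def conj_commute)
  finally show ?thesis .
qed

text \<open>The normalisation cancels in the quotient and does not affect positivity. Hence
  \<open>ratio\<close> and survival are the same for every choice of \<open>e\<close>, a freedom
  exploited in the annealed case.\<close>

lemma Z_branching_sum:
  assumes e: "environment e"
  shows "measure (Z X n) UNIV = prod_mean e n * norm_pop n e X"
    "measure (Z X n) {..y} = prod_mean e n * branching_sum n e (\<lambda>_ z. indicator {0..} z) X y"
    "measure (Z X n) {..y} / measure (Z X n) UNIV = ratio n e X y"
    "measure (Z X n) UNIV > 0 \<longleftrightarrow> norm_pop n e X \<noteq> 0"
proof -
  have p: "prod_mean e n > 0" by (rule prod_mean_pos[OF e])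
  show 1: "measure (Z X n) UNIV = prod_mean e n * norm_pop n e X"
    unfolding norm_pop_def branching_sum_generation using p by (simp add: measure_Z)
  show 2: "measure (Z X n) {..y} = prod_mean e n * branching_sum n e (\<lambda>_ z. indicator {0..} z) X y"
    unfolding branching_sum_generation using p by (simp add: measure_Z indicator_def)
  show "measure (Z X n) {..y} / measure (Z X n) UNIV = ratio n e X y"
    unfolding 1 2 ratio_def using p by simp
  show "measure (Z X n) UNIV > 0 \<longleftrightarrow> norm_pop n e X \<noteq> 0"
    unfolding 1 using p norm_pop_nonneg[of n e X] by (auto simp: zero_less_mult_iff order_le_less)
qed

section \<open>Translation of the stated quantities and conditioning on survival\<close>

lemma quenched_eq_tree_law: "quenched \<eta> s = tree_law (\<lambda>n. \<eta> (s n))"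
  by (simp add: quenched_def tree_law_def)

lemma mean_disp_eq: "mean_disp \<eta> s n = disp_mean (\<eta> (s n))"
  by (simp add: mean_disp_def disp_mean_def mean_offspring_def offspring_mean_def)

lemma var_disp_eq: "var_disp \<eta> s n = disp_var (\<eta> (s n))"
  by (simp add: var_disp_def disp_var_def mean_disp_eq mean_offspring_def)

lemma barrier_eq: "scaling \<eta> s n * x + centering \<eta> s n = barrier (\<lambda>n. \<eta> (s n)) x n"
  by (simp add: scaling_def centering_def barrier_def mean_disp_eq var_disp_eq)

text \<open>The conditional expectation differs from \<open>c\<close> by the integral of
  \<open>f n x - c\<close> over the event divided by the probability of the event. The numerator
  tends to 0 by hypothesis and the denominator to \<open>p > 0\<close>.\<close>

lemma cond_expectation_limit:
  fixes f :: "nat \<Rightarrow> 'a \<Rightarrow> real"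
  assumes M: "prob_space M" and A: "\<And>n. {x \<in> space M. B n x} \<in> sets M"
    and f: "\<And>n. f n \<in> borel_measurable M" "\<And>n x. 0 \<le> f n x" "\<And>n x. f n x \<le> 1"
    and lim: "(\<lambda>n. \<integral>x. (if B n x then \<bar>f n x - c\<bar> else 0) \<partial>M) \<longlonglongrightarrow> 0"
    and p: "(\<lambda>n. measure M {x \<in> space M. B n x}) \<longlonglongrightarrow> p" "p > 0"
  shows "(\<lambda>n. cond_expectation M (B n) (f n)) \<longlonglongrightarrow> c"
proof -
  interpret prob_space M by fact
  define D where "D n = {x \<in> space M. B n x}" for n
  have D: "D n \<in> sets M" for n using A by (simp add: D_def)
  have f_int: "integrable M (f n)" for n
    by (rule integrable_const_bound[where B=1]) (use f in auto)
  have ind_int: "integrable M (\<lambda>x. indicator (D n) x * g x)" if "integrable M g" for n and g :: "'a \<Rightarrow> real"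
    using integrable_mult_indicator[OF D[of n] that] by simp
  have formula: "cond_expectation M (B n) (f n) = c + (\<integral>x. indicator (D n) x * (f n x - c) \<partial>M) / measure M (D n)"
    if pos: "measure M (D n) > 0" for n
  proof -
    have "uniform_measure M (D n) = density M (\<lambda>x. ennreal (indicator (D n) x / measure M (D n)))"
      unfolding uniform_measure_def
    proof (rule density_cong)
      show "AE x in M. indicator (D n) x / emeasure M (D n) = ennreal (indicator (D n) x / measure M (D n))"
        using pos by (intro AE_I2) (auto simp: emeasure_eq_measure indicator_def divide_ennreal[symmetric] simp flip: ennreal_1)
    qed (use D in measurable)
    then have "cond_expectation M (B n) (f n) = (\<integral>x. indicator (D n) x / measure M (D n) * f n x \<partial>M)"
      unfolding cond_expectation_def D_def[symmetric] using D f pos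
      by (simp add: integral_density)
    also have "\<dots> = (\<integral>x. indicator (D n) x * f n x \<partial>M) / measure M (D n)"
      by simp
    also have "(\<integral>x. indicator (D n) x * f n x \<partial>M) = (\<integral>x. indicator (D n) x * (f n x - c) + c * indicator (D n) x \<partial>M)"
      by (simp add: algebra_simps)
    also have "\<dots> = (\<integral>x. indicator (D n) x * (f n x - c) \<partial>M) + c * measure M (D n)"
    proof (subst Bochner_Integration.integral_add)
      show "integrable M (\<lambda>x. indicator (D n) x * (f n x - c))" using f_int by (intro ind_int) simp
      show "integrable M (\<lambda>x. c * indicator (D n) x)" using D[of n] by (simp add: emeasure_eq_measure)
    qed (use D in simp)
    finally show ?thesis using pos by (simp add: add_divide_distrib)
  qed
  have "(\<lambda>n. \<integral>x. indicator (D n) x * (f n x - c) \<partial>M) \<longlonglongrightarrow> 0"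
  proof (rule Lim_null_comparison[OF _ lim], rule always_eventually, rule allI)
    fix n
    have "norm (\<integral>x. indicator (D n) x * (f n x - c) \<partial>M) \<le> (\<integral>x. norm (indicator (D n) x * (f n x - c)) \<partial>M)"
      by (rule integral_norm_bound)
    also have "\<dots> = (\<integral>x. (if B n x then \<bar>f n x - c\<bar> else 0) \<partial>M)"
      by (intro Bochner_Integration.integral_cong) (auto simp: D_def indicator_def)
    finally show "norm (\<integral>x. indicator (D n) x * (f n x - c) \<partial>M) \<le> (\<integral>x. (if B n x then \<bar>f n x - c\<bar> else 0) \<partial>M)" .
  qed
  then have "(\<lambda>n. c + (\<integral>x. indicator (D n) x * (f n x - c) \<partial>M) / measure M (D n)) \<longlonglongrightarrow> c + 0 / p"
    using p by (intro tendsto_intros) (auto simp: D_def)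
  moreover have "eventually (\<lambda>n. c + (\<integral>x. indicator (D n) x * (f n x - c) \<partial>M) / measure M (D n) = cond_expectation M (B n) (f n)) sequentially"
    using order_tendstoD(1)[OF p] unfolding D_def[symmetric] by eventually_elim (simp add: formula)
  ultimately have "(\<lambda>n. cond_expectation M (B n) (f n)) \<longlonglongrightarrow> c + 0 / p" by (rule Lim_transform_eventually)
  then show ?thesis by simp
qed

lemma survival_measure:
  assumes e: "environment e"
  shows "{X \<in> space (tree_law e). measure (Z X n) UNIV > 0} \<in> sets (tree_law e)"
    "measure (tree_law e) {X \<in> space (tree_law e). measure (Z X n) UNIV > 0} = 1 - extinct n e"
proof -
  note e1 = environmentD(1)[OF e]
  interpret T: prob_space "tree_law e" by (rule prob_space_tree_law[OF e1])
  have eq: "{X \<in> space (tree_law e). measure (Z X n) UNIV > 0} = {X. norm_pop n e X \<noteq> 0}"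
    using space_tree_law[OF e1] Z_branching_sum(4)[OF e] by auto
  have "{X \<in> space tree_space. norm_pop n e X \<noteq> 0} \<in> sets tree_space" by measurable
  then have A: "{X. norm_pop n e X \<noteq> 0} \<in> sets (tree_law e)" by (simp add: sets_tree_law[OF e1])
  then show "{X \<in> space (tree_law e). measure (Z X n) UNIV > 0} \<in> sets (tree_law e)" by (simp only: eq)
  have "measure (tree_law e) {X. norm_pop n e X \<noteq> 0} = (\<integral>X. indicator {X. norm_pop n e X \<noteq> 0} X \<partial>tree_law e)"
    using A by simp
  also have "\<dots> = (\<integral>X. 1 - (if norm_pop n e X = 0 then 1 else 0) \<partial>tree_law e)"
    by (intro Bochner_Integration.integral_cong) (auto simp: indicator_def)
  also have "\<dots> = 1 - extinct n e"
    unfolding extinct_def using extinct_integrable[OF e, of n] by (subst Bochner_Integration.integral_diff) (auto simp: T.prob_space)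
  finally show "measure (tree_law e) {X \<in> space (tree_law e). measure (Z X n) UNIV > 0} = 1 - extinct n e"
    by (simp only: eq)
qed

lemma if_not_eq: "(if a \<noteq> b then u else v) = (if a = b then v else u)"
  by simp

lemma regular_quenched:
  assumes reg: "regular e"
  shows "(\<lambda>n. cond_expectation (tree_law e) (\<lambda>Y. measure (Z Y n) UNIV > 0)
      (\<lambda>Y. measure (Z Y n) {..barrier e x n} / measure (Z Y n) UNIV)) \<longlonglongrightarrow> cdf std_normal_distribution x"
proof -
  have e: "environment e" using reg by (simp add: regular_def)
  note e1 = environmentD(1)[OF e]
  note Zr = Z_branching_sum(3)[OF e] and Zp = Z_branching_sum(4)[OF e]
  show ?thesis
    unfolding Zr
  proof (rule cond_expectation_limit[OF prob_space_tree_law[OF e1] survival_measure(1)[OF e] _ ratio_bounds])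
    show "(\<lambda>X. ratio n e X (barrier e x n)) \<in> borel_measurable (tree_law e)" for n
      by (subst measurable_cong_sets[OF sets_tree_law[OF e1] refl]) (rule ratio_measurable)
    have "(\<lambda>n. \<integral>X. (if norm_pop n e X = 0 then 0 else \<bar>ratio n e X (barrier e x n) - cdf std_normal_distribution x\<bar>) \<partial>tree_law e) \<longlonglongrightarrow> 0"
      by (rule regular_ratio[OF reg])
    then show "(\<lambda>n. \<integral>X. (if measure (Z X n) UNIV > 0 then \<bar>ratio n e X (barrier e x n) - cdf std_normal_distribution x\<bar> else 0) \<partial>tree_law e) \<longlonglongrightarrow> 0"
      unfolding Zp if_not_eq .
    show "(\<lambda>n. measure (tree_law e) {X \<in> space (tree_law e). measure (Z X n) UNIV > 0}) \<longlonglongrightarrow> 1 - extinct_prob e"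
      unfolding survival_measure(2)[OF e] by (intro tendsto_intros extinct_prob_limit(1)[OF e])
    show "1 - extinct_prob e > 0" using reg by (simp add: regular_def)
  qed
qed

section \<open>Disintegration of the annealed law\<close>

context mark_kernel
begin

lemma annealed_eq_bind:
  "annealed \<eta> \<nu> = \<nu> \<bind> (\<lambda>s. tree_law (env s) \<bind> (\<lambda>X. return (\<nu> \<Otimes>\<^sub>M tree_space) (s, X)))"
  unfolding annealed_def quenched_eq_tree_law tree_space_def env_def ..

lemma annealed_kernel:
  "(\<lambda>s. tree_law (env s) \<bind> (\<lambda>X. return (\<nu> \<Otimes>\<^sub>M tree_space) (s, X))) \<in> \<nu> \<rightarrow>\<^sub>M prob_algebra (\<nu> \<Otimes>\<^sub>M tree_space)"
proof (rule measurable_bind_prob_space2[OF tree_law_kernel])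
  show "(\<lambda>(s, X). return (\<nu> \<Otimes>\<^sub>M tree_space) (s, X)) \<in> \<nu> \<Otimes>\<^sub>M tree_space \<rightarrow>\<^sub>M prob_algebra (\<nu> \<Otimes>\<^sub>M tree_space)"
    using measurable_return_prob_space[of "\<nu> \<Otimes>\<^sub>M tree_space"] by (simp add: case_prod_beta')
qed

lemma nn_integral_annealed:
  assumes f: "f \<in> borel_measurable (\<nu> \<Otimes>\<^sub>M tree_space)"
  shows "(\<integral>\<^sup>+x. f x \<partial>annealed \<eta> \<nu>) = (\<integral>\<^sup>+s. (\<integral>\<^sup>+X. f (s, X) \<partial>tree_law (env s)) \<partial>\<nu>)"
proof -
  have "(\<integral>\<^sup>+x. f x \<partial>annealed \<eta> \<nu>) = (\<integral>\<^sup>+s. (\<integral>\<^sup>+x. f x \<partial>(tree_law (env s) \<bind> (\<lambda>X. return (\<nu> \<Otimes>\<^sub>M tree_space) (s, X)))) \<partial>\<nu>)"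
    unfolding annealed_eq_bind by (rule nn_integral_bind[OF f measurable_prob_algebraD[OF annealed_kernel]])
  also have "\<dots> = (\<integral>\<^sup>+s. (\<integral>\<^sup>+X. f (s, X) \<partial>tree_law (env s)) \<partial>\<nu>)"
  proof (rule nn_integral_cong)
    fix s assume s: "s \<in> space \<nu>"
    note sets_T = sets_tree_law[OF mark_laws_env[OF s]]
    have pair: "Pair s \<in> tree_law (env s) \<rightarrow>\<^sub>M \<nu> \<Otimes>\<^sub>M tree_space"
      by (subst measurable_cong_sets[OF sets_T refl]) (rule measurable_Pair1'[OF s])
    have "(\<integral>\<^sup>+x. f x \<partial>(tree_law (env s) \<bind> (\<lambda>X. return (\<nu> \<Otimes>\<^sub>M tree_space) (s, X))))
      = (\<integral>\<^sup>+X. (\<integral>\<^sup>+x. f x \<partial>return (\<nu> \<Otimes>\<^sub>M tree_space) (s, X)) \<partial>tree_law (env s))"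
      by (rule nn_integral_bind[OF f]) (rule measurable_compose[OF pair return_measurable])
    also have "\<dots> = (\<integral>\<^sup>+X. f (s, X) \<partial>tree_law (env s))"
      using s f by (intro nn_integral_cong nn_integral_return) (auto simp: space_pair_measure)
    finally show "(\<integral>\<^sup>+x. f x \<partial>(tree_law (env s) \<bind> (\<lambda>X. return (\<nu> \<Otimes>\<^sub>M tree_space) (s, X)))) = (\<integral>\<^sup>+X. f (s, X) \<partial>tree_law (env s))" .
  qed
  finally show ?thesis .
qed

lemma annealed_law:
  assumes "prob_space \<nu>"
  shows "sets (annealed \<eta> \<nu>) = sets (\<nu> \<Otimes>\<^sub>M tree_space)" "prob_space (annealed \<eta> \<nu>)"
    "distr (annealed \<eta> \<nu>) \<nu> fst = \<nu>"
proof -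
  have \<nu>: "\<nu> \<in> space (prob_algebra \<nu>)" using assms by (simp add: space_prob_algebra)
  show sets_P: "sets (annealed \<eta> \<nu>) = sets (\<nu> \<Otimes>\<^sub>M tree_space)"
    unfolding annealed_eq_bind by (rule sets_bind'[OF \<nu> annealed_kernel])
  show "prob_space (annealed \<eta> \<nu>)"
    unfolding annealed_eq_bind by (rule prob_space_bind'[OF \<nu> annealed_kernel])
  have fst_m: "fst \<in> annealed \<eta> \<nu> \<rightarrow>\<^sub>M \<nu>"
    by (subst measurable_cong_sets[OF sets_P refl]) measurable
  show "distr (annealed \<eta> \<nu>) \<nu> fst = \<nu>"
  proof (rule measure_eqI)
    fix A assume "A \<in> sets (distr (annealed \<eta> \<nu>) \<nu> fst)"
    then have A: "A \<in> sets \<nu>" by simp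
    have "emeasure (distr (annealed \<eta> \<nu>) \<nu> fst) A = (\<integral>\<^sup>+s. indicator A s \<partial>distr (annealed \<eta> \<nu>) \<nu> fst)"
      using A by simp
    also have "\<dots> = (\<integral>\<^sup>+x. indicator A (fst x) \<partial>annealed \<eta> \<nu>)"
      using A by (intro nn_integral_distr fst_m) simp
    also have "\<dots> = (\<integral>\<^sup>+s. (\<integral>\<^sup>+X. indicator A s \<partial>tree_law (env s)) \<partial>\<nu>)"
      using A by (subst nn_integral_annealed) (auto intro: measurable_compose[OF measurable_fst])
    also have "\<dots> = (\<integral>\<^sup>+s. indicator A s \<partial>\<nu>)"
      by (intro nn_integral_cong) (simp add: prob_space.emeasure_space_1[OF prob_space_tree_law[OF mark_laws_env]])
    finally show "emeasure (distr (annealed \<eta> \<nu>) \<nu> fst) A = emeasure \<nu> A" using A by simp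
  qed simp
qed

lemma integral_annealed:
  fixes h :: "(nat \<Rightarrow> 't) \<times> marks \<Rightarrow> real"
  assumes \<nu>: "prob_space \<nu>" and h: "h \<in> borel_measurable (\<nu> \<Otimes>\<^sub>M tree_space)" "\<And>x. 0 \<le> h x" "\<And>x. h x \<le> 1"
  shows "(\<integral>x. h x \<partial>annealed \<eta> \<nu>) = (\<integral>s. (\<integral>X. h (s, X) \<partial>tree_law (env s)) \<partial>\<nu>)"
    "(\<lambda>s. \<integral>X. h (s, X) \<partial>tree_law (env s)) \<in> borel_measurable \<nu>"
proof -
  interpret prob_space \<nu> by fact
  show m: "(\<lambda>s. \<integral>X. h (s, X) \<partial>tree_law (env s)) \<in> borel_measurable \<nu>"
    using h by (intro tree_integral_measurable) auto
  have hP: "h \<in> borel_measurable (annealed \<eta> \<nu>)"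
    by (subst measurable_cong_sets[OF annealed_law(1)[OF \<nu>] refl]) (rule h)
  have "(\<integral>x. h x \<partial>annealed \<eta> \<nu>) = enn2real (\<integral>\<^sup>+x. ennreal (h x) \<partial>annealed \<eta> \<nu>)"
    using hP h by (intro integral_eq_nn_integral) auto
  also have "(\<integral>\<^sup>+x. ennreal (h x) \<partial>annealed \<eta> \<nu>) = (\<integral>\<^sup>+s. (\<integral>\<^sup>+X. ennreal (h (s, X)) \<partial>tree_law (env s)) \<partial>\<nu>)"
    using h(1) by (intro nn_integral_annealed) simp
  also have "\<dots> = (\<integral>\<^sup>+s. ennreal (\<integral>X. h (s, X) \<partial>tree_law (env s)) \<partial>\<nu>)"
  proof (rule nn_integral_cong)
    fix s assume s: "s \<in> space \<nu>"
    interpret T: prob_space "tree_law (env s)" by (rule prob_space_tree_law[OF mark_laws_env[OF s]])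
    have "(\<lambda>X. h (s, X)) \<in> borel_measurable (tree_law (env s))"
      by (subst measurable_cong_sets[OF sets_tree_law[OF mark_laws_env[OF s]] refl])
        (rule measurable_compose[OF measurable_Pair1'[OF s] h(1)])
    then have "integrable (tree_law (env s)) (\<lambda>X. h (s, X))"
      using h by (intro T.integrable_const_bound[where B=1]) auto
    then show "(\<integral>\<^sup>+X. ennreal (h (s, X)) \<partial>tree_law (env s)) = ennreal (\<integral>X. h (s, X) \<partial>tree_law (env s))"
      using h by (intro nn_integral_eq_integral) auto
  qed
  also have "enn2real \<dots> = (\<integral>s. (\<integral>X. h (s, X) \<partial>tree_law (env s)) \<partial>\<nu>)"
    using m h by (intro integral_eq_nn_integral[symmetric]) (auto intro!: Bochner_Integration.integral_nonneg)
  finally show "(\<integral>x. h x \<partial>annealed \<eta> \<nu>) = (\<integral>s. (\<integral>X. h (s, X) \<partial>tree_law (env s)) \<partial>\<nu>)" .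
qed

end

text \<open>Carries integrals over the root mark of a tree to integrals against the kernel; it
  serves to read the logarithmic moment condition.\<close>

lemma nn_integral_root:
  assumes e: "mark_laws e" and f: "f \<in> borel_measurable mark_space"
  shows "(\<integral>\<^sup>+X. f (X []) \<partial>tree_law e) = (\<integral>\<^sup>+p. f p \<partial>e 0)"
proof -
  have root: "(\<lambda>X. X []) \<in> tree_law e \<rightarrow>\<^sub>M e 0"
    by (subst measurable_cong_sets[OF sets_tree_law[OF e] mark_lawsD(2)[OF e]]) (rule root_measurable)
  have "distr (tree_law e) (e 0) (\<lambda>X. X []) = e 0"
    unfolding tree_law_def using distr_PiM_component[of UNIV "\<lambda>u. e (length u)" "[]"] mark_lawsD(1)[OF e] by simp
  moreover have "(\<integral>\<^sup>+p. f p \<partial>distr (tree_law e) (e 0) (\<lambda>X. X [])) = (\<integral>\<^sup>+X. f (X []) \<partial>tree_law e)"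
    by (rule nn_integral_distr[OF root]) (simp add: measurable_cong_sets[OF mark_lawsD(2)[OF e] refl] f)
  ultimately show ?thesis by simp
qed

context random_environment
begin

lemma extinct_prob_measurable: "(\<lambda>s. extinct_prob (env s)) \<in> borel_measurable \<nu>"
  unfolding extinct_prob_def by (intro borel_measurable_lim_metric extinct_measurable)

lemma barrier_measurable: "(\<lambda>s. barrier (env s) x n) \<in> borel_measurable \<nu>"
  unfolding barrier_def env_def by measurable

text \<open>The quenched deviations on survival are bounded by one and tend to 0 in almost every
  environment, so they can be integrated over the environment. The annealed survival probability
  tends to the mean of \<open>1 - extinct_prob\<close>, which is positive because the integrand is
  almost surely positive.\<close>

theorem annealed_limit:
  "(\<lambda>n. cond_expectation (annealed \<eta> \<nu>) (\<lambda>(s, Y). measure (Z Y n) UNIV > 0)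
      (\<lambda>(s, Y). measure (Z Y n) {..barrier (env s) x n} / measure (Z Y n) UNIV)) \<longlonglongrightarrow> cdf std_normal_distribution x"
proof -
  let ?P = "annealed \<eta> \<nu>"
  define c where "c = cdf std_normal_distribution x"
  have c: "0 \<le> c" "c \<le> 1" unfolding c_def by (rule cdf_std_normal_bounds)+
  have \<nu>: "prob_space \<nu>" by (rule prob_space_axioms)
  note sets_P = annealed_law(1)[OF \<nu>]
  \<comment> \<open>One fixed environment \<open>s0\<close> serves only as a normalisation, which
    cancels in \<open>ratio\<close> and in the survival event. Joint measurability then concerns the
    tree and the barrier alone, with no dependence of the branching sum on the environment.\<close>
  have "\<exists>s. environment (env s)"
  proof (rule ccontr)
    assume "\<not> (\<exists>s. environment (env s))"
    then have "AE s in \<nu>. False" using AE_environment by simp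
    then show False by simp
  qed
  then obtain s0 where s0: "environment (env s0)" by blast
  let ?e = "env s0"
  note Zr = Z_branching_sum(3)[OF s0] and Zp = Z_branching_sum(4)[OF s0]
  let ?r = "\<lambda>n x'. ratio n ?e (snd x') (barrier (env (fst x')) x n)"
  let ?B = "\<lambda>n x'. norm_pop n ?e (snd x') \<noteq> 0"
  have rm: "?r n \<in> borel_measurable (\<nu> \<Otimes>\<^sub>M tree_space)" for n
  proof -
    have pair: "(\<lambda>x'. (snd x', barrier (env (fst x')) x n)) \<in> \<nu> \<Otimes>\<^sub>M tree_space \<rightarrow>\<^sub>M tree_space \<Otimes>\<^sub>M borel"
      by (intro measurable_Pair measurable_snd measurable_compose[OF measurable_fst barrier_measurable])
    have "(\<lambda>x'. branching_sum n ?e (\<lambda>_ z. indicator {0..} z) (snd x') (barrier (env (fst x')) x n)) \<in> borel_measurable (\<nu> \<Otimes>\<^sub>M tree_space)"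
      using measurable_compose[OF pair branching_sum_measurable[OF indicator_measurable_pair, of n ?e]] by simp
    then show ?thesis
      unfolding ratio_def
      by (intro borel_measurable_divide measurable_compose[OF measurable_snd norm_pop_measurable])
  qed
  have Wm: "(\<lambda>x'. norm_pop n ?e (snd x')) \<in> borel_measurable (\<nu> \<Otimes>\<^sub>M tree_space)" for n
    by (rule measurable_compose[OF measurable_snd norm_pop_measurable])
  have Bm: "{x' \<in> space ?P. ?B n x'} \<in> sets ?P" for n
  proof -
    have "{x' \<in> space (\<nu> \<Otimes>\<^sub>M tree_space). ?B n x'} \<in> sets (\<nu> \<Otimes>\<^sub>M tree_space)"
      using Wm[of n] by measurable
    then show ?thesis by (simp add: sets_P sets_eq_imp_space_eq[OF sets_P])
  qed
  let ?h = "\<lambda>n x'. if ?B n x' then \<bar>?r n x' - c\<bar> else 0"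
  have hm: "?h n \<in> borel_measurable (\<nu> \<Otimes>\<^sub>M tree_space)" for n
    using Wm[of n] rm[of n] by measurable
  have h01: "0 \<le> ?h n x'" "?h n x' \<le> 1" for n x'
    using ratio_bounds[of n ?e "snd x'" "barrier (env (fst x')) x n"] c by auto
  note h_int = integral_annealed[OF \<nu> hm h01]
  have "(\<lambda>n. \<integral>s. (\<integral>X. ?h n (s, X) \<partial>tree_law (env s)) \<partial>\<nu>) \<longlonglongrightarrow> (\<integral>s. 0 \<partial>\<nu>)"
  proof (rule integral_dominated_convergence[where w="\<lambda>_. 1"])
    show "(\<lambda>s. \<integral>X. ?h n (s, X) \<partial>tree_law (env s)) \<in> borel_measurable \<nu>" for n by (rule h_int(2))
    show "AE s in \<nu>. (\<lambda>n. \<integral>X. ?h n (s, X) \<partial>tree_law (env s)) \<longlonglongrightarrow> 0"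
      using AE_regular
    proof eventually_elim
      case (elim s)
      have e: "environment (env s)" using elim by (simp add: regular_def)
      have "ratio n ?e X y = ratio n (env s) X y" for n X y
        using Zr[of X n y] Z_branching_sum(3)[OF e, of X n y] by simp
      moreover have "norm_pop n ?e X = 0 \<longleftrightarrow> norm_pop n (env s) X = 0" for n X
        using Zp[of X n] Z_branching_sum(4)[OF e, of X n] by blast
      ultimately show ?case
        using regular_ratio[OF elim, of x] by (simp add: if_not_eq c_def cong: if_cong)
    qed
    show "AE s in \<nu>. norm (\<integral>X. ?h n (s, X) \<partial>tree_law (env s)) \<le> 1" for n
    proof (rule AE_I2)
      fix s assume s: "s \<in> space \<nu>"
      interpret T: prob_space "tree_law (env s)" by (rule prob_space_tree_law[OF mark_laws_env[OF s]])
      have "(\<integral>X. ?h n (s, X) \<partial>tree_law (env s)) \<le> 1"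
      proof (cases "integrable (tree_law (env s)) (\<lambda>X. ?h n (s, X))")
        case True
        then show ?thesis by (rule T.integral_le_const) (intro AE_I2 h01)
      qed (simp add: not_integrable_integral_eq)
      moreover have "0 \<le> (\<integral>X. ?h n (s, X) \<partial>tree_law (env s))"
        by (intro Bochner_Integration.integral_nonneg h01)
      ultimately show "norm (\<integral>X. ?h n (s, X) \<partial>tree_law (env s)) \<le> 1" by (simp only: real_norm_def abs_of_nonneg)
    qed
  qed auto
  then have lim: "(\<lambda>n. \<integral>x'. ?h n x' \<partial>?P) \<longlonglongrightarrow> 0" by (simp only: h_int(1) integral_zero)
  have surv: "measure ?P {x' \<in> space ?P. ?B n x'} = (\<integral>s. 1 - extinct n (env s) \<partial>\<nu>)" for n
  proof -
    let ?i = "\<lambda>x'. if ?B n x' then 1 else 0 :: real"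
    have im: "?i \<in> borel_measurable (\<nu> \<Otimes>\<^sub>M tree_space)" using Wm[of n] by measurable
    have "measure ?P {x' \<in> space ?P. ?B n x'} = (\<integral>x'. indicator {x' \<in> space ?P. ?B n x'} x' \<partial>?P)"
      using Bm[of n] by simp
    also have "\<dots> = (\<integral>x'. ?i x' \<partial>?P)"
      by (intro Bochner_Integration.integral_cong) (auto simp: indicator_def)
    also have "\<dots> = (\<integral>s. (\<integral>X. ?i (s, X) \<partial>tree_law (env s)) \<partial>\<nu>)"
      by (rule integral_annealed(1)[OF \<nu> im]) auto
    also have "\<dots> = (\<integral>s. 1 - extinct n (env s) \<partial>\<nu>)"
    proof (rule integral_cong_AE)
      show "(\<lambda>s. \<integral>X. ?i (s, X) \<partial>tree_law (env s)) \<in> borel_measurable \<nu>"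
        by (rule integral_annealed(2)[OF \<nu> im]) auto
      show "(\<lambda>s. 1 - extinct n (env s)) \<in> borel_measurable \<nu>"
        using extinct_measurable[of n] by measurable
      show "AE s in \<nu>. (\<integral>X. ?i (s, X) \<partial>tree_law (env s)) = 1 - extinct n (env s)"
        using AE_environment
      proof eventually_elim
        case (elim s)
        interpret T: prob_space "tree_law (env s)" by (rule prob_space_tree_law[OF environmentD(1)[OF elim]])
        have "norm_pop n ?e X = 0 \<longleftrightarrow> norm_pop n (env s) X = 0" for X
          using Zp[of X n] Z_branching_sum(4)[OF elim, of X n] by blast
        then have "(\<integral>X. ?i (s, X) \<partial>tree_law (env s)) = (\<integral>X. 1 - (if norm_pop n (env s) X = 0 then 1 else 0) \<partial>tree_law (env s))"
          by (intro Bochner_Integration.integral_cong) auto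
        also have "\<dots> = 1 - extinct n (env s)"
          unfolding extinct_def using extinct_integrable[OF elim, of n]
          by (subst Bochner_Integration.integral_diff) (auto simp: T.prob_space)
        finally show ?case .
      qed
    qed
    finally show ?thesis .
  qed
  have ext01: "AE s in \<nu>. \<forall>n. 0 \<le> extinct n (env s) \<and> extinct n (env s) \<le> 1"
    using AE_environment
  proof eventually_elim
    case (elim s)
    show ?case
    proof
      fix n
      show "0 \<le> extinct n (env s) \<and> extinct n (env s) \<le> 1"
        using laplace_bounds(2,3,4)[OF elim, of 0 n] by auto
    qed
  qed
  have surv_lim: "(\<lambda>n. \<integral>s. 1 - extinct n (env s) \<partial>\<nu>) \<longlonglongrightarrow> (\<integral>s. 1 - extinct_prob (env s) \<partial>\<nu>)"
  proof (rule integral_dominated_convergence[where w="\<lambda>_. 1"])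
    show "AE s in \<nu>. norm (1 - extinct n (env s)) \<le> 1" for n using ext01 by eventually_elim auto
    show "AE s in \<nu>. (\<lambda>n. 1 - extinct n (env s)) \<longlonglongrightarrow> 1 - extinct_prob (env s)"
      using AE_environment by eventually_elim (intro tendsto_intros extinct_prob_limit(1))
  qed (use extinct_measurable extinct_prob_measurable in auto)
  have ext_lt: "AE s in \<nu>. 0 < 1 - extinct_prob (env s) \<and> 1 - extinct_prob (env s) \<le> 1"
    using AE_regular
  proof eventually_elim
    case (elim s)
    then show ?case using extinct_prob_limit(3)[of "env s"] by (auto simp: regular_def)
  qed
  have pos: "(\<integral>s. 1 - extinct_prob (env s) \<partial>\<nu>) > 0"
  proof (rule ccontr)
    assume neg: "\<not> (\<integral>s. 1 - extinct_prob (env s) \<partial>\<nu>) > 0"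
    have int: "integrable \<nu> (\<lambda>s. 1 - extinct_prob (env s))"
    proof (rule integrable_const_bound[where B=1])
      show "AE s in \<nu>. norm (1 - extinct_prob (env s)) \<le> 1" using ext_lt by eventually_elim auto
    qed (use extinct_prob_measurable in auto)
    have nn: "AE s in \<nu>. 0 \<le> 1 - extinct_prob (env s)" using ext_lt by eventually_elim auto
    have "(\<integral>s. 1 - extinct_prob (env s) \<partial>\<nu>) = 0"
      using neg integral_nonneg_AE[OF nn] by linarith
    then have "AE s in \<nu>. 1 - extinct_prob (env s) = 0"
      using integral_nonneg_eq_0_iff_AE[OF int nn] by simp
    then have "AE s in \<nu>. False" using ext_lt by eventually_elim auto
    then show False by simp
  qed
  have "(\<lambda>n. cond_expectation ?P (?B n) (?r n)) \<longlonglongrightarrow> c"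
  proof (rule cond_expectation_limit[OF annealed_law(2)[OF \<nu>] Bm _ ratio_bounds lim])
    show "?r n \<in> borel_measurable ?P" for n
      by (subst measurable_cong_sets[OF sets_P refl]) (rule rm)
    show "(\<lambda>n. measure ?P {x' \<in> space ?P. ?B n x'}) \<longlonglongrightarrow> (\<integral>s. 1 - extinct_prob (env s) \<partial>\<nu>)"
      unfolding surv by (rule surv_lim)
  qed (rule pos)
  then show ?thesis
    by (simp only: Zr Zp case_prod_beta' c_def)
qed

end

text \<open>What remains is a transfer. The hypotheses under \<open>P\<close> concern the
  environment or the root mark only, so they pass to the law of the environment and to the kernel,
  and stationarity and ergodicity become properties of the shift on sequences.\<close>

theorem theorem12p1:
  fixes M :: "'w measure" and \<Theta> :: "'t measure"
    and \<xi> :: "nat \<Rightarrow> 'w \<Rightarrow> 't" and \<eta> :: "'t \<Rightarrow> mark measure"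
    and P :: "((nat \<Rightarrow> 't) \<times> marks) measure"
    and \<epsilon> :: real
  assumes "prob_space M"
    and "\<And>n. \<xi> n \<in> M \<rightarrow>\<^sub>M \<Theta>"
    and "stationary_seq M \<Theta> \<xi>"
    and "ergodic_seq M \<Theta> \<xi>"
    and "\<eta> \<in> \<Theta> \<rightarrow>\<^sub>M prob_algebra mark_space"
    and P: "P = annealed \<eta> (env_law M \<Theta> \<xi>)"
    \<comment> \<open>\<open>E log m\<^sub>0 \<in> (0, \<infinity>)\<close>\<close>
    and "AE (s, X) in P. 0 < mean_offspring \<eta> s 0 \<and> mean_offspring \<eta> s 0 < \<infinity>"
    and "integrable P (\<lambda>(s, X). ln (enn2real (mean_offspring \<eta> s 0)))"
    and "0 < (\<integral>(s, X). ln (enn2real (mean_offspring \<eta> s 0)) \<partial>P)"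
    and "(\<integral>\<^sup>+(s, X). of_nat (fst (X [])) / mean_offspring \<eta> s 0
            * ennreal (log_plus (real (fst (X [])))) \<partial>P) < \<infinity>"
    and "\<epsilon> > 0"
    and "(\<integral>\<^sup>+(s, X). ennreal (\<bar>mean_disp \<eta> s 0\<bar> powr \<epsilon>) \<partial>P) < \<infinity>"
    and "0 < (\<integral>\<^sup>+(s, X). var_disp \<eta> s 0 \<partial>P)"
    and "(\<integral>\<^sup>+(s, X). var_disp \<eta> s 0 \<partial>P) < \<infinity>"
  shows "\<forall>x::real.
    (AE (s, X) in P.
       (\<lambda>n. cond_expectation (quenched \<eta> s) (\<lambda>Y. measure (Z Y n) UNIV > 0)
              (\<lambda>Y. measure (Z Y n) {..scaling \<eta> s n * x + centering \<eta> s n} / measure (Z Y n) UNIV))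
       \<longlonglongrightarrow> cdf std_normal_distribution x) \<and>
    (\<lambda>n. cond_expectation P (\<lambda>(s, Y). measure (Z Y n) UNIV > 0)
           (\<lambda>(s, Y). measure (Z Y n) {..scaling \<eta> s n * x + centering \<eta> s n} / measure (Z Y n) UNIV))
       \<longlonglongrightarrow> cdf std_normal_distribution x"
proof -
  define \<nu> where "\<nu> = env_law M \<Theta> \<xi>"
  have seq: "(\<lambda>w n. \<xi> n w) \<in> M \<rightarrow>\<^sub>M (\<Pi>\<^sub>M n\<in>UNIV. \<Theta>)"
    using assms(2) by (intro measurable_PiM_single') (auto simp: measurable_space[OF assms(2)])
  have \<nu>: "prob_space \<nu>"
    unfolding \<nu>_def env_law_def by (rule prob_space.prob_space_distr[OF assms(1) seq])
  have sets_\<nu>: "sets \<nu> = sets (\<Pi>\<^sub>M n\<in>UNIV. \<Theta>)" by (simp add: \<nu>_def env_law_def)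
  have space_env: "space \<nu> = space (\<Pi>\<^sub>M n\<in>UNIV. \<Theta>)" by (rule sets_eq_imp_space_eq[OF sets_\<nu>])
  interpret mark_kernel \<nu> \<Theta> \<eta> by unfold_locales (rule sets_\<nu>, rule assms(5))
  have shift_m: "shift \<in> \<nu> \<rightarrow>\<^sub>M \<nu>"
    unfolding measurable_cong_sets[OF sets_\<nu> sets_\<nu>] shift_def[abs_def]
    by (intro measurable_PiM_single' measurable_component_singleton) (auto simp: space_PiM)
  have "distr \<nu> \<nu> shift = distr (distr M (\<Pi>\<^sub>M n\<in>UNIV. \<Theta>) (\<lambda>w n. \<xi> n w)) (\<Pi>\<^sub>M n\<in>UNIV. \<Theta>) shift"
    unfolding \<nu>_def env_law_def by (intro distr_cong) auto
  also have "\<dots> = distr M (\<Pi>\<^sub>M n\<in>UNIV. \<Theta>) (shift \<circ> (\<lambda>w n. \<xi> n w))"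
    using shift_m unfolding measurable_cong_sets[OF sets_\<nu> sets_\<nu>] by (rule distr_distr[OF _ seq])
  also have "shift \<circ> (\<lambda>w n. \<xi> n w) = (\<lambda>w n. \<xi> (Suc n) w)" by (simp add: fun_eq_iff shift_def)
  also have "distr M (\<Pi>\<^sub>M n\<in>UNIV. \<Theta>) (\<lambda>w n. \<xi> (Suc n) w) = \<nu>"
    using assms(3) by (simp add: stationary_seq_def env_law_def \<nu>_def)
  finally have distr_shift: "distr \<nu> \<nu> shift = \<nu>" .
  have erg: "ergodic_system \<nu> shift"
  proof (intro ergodic_system.intro ergodic_system_axioms.intro \<nu> shift_m distr_shift)
    fix A assume A: "A \<in> sets \<nu>" "shift -` A \<inter> space \<nu> = A"
    have "{s \<in> space (\<Pi>\<^sub>M n\<in>(UNIV::nat set). \<Theta>). (\<lambda>n. s (Suc n)) \<in> A} = shift -` A \<inter> space \<nu>"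
      unfolding space_env shift_def[abs_def] by blast
    then show "measure \<nu> A = 0 \<or> measure \<nu> A = 1"
      using assms(4) A unfolding ergodic_seq_def \<nu>_def[symmetric] sets_\<nu> by simp
  qed
  have P_eq: "P = annealed \<eta> \<nu>" using P by (simp add: \<nu>_def)
  note sets_P = annealed_law(1)[OF \<nu>, folded P_eq] and distr_P = annealed_law(3)[OF \<nu>, folded P_eq]
  have fst_m: "fst \<in> P \<rightarrow>\<^sub>M \<nu>" by (subst measurable_cong_sets[OF sets_P refl]) measurable
  have mo: "mean_offspring \<eta> s n = (\<integral>\<^sup>+p. of_nat (fst p) \<partial>\<eta> (s n))" for s n
    by (simp add: mean_offspring_def)
  have om: "enn2real (mean_offspring \<eta> s n) = offspring_mean (\<eta> (s n))" for s n
    by (simp add: mo offspring_mean_def)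
  have mo_m: "(\<lambda>s. mean_offspring \<eta> s 0) \<in> borel_measurable \<nu>"
    unfolding mo by (rule measurable_compose[OF coordinate_measurable offspring_total_measurable])
  have ln_m: "(\<lambda>s. ln (offspring_mean (\<eta> (s 0)))) \<in> borel_measurable \<nu>"
    by measurable
  have mean: "AE s in \<nu>. 0 < mean_offspring \<eta> s 0 \<and> mean_offspring \<eta> s 0 < \<infinity>"
  proof -
    have "{s \<in> space \<nu>. 0 < mean_offspring \<eta> s 0 \<and> mean_offspring \<eta> s 0 < \<infinity>} \<in> sets \<nu>"
      using mo_m by measurable
    from AE_distr_iff[OF fst_m this] show ?thesis
      using assms(7) unfolding distr_P case_prod_beta' by (rule iffD2)
  qed
  interpret random_environment \<nu> \<Theta> \<eta>
  proof (intro random_environment.intro random_environment_axioms.intro erg)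
    show "mark_kernel \<nu> \<Theta> \<eta>" by unfold_locales
    show "AE s in \<nu>. 0 < (\<integral>\<^sup>+p. of_nat (fst p) \<partial>\<eta> (s 0)) \<and> (\<integral>\<^sup>+p. of_nat (fst p) \<partial>\<eta> (s 0)) < \<infinity>"
      using mean by (simp only: mo)
    show "integrable \<nu> (\<lambda>s. ln (offspring_mean (\<eta> (s 0))))"
      using assms(8) integrable_distr_eq[OF fst_m ln_m] unfolding distr_P case_prod_beta' om by (rule iffD2[rotated])
    show "0 < (\<integral>s. ln (offspring_mean (\<eta> (s 0))) \<partial>\<nu>)"
      using assms(9) integral_distr[OF fst_m ln_m] by (simp add: distr_P case_prod_beta' om)
    have "(\<lambda>s. disp_var (\<eta> (s 0))) \<in> borel_measurable \<nu>" by measurable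
    then have var_m: "(\<lambda>s. disp_var (\<eta> (s 0))) \<in> borel_measurable (distr P \<nu> fst)" by simp
    have "(\<integral>\<^sup>+s. disp_var (\<eta> (s 0)) \<partial>\<nu>) = (\<integral>\<^sup>+(s, X). var_disp \<eta> s 0 \<partial>P)"
      using nn_integral_distr[OF fst_m var_m] by (simp add: distr_P case_prod_beta' var_disp_eq)
    then show "0 < (\<integral>\<^sup>+s. disp_var (\<eta> (s 0)) \<partial>\<nu>)" "(\<integral>\<^sup>+s. disp_var (\<eta> (s 0)) \<partial>\<nu>) < \<infinity>"
      using assms(13,14) by simp_all
    \<comment> \<open>The moment condition is stated for the root mark under \<open>P\<close>.
      Disintegration and the law of the root turn it into the kernel integral of the locale, where
      extended division agrees with real division because the mean is positive and finite.\<close>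
    let ?g = "\<lambda>s p. of_nat (fst p) / mean_offspring \<eta> s 0 * ennreal (log_plus (real (fst p)))"
    have root: "(\<lambda>x. fst (snd x [])) \<in> \<nu> \<Otimes>\<^sub>M tree_space \<rightarrow>\<^sub>M count_space UNIV"
      by (rule measurable_compose[OF measurable_compose[OF measurable_snd root_measurable] mark_measurable(1)])
    have g_m: "(\<lambda>x. ?g (fst x) (snd x [])) \<in> borel_measurable (\<nu> \<Otimes>\<^sub>M tree_space)"
      by (intro borel_measurable_times_ennreal borel_measurable_divide_ennreal measurable_compose[OF measurable_fst mo_m]
          measurable_compose[OF root, of "of_nat :: nat \<Rightarrow> ennreal" borel]
          measurable_compose[OF root, of "\<lambda>n. ennreal (log_plus (real n))" borel]) auto
    have "(\<integral>\<^sup>+(s, X). of_nat (fst (X [])) / mean_offspring \<eta> s 0 * ennreal (log_plus (real (fst (X [])))) \<partial>P)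
      = (\<integral>\<^sup>+s. (\<integral>\<^sup>+X. ?g s (X []) \<partial>tree_law (env s)) \<partial>\<nu>)"
      unfolding P_eq case_prod_beta' by (subst nn_integral_annealed[OF g_m]) simp
    also have "\<dots> = (\<integral>\<^sup>+s. \<integral>\<^sup>+p. ennreal (real (fst p) / offspring_mean (\<eta> (s 0)) * log_plus (real (fst p))) \<partial>\<eta> (s 0) \<partial>\<nu>)"
    proof (rule nn_integral_cong_AE)
      show "AE s in \<nu>. (\<integral>\<^sup>+X. ?g s (X []) \<partial>tree_law (env s))
        = (\<integral>\<^sup>+p. ennreal (real (fst p) / offspring_mean (\<eta> (s 0)) * log_plus (real (fst p))) \<partial>\<eta> (s 0))"
        using mean AE_space
      proof eventually_elim
        case (elim s)
        have mo_eq: "mean_offspring \<eta> s 0 = ennreal (offspring_mean (\<eta> (s 0)))"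
          using elim by (simp add: om[symmetric])
        have pos: "offspring_mean (\<eta> (s 0)) > 0"
          using elim by (simp add: om[symmetric] enn2real_positive_iff)
        have gm: "?g s \<in> borel_measurable mark_space"
          by (rule measurable_compose[OF mark_measurable(1), of "\<lambda>n. of_nat n / mean_offspring \<eta> s 0 * ennreal (log_plus (real n))"]) simp
        have "(\<integral>\<^sup>+X. ?g s (X []) \<partial>tree_law (env s)) = (\<integral>\<^sup>+p. ?g s p \<partial>env s 0)"
          by (rule nn_integral_root[OF mark_laws_env[OF elim(2)] gm])
        also have "\<dots> = (\<integral>\<^sup>+p. ennreal (real (fst p) / offspring_mean (\<eta> (s 0)) * log_plus (real (fst p))) \<partial>\<eta> (s 0))"
          unfolding env_def
        proof (intro nn_integral_cong)
          fix p :: mark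
          have "of_nat (fst p) / mean_offspring \<eta> s 0 = ennreal (real (fst p) / offspring_mean (\<eta> (s 0)))"
            unfolding mo_eq ennreal_of_nat_eq_real_of_nat using pos by (intro divide_ennreal) auto
          moreover have "log_plus (real (fst p)) \<ge> 0" by (simp add: log_plus_def)
          ultimately show "?g s p = ennreal (real (fst p) / offspring_mean (\<eta> (s 0)) * log_plus (real (fst p)))"
            using pos by (simp only: ennreal_mult divide_nonneg_nonneg of_nat_0_le_iff less_imp_le)
        qed
        finally show ?case .
      qed
    qed
    finally show "(\<integral>\<^sup>+s. \<integral>\<^sup>+p. ennreal (real (fst p) / offspring_mean (\<eta> (s 0)) * log_plus (real (fst p))) \<partial>\<eta> (s 0) \<partial>\<nu>) < \<infinity>"
      using assms(10) by simp
  qed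
  have env_eq: "env s = (\<lambda>n. \<eta> (s n))" for s by (simp add: env_def fun_eq_iff)
  have reg: "AE y in P. regular (env (fst y))"
    by (rule AE_distrD[OF fst_m]) (simp only: distr_P AE_regular)
  show ?thesis
  proof (intro allI conjI)
    fix x :: real
    show "AE (s, X) in P.
       (\<lambda>n. cond_expectation (quenched \<eta> s) (\<lambda>Y. measure (Z Y n) UNIV > 0)
              (\<lambda>Y. measure (Z Y n) {..scaling \<eta> s n * x + centering \<eta> s n} / measure (Z Y n) UNIV))
       \<longlonglongrightarrow> cdf std_normal_distribution x"
      using reg
    proof eventually_elim
      case (elim y)
      then show ?case
        using regular_quenched[OF elim, of x] by (simp add: case_prod_beta' quenched_eq_tree_law barrier_eq env_eq)
    qed
    show "(\<lambda>n. cond_expectation P (\<lambda>(s, Y). measure (Z Y n) UNIV > 0)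
           (\<lambda>(s, Y). measure (Z Y n) {..scaling \<eta> s n * x + centering \<eta> s n} / measure (Z Y n) UNIV))
       \<longlonglongrightarrow> cdf std_normal_distribution x"
      using annealed_limit[of x] by (simp add: P_eq barrier_eq env_eq)
  qed
qed

end
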